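(* Let $n\ge 1$, let $X=L^{1}(\mathbb{R}^{n};\mathbb{R}^{n})$ be the Banach space of integrable vector fields on $\mathbb{R}^n$, and let $$N=\Bigl\{(f_{j})_{1\le j\le n}\in X:\ \sum_{1\le j\le n}\frac{\partial f_{j}}{\partial x_{j}}=0 \text{ in the sense of distributions}\Bigr\},$$ which is a closed subspace of $X$. Then the Lipschitz-free space $\mathcal{F}(\mathbb{R}^n)$ over $\mathbb{R}^n$ is isometric to the quotient Banach space $X/N$, and $$\mathrm{Lip}_0(\mathbb{R}^n)=(X/N)^{*}\quad\text{(isometrically)}.$$
   Context: $\mathbb{R}^n$ carries the Euclidean norm $|\cdot|$ and Lebesgue measure, and $L^{1}(\mathbb{R}^{n};\mathbb{R}^{n})$ is normed by $\|F\|_1=\int_{\mathbb{R}^n}|F(x)|\,dx$. $\mathrm{Lip}_0(\mathbb{R}^n)$ is the Banach space of Lipschitz functions $f:\mathbb{R}^n\to\mathbb{R}$ with $f(0)=0$, with norm $\|f\|=\sup_{x\ne y}\frac{|f(x)-f(y)|}{|x-y|}=\|\nabla f\|_{L^\infty(\mathbb{R}^n)}$. The Lipschitz-free space $\mathcal{F}(\mathbb{R}^n)$ is the canonical isometric predual of $\mathrm{Lip}_0(\mathbb{R}^n)$, i.e. the norm-closed linear span in $\mathrm{Lip}_0(\mathbb{R}^n)^*$ of the evaluation functionals $\delta_x: f\mapsto f(x)$, $x\in\mathbb{R}^n$. *)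

theory Defs
  imports "HOL-Analysis.Analysis"
begin

section \<open>A completeness criterion\<close>

lemma Cauchy_converges_if_abs_summable_sums:
  fixes X :: "nat \<Rightarrow> 'a::real_normed_vector"
  assumes sums: "\<And>f :: nat \<Rightarrow> 'a. summable (\<lambda>n. norm (f n)) \<Longrightarrow> summable f"
    and X: "Cauchy X"
  shows "convergent X"
proof -
  have "\<exists>N. \<forall>m\<ge>N. \<forall>n\<ge>N. dist (X m) (X n) < (1/2)^k" for k :: nat
    using X by (intro metric_CauchyD) auto
  then obtain N where N: "\<And>k m n. m \<ge> N k \<Longrightarrow> n \<ge> N k \<Longrightarrow> dist (X m) (X n) < (1/2)^k"
    by metis
  define r where "r k = k + (\<Sum>i\<le>k. N i)" for k
  have rN: "N k \<le> r k" for k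
    unfolding r_def by (rule trans_le_add2, rule member_le_sum) auto
  have r: "strict_mono r"
    by (rule strict_mono_Suc_iff[THEN iffD2]) (auto simp: r_def)
  define f where "f k = X (r (Suc k)) - X (r k)" for k
  have "norm (f k) \<le> (1/2)^k" for k
  proof -
    have "r k \<le> r (Suc k)"
      using r by (simp add: strict_mono_less_eq)
    then show ?thesis
      using N[of k "r (Suc k)" "r k"] rN[of k] by (simp add: f_def dist_norm)
  qed
  then have "summable (\<lambda>k. norm (f k))"
    by (intro summable_comparison_test[OF _ summable_geometric[of "1/2::real"]]) auto
  then have "summable f"
    by (rule sums)
  then have "convergent (\<lambda>n. \<Sum>k<n. f k)"
    by (simp add: summable_iff_convergent)
  moreover have "(\<Sum>k<n. f k) = X (r n) - X (r 0)" for n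
    unfolding f_def by (rule sum_lessThan_telescope)
  ultimately obtain l where "(\<lambda>n. X (r n) - X (r 0)) \<longlonglongrightarrow> l"
    by (auto simp: convergent_def)
  then have "(\<lambda>n. (X (r n) - X (r 0)) + X (r 0)) \<longlonglongrightarrow> l + X (r 0)"
    by (intro tendsto_intros)
  then have "(X \<circ> r) \<longlonglongrightarrow> l + X (r 0)"
    by (simp add: o_def)
  then show ?thesis
    using Cauchy_converges_subseq[OF X r] unfolding convergent_def by blast
qed


section \<open>The space of integrable functions modulo null sets\<close>

definition L1_rel :: "('a::euclidean_space \<Rightarrow> 'b::{banach, second_countable_topology}) \<Rightarrow> ('a \<Rightarrow> 'b) \<Rightarrow> bool"
  where "L1_rel f g \<longleftrightarrow> integrable lebesgue f \<and> integrable lebesgue g \<and> (AE x in lebesgue. f x = g x)"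

lemma part_equivp_L1_rel: "part_equivp L1_rel"
proof (rule part_equivpI)
  show "\<exists>f. L1_rel f f"
    by (rule exI[of _ "\<lambda>_. 0"]) (simp add: L1_rel_def)
  show "symp L1_rel"
    by (auto simp: symp_def L1_rel_def)
  show "transp L1_rel"
    by (auto simp: transp_def L1_rel_def)
qed

quotient_type (overloaded) ('a, 'b) L1 =
  "'a::euclidean_space \<Rightarrow> 'b::{banach, second_countable_topology}" / partial: L1_rel
  by (rule part_equivp_L1_rel)

lemma L1_norm_cong:
  fixes f g :: "'a::euclidean_space \<Rightarrow> 'b::{banach, second_countable_topology}"
  assumes "L1_rel f g"
  shows "(\<integral>x. norm (f x) \<partial>lebesgue) = (\<integral>x. norm (g x) \<partial>lebesgue)"
  using assms unfolding L1_rel_def by (intro integral_cong_AE) auto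

instantiation L1 :: (euclidean_space, "{banach, second_countable_topology}") real_normed_vector
begin

lift_definition norm_L1 :: "('a, 'b) L1 \<Rightarrow> real" is "\<lambda>f. \<integral>x. norm (f x) \<partial>lebesgue"
  by (rule L1_norm_cong)

lift_definition zero_L1 :: "('a, 'b) L1" is "\<lambda>_. 0"
  by (simp add: L1_rel_def)

lift_definition plus_L1 :: "('a, 'b) L1 \<Rightarrow> ('a, 'b) L1 \<Rightarrow> ('a, 'b) L1" is "\<lambda>f g x. f x + g x"
  by (auto simp: L1_rel_def)

lift_definition minus_L1 :: "('a, 'b) L1 \<Rightarrow> ('a, 'b) L1 \<Rightarrow> ('a, 'b) L1" is "\<lambda>f g x. f x - g x"
  by (auto simp: L1_rel_def)

lift_definition uminus_L1 :: "('a, 'b) L1 \<Rightarrow> ('a, 'b) L1" is "\<lambda>f x. - f x"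
  by (auto simp: L1_rel_def)

lift_definition scaleR_L1 :: "real \<Rightarrow> ('a, 'b) L1 \<Rightarrow> ('a, 'b) L1" is "\<lambda>c f x. c *\<^sub>R f x"
  by (auto simp: L1_rel_def)

definition dist_L1 :: "('a, 'b) L1 \<Rightarrow> ('a, 'b) L1 \<Rightarrow> real"
  where "dist_L1 F G = norm (F - G)"

definition uniformity_L1 :: "(('a, 'b) L1 \<times> ('a, 'b) L1) filter"
  where "uniformity_L1 = (INF e\<in>{0<..}. principal {(F, G). dist F G < e})"

definition open_L1 :: "('a, 'b) L1 set \<Rightarrow> bool"
  where "open_L1 S \<longleftrightarrow> (\<forall>F\<in>S. \<forall>\<^sub>F (F', G) in uniformity. F' = F \<longrightarrow> G \<in> S)"

definition sgn_L1 :: "('a, 'b) L1 \<Rightarrow> ('a, 'b) L1"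
  where "sgn_L1 F = inverse (norm F) *\<^sub>R F"

instance
proof
  fix F G H :: "('a, 'b) L1" and a b :: real
  show "F + G + H = F + (G + H)" by transfer (auto simp: L1_rel_def add.assoc)
  show "F + G = G + F" by transfer (auto simp: L1_rel_def add.commute)
  show "0 + F = F" by transfer (auto simp: L1_rel_def)
  show "- F + F = 0" by transfer (auto simp: L1_rel_def)
  show "F - G = F + - G" by transfer (auto simp: L1_rel_def)
  show "a *\<^sub>R (F + G) = a *\<^sub>R F + a *\<^sub>R G" by transfer (auto simp: L1_rel_def scaleR_add_right)
  show "(a + b) *\<^sub>R F = a *\<^sub>R F + b *\<^sub>R F" by transfer (auto simp: L1_rel_def scaleR_add_left)
  show "a *\<^sub>R b *\<^sub>R F = (a * b) *\<^sub>R F" by transfer (auto simp: L1_rel_def)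
  show "1 *\<^sub>R F = F" by transfer (auto simp: L1_rel_def)
  show "dist F G = norm (F - G)" by (rule dist_L1_def)
  show "sgn F = inverse (norm F) *\<^sub>R F" by (rule sgn_L1_def)
  show "(uniformity :: (('a, 'b) L1 \<times> ('a, 'b) L1) filter) =
      (INF e\<in>{0<..}. principal {(F, G). dist F G < e})"
    by (rule uniformity_L1_def)
  show "open U = (\<forall>F\<in>U. \<forall>\<^sub>F (F', G) in uniformity. F' = F \<longrightarrow> G \<in> U)" for U :: "('a, 'b) L1 set"
    by (rule open_L1_def)
  show "norm F = 0 \<longleftrightarrow> F = 0"
    by transfer (auto simp: L1_rel_def integral_nonneg_eq_0_iff_AE)
  show "norm (F + G) \<le> norm F + norm G"
  proof transfer
    fix f g :: "'a \<Rightarrow> 'b" assume "L1_rel f f" "L1_rel g g"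
    then have f: "integrable lebesgue f" and g: "integrable lebesgue g"
      by (auto simp: L1_rel_def)
    have "(\<integral>x. norm (f x + g x) \<partial>lebesgue) \<le> (\<integral>x. norm (f x) + norm (g x) \<partial>lebesgue)"
      using f g by (intro integral_mono) (auto intro: norm_triangle_ineq)
    also have "\<dots> = (\<integral>x. norm (f x) \<partial>lebesgue) + (\<integral>x. norm (g x) \<partial>lebesgue)"
      using f g by simp
    finally show "(\<integral>x. norm (f x + g x) \<partial>lebesgue)
      \<le> (\<integral>x. norm (f x) \<partial>lebesgue) + (\<integral>x. norm (g x) \<partial>lebesgue)" .
  qed
  show "norm (a *\<^sub>R F) = \<bar>a\<bar> * norm F" by transfer simp
qed

end

lemma L1_cases:
  obtains f where "integrable lebesgue f" "F = abs_L1 f"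
proof -
  have "L1_rel (rep_L1 F) (rep_L1 F)" "abs_L1 (rep_L1 F) = F"
    by (rule Quotient_rep_reflp[OF Quotient_L1], rule Quotient_abs_rep[OF Quotient_L1])
  then show thesis
    using that[of "rep_L1 F"] by (simp add: L1_rel_def)
qed

lemma L1_rel_refl [simp]: "L1_rel f f \<longleftrightarrow> integrable lebesgue f"
  by (simp add: L1_rel_def)

lemma abs_L1_minus:
  "integrable lebesgue f \<Longrightarrow> integrable lebesgue g \<Longrightarrow> abs_L1 f - abs_L1 g = abs_L1 (\<lambda>x. f x - g x)"
  by (simp add: minus_L1.abs_eq)

lemma abs_L1_sum:
  "(\<And>i. i \<in> I \<Longrightarrow> integrable lebesgue (f i)) \<Longrightarrow> (\<Sum>i\<in>I. abs_L1 (f i)) = abs_L1 (\<lambda>x. \<Sum>i\<in>I. f i x)"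
  by (induction I rule: infinite_finite_induct) (simp_all add: zero_L1_def plus_L1.abs_eq)

lemma norm_abs_L1:
  "integrable lebesgue f \<Longrightarrow> norm (abs_L1 f) = (\<integral>x. norm (f x) \<partial>lebesgue)"
  by (simp add: norm_L1.abs_eq)

instance L1 :: (euclidean_space, "{banach, second_countable_topology}") banach
proof
  fix X :: "nat \<Rightarrow> ('a, 'b) L1"
  assume "Cauchy X"
  then show "convergent X"
  proof (rule Cauchy_converges_if_abs_summable_sums[rotated])
    fix F :: "nat \<Rightarrow> ('a, 'b) L1"
    assume summ: "summable (\<lambda>n. norm (F n))"
    have "\<exists>f. integrable lebesgue f \<and> F n = abs_L1 f" for n
      by (metis L1_cases)
    then obtain f where int: "\<And>n. integrable lebesgue (f n)" and F: "\<And>n. F n = abs_L1 (f n)"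
      by metis
    have [measurable]: "f n \<in> borel_measurable lebesgue" for n
      using int by auto
    have summ': "summable (\<lambda>n. \<integral>x. norm (f n x) \<partial>lebesgue)"
      using summ by (simp add: F int norm_abs_L1)
    have "(\<integral>\<^sup>+x. (\<Sum>n. ennreal (norm (f n x))) \<partial>lebesgue)
        = (\<Sum>n. \<integral>\<^sup>+x. ennreal (norm (f n x)) \<partial>lebesgue)"
      by (rule nn_integral_suminf) measurable
    also have "\<dots> = (\<Sum>n. ennreal (\<integral>x. norm (f n x) \<partial>lebesgue))"
      using int by (intro suminf_cong nn_integral_eq_integral) auto
    also have "\<dots> \<noteq> \<infinity>"
      using summ' by (simp add: suminf_ennreal2 ennreal_suminf_neq_top)
    finally have fin: "(\<integral>\<^sup>+x. (\<Sum>n. ennreal (norm (f n x))) \<partial>lebesgue) \<noteq> \<infinity>" .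
    have "AE x in lebesgue. (\<Sum>n. ennreal (norm (f n x))) \<noteq> \<infinity>"
      using fin by (intro nn_integral_PInf_AE) auto
    then have AE_summ: "AE x in lebesgue. summable (\<lambda>n. norm (f n x))"
      by eventually_elim (auto intro: summable_suminf_not_top)
    let ?w = "\<lambda>x. \<Sum>n. norm (f n x)" and ?S = "\<lambda>x. \<Sum>n. f n x"
    have w: "integrable lebesgue ?w"
      by (rule integrable_suminf) (simp_all add: int AE_summ summ')
    have S: "integrable lebesgue ?S"
      by (rule integrable_suminf) (fact int AE_summ summ')+
    define d where "d k x = norm ((\<Sum>n<k. f n x) - ?S x)" for k x
    have d_lim: "AE x in lebesgue. (\<lambda>k. d k x) \<longlonglongrightarrow> 0"
      using AE_summ
    proof eventually_elim
      case (elim x)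
      then have "(\<lambda>k. \<Sum>n<k. f n x) \<longlonglongrightarrow> ?S x"
        by (rule summable_LIMSEQ[OF summable_norm_cancel])
      then show ?case
        unfolding d_def by (intro tendsto_norm_zero LIM_zero)
    qed
    have d_bound: "AE x in lebesgue. norm (d k x) \<le> ?w x + norm (?S x)" for k
      using AE_summ
    proof eventually_elim
      case (elim x)
      have "norm (\<Sum>n<k. f n x) \<le> (\<Sum>n<k. norm (f n x))"
        by (rule norm_sum)
      also have "\<dots> \<le> ?w x"
        using elim by (intro sum_le_suminf) auto
      finally show ?case
        using norm_triangle_ineq4[of "\<Sum>n<k. f n x" "?S x"] by (simp add: d_def)
    qed
    have d_meas: "d k \<in> borel_measurable lebesgue" for k
    proof -
      have "integrable lebesgue (d k)"
        unfolding d_def using int S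
        by (intro integrable_norm Bochner_Integration.integrable_diff Bochner_Integration.integrable_sum)
      then show ?thesis
        by (rule borel_measurable_integrable)
    qed
    have "(\<lambda>k. \<integral>x. d k x \<partial>lebesgue) \<longlonglongrightarrow> (\<integral>x. 0 \<partial>(lebesgue :: 'a measure))"
      by (rule integral_dominated_convergence[OF borel_measurable_const d_meas
        Bochner_Integration.integrable_add[OF w integrable_norm[OF S]] d_lim d_bound])
    then have "(\<lambda>k. \<integral>x. norm ((\<Sum>n<k. f n x) - ?S x) \<partial>lebesgue) \<longlonglongrightarrow> 0"
      by (simp add: d_def)
    then have "(\<lambda>k. norm ((\<Sum>n<k. F n) - abs_L1 ?S)) \<longlonglongrightarrow> 0"
      using int S by (simp add: F abs_L1_sum abs_L1_minus norm_abs_L1)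
    then have "(\<lambda>k. \<Sum>n<k. F n) \<longlonglongrightarrow> abs_L1 ?S"
      by (rule LIM_zero_cancel[OF tendsto_norm_zero_cancel])
    then show "summable F"
      by (auto simp: summable_def sums_def)
  qed
qed


section \<open>Divergence-free integrable vector fields\<close>

definition partial_deriv :: "'n::finite \<Rightarrow> (real^'n \<Rightarrow> real) \<Rightarrow> real^'n \<Rightarrow> real"
  where "partial_deriv j f x = frechet_derivative f (at x) (axis j 1)"

text \<open>
  Every positive level requires differentiability at all points, so the value of
  \<open>frechet_derivative\<close> at points of non-differentiability is irrelevant; level \<open>0\<close> asks for
  continuity, hence \<open>Ck_fun k\<close> is the usual class of \<open>k\<close> times continuously differentiable functions.
\<close>

primrec Ck_fun :: "nat \<Rightarrow> (real^'n::finite \<Rightarrow> real) \<Rightarrow> bool"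
  where
    "Ck_fun 0 f \<longleftrightarrow> continuous_on UNIV f"
  | "Ck_fun (Suc k) f \<longleftrightarrow> (\<forall>x. f differentiable at x) \<and> (\<forall>j. Ck_fun k (partial_deriv j f))"

definition test_function :: "(real^'n::finite \<Rightarrow> real) \<Rightarrow> bool"
  where "test_function \<phi> \<longleftrightarrow> (\<forall>k. Ck_fun k \<phi>) \<and> compact (closure {x. \<phi> x \<noteq> 0})"

text \<open>
  The \<open>j\<close>-th distributional derivative of \<open>g\<close>, evaluated at the test function \<open>\<phi>\<close>. It is only
  meaningful when \<open>\<phi>\<close> is a test function and \<open>g\<close> is locally integrable.
\<close>

definition distr_partial :: "'n::finite \<Rightarrow> (real^'n \<Rightarrow> real) \<Rightarrow> (real^'n \<Rightarrow> real) \<Rightarrow> real"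
  where "distr_partial j g \<phi> = - (\<integral>x. g x * partial_deriv j \<phi> x \<partial>lebesgue)"

lemma test_function_partial_continuous:
  "test_function \<phi> \<Longrightarrow> continuous_on UNIV (partial_deriv j \<phi>)"
  unfolding test_function_def by (metis Ck_fun.simps)

lemma test_function_partial_measurable:
  "test_function \<phi> \<Longrightarrow> partial_deriv j \<phi> \<in> borel_measurable lebesgue"
  by (rule measurable_completion)
    (simp add: borel_measurable_continuous_onI test_function_partial_continuous)

lemma test_function_partial_bounded:
  fixes \<phi> :: "real^'n::finite \<Rightarrow> real"
  assumes "test_function \<phi>"
  obtains C where "C \<ge> 0" "\<And>j x. \<bar>partial_deriv j \<phi> x\<bar> \<le> C"
proof -
  let ?K = "closure {x. \<phi> x \<noteq> 0}"
  have K: "compact ?K"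
    using assms by (simp add: test_function_def)
  have zero: "partial_deriv j \<phi> x = 0" if "x \<notin> ?K" for j x
  proof -
    have "(\<phi> has_derivative (\<lambda>_. 0)) (at x)"
    proof (rule has_derivative_transform_within_open)
      show "((\<lambda>_. 0) has_derivative (\<lambda>_. 0)) (at x)" by simp
      show "open (- ?K)" by (rule open_Compl[OF closed_closure])
      show "x \<in> - ?K" using that by blast
      show "0 = \<phi> y" if "y \<in> - ?K" for y
        using that closure_subset[of "{x. \<phi> x \<noteq> 0}"] by auto
    qed
    then show ?thesis
      by (simp add: partial_deriv_def frechet_derivative_at[symmetric])
  qed
  have "\<exists>B. \<forall>x. \<bar>partial_deriv j \<phi> x\<bar> \<le> B" for j
  proof -
    have "compact (partial_deriv j \<phi> ` ?K)"
      using K test_function_partial_continuous[OF assms]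
      by (intro compact_continuous_image) (auto intro: continuous_on_subset)
    then obtain B where "B > 0" "\<And>x. x \<in> ?K \<Longrightarrow> \<bar>partial_deriv j \<phi> x\<bar> \<le> B"
      by (metis (no_types) bounded_pos compact_imp_bounded imageI real_norm_def)
    then have "\<bar>partial_deriv j \<phi> x\<bar> \<le> B" for x
      using zero[of x j] by (cases "x \<in> ?K") auto
    then show ?thesis by blast
  qed
  then obtain B where B: "\<And>j x. \<bar>partial_deriv j \<phi> x\<bar> \<le> B j"
    by metis
  show thesis
  proof (rule that[of "\<Sum>j\<in>UNIV. B j"])
    have "0 \<le> B j" for j
      using B[of j 0] by linarith
    then show "0 \<le> (\<Sum>j\<in>UNIV. B j)" and "\<bar>partial_deriv j \<phi> x\<bar> \<le> (\<Sum>j\<in>UNIV. B j)" for j x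
      using order_trans[OF B member_le_sum[of j UNIV B]] by (auto intro: sum_nonneg)
  qed
qed

text \<open>The distribution \<open>\<Sum>j. \<partial>f\<^sub>j/\<partial>x\<^sub>j\<close> vanishes on every test function.\<close>

lift_definition divergence_free :: "(real^'n::finite, real^'n) L1 \<Rightarrow> bool"
  is "\<lambda>f. \<forall>\<phi>. test_function \<phi> \<longrightarrow> (\<Sum>j\<in>UNIV. distr_partial j (\<lambda>x. f x $ j) \<phi>) = 0"
proof -
  fix f g :: "real^'n \<Rightarrow> real^'n"
  assume "L1_rel f g"
  then have [measurable]: "f \<in> borel_measurable lebesgue" "g \<in> borel_measurable lebesgue"
    and ae: "AE x in lebesgue. f x = g x"
    by (auto simp: L1_rel_def)
  have "distr_partial j (\<lambda>x. f x $ j) \<phi> = distr_partial j (\<lambda>x. g x $ j) \<phi>"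
    if "test_function \<phi>" for \<phi> j
  proof -
    note [measurable] = test_function_partial_measurable[OF that]
    have "(\<lambda>x. f x $ j) \<in> borel_measurable lebesgue" "(\<lambda>x. g x $ j) \<in> borel_measurable lebesgue"
      by (simp_all add: cart_eq_inner_axis)
    then show ?thesis
      unfolding distr_partial_def using ae
      by (intro arg_cong[where f = uminus] integral_cong_AE) (auto intro: borel_measurable_times
        test_function_partial_measurable[OF that])
  qed
  then show "(\<forall>\<phi>. test_function \<phi> \<longrightarrow> (\<Sum>j\<in>UNIV. distr_partial j (\<lambda>x. f x $ j) \<phi>) = 0) \<longleftrightarrow>
      (\<forall>\<phi>. test_function \<phi> \<longrightarrow> (\<Sum>j\<in>UNIV. distr_partial j (\<lambda>x. g x $ j) \<phi>) = 0)"
    by simp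
qed

definition div_free_fields :: "(real^'n::finite, real^'n) L1 set"
  where "div_free_fields = {F. divergence_free F}"

lemma integrable_component_times_partial:
  fixes f :: "real^'n::finite \<Rightarrow> real^'n"
  assumes f: "integrable lebesgue f" and \<phi>: "test_function \<phi>"
  shows "integrable lebesgue (\<lambda>x. f x $ j * partial_deriv j \<phi> x)"
proof -
  obtain C where "C \<ge> 0" and C: "\<And>j x. \<bar>partial_deriv j \<phi> x\<bar> \<le> C"
    using test_function_partial_bounded[OF \<phi>] by metis
  have [measurable]: "(\<lambda>x. f x $ j) \<in> borel_measurable lebesgue"
    using f by (simp add: cart_eq_inner_axis)
  note [measurable] = test_function_partial_measurable[OF \<phi>]
  show ?thesis
  proof (rule Bochner_Integration.integrable_bound)
    show "integrable lebesgue (\<lambda>x. norm (f x) * C)"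
      using f by simp
    show "AE x in lebesgue. norm (f x $ j * partial_deriv j \<phi> x) \<le> norm (norm (f x) * C)"
      using C \<open>C \<ge> 0\<close> component_le_norm_cart[of "f _" j]
      by (auto simp: abs_mult intro!: AE_I2 mult_mono)
  qed measurable
qed

lemma subspace_div_free_fields: "subspace (div_free_fields :: (real^'n::finite, real^'n) L1 set)"
proof (rule subspaceI)
  show "0 \<in> (div_free_fields :: (real^'n, real^'n) L1 set)"
    unfolding div_free_fields_def by (simp, transfer) (simp add: distr_partial_def)
  show "F + G \<in> div_free_fields" if "F \<in> div_free_fields" "G \<in> div_free_fields"
    for F G :: "(real^'n, real^'n) L1"
    using that unfolding div_free_fields_def mem_Collect_eq
  proof transfer
    fix f g :: "real^'n \<Rightarrow> real^'n"
    assume "L1_rel f f" "L1_rel g g"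
    then have int: "integrable lebesgue f" "integrable lebesgue g"
      by simp_all
    assume 0: "\<forall>\<phi>. test_function \<phi> \<longrightarrow> (\<Sum>j\<in>UNIV. distr_partial j (\<lambda>x. f x $ j) \<phi>) = 0"
      "\<forall>\<phi>. test_function \<phi> \<longrightarrow> (\<Sum>j\<in>UNIV. distr_partial j (\<lambda>x. g x $ j) \<phi>) = 0"
    have "distr_partial j (\<lambda>x. (f x + g x) $ j) \<phi> =
        distr_partial j (\<lambda>x. f x $ j) \<phi> + distr_partial j (\<lambda>x. g x $ j) \<phi>"
      if "test_function \<phi>" for j \<phi>
      using that int by (simp add: distr_partial_def distrib_right integrable_component_times_partial)
    then show "\<forall>\<phi>. test_function \<phi> \<longrightarrow> (\<Sum>j\<in>UNIV. distr_partial j (\<lambda>x. (f x + g x) $ j) \<phi>) = 0"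
      using 0 by (simp add: sum.distrib)
  qed
  show "c *\<^sub>R F \<in> div_free_fields" if "F \<in> div_free_fields" for c and F :: "(real^'n, real^'n) L1"
    using that unfolding div_free_fields_def mem_Collect_eq
  proof transfer
    fix c and f :: "real^'n \<Rightarrow> real^'n"
    assume 0: "\<forall>\<phi>. test_function \<phi> \<longrightarrow> (\<Sum>j\<in>UNIV. distr_partial j (\<lambda>x. f x $ j) \<phi>) = 0"
    have "distr_partial j (\<lambda>x. (c *\<^sub>R f x) $ j) \<phi> = c * distr_partial j (\<lambda>x. f x $ j) \<phi>" for j \<phi>
      by (simp add: distr_partial_def mult.assoc)
    then show "\<forall>\<phi>. test_function \<phi> \<longrightarrow> (\<Sum>j\<in>UNIV. distr_partial j (\<lambda>x. (c *\<^sub>R f x) $ j) \<phi>) = 0"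
      using 0 by (simp flip: sum_distrib_left)
  qed
qed

lemma closed_div_free_fields: "closed (div_free_fields :: (real^'n::finite, real^'n) L1 set)"
proof -
  have "F \<in> div_free_fields"
    if X: "\<And>k. X k \<in> div_free_fields" and lim: "X \<longlonglongrightarrow> F" for X and F :: "(real^'n, real^'n) L1"
  proof -
    obtain f where f: "integrable lebesgue f" "F = abs_L1 f"
      by (rule L1_cases)
    have "\<exists>g. integrable lebesgue g \<and> X k = abs_L1 g" for k
      by (metis L1_cases)
    then obtain g where g: "\<And>k. integrable lebesgue (g k)" "\<And>k. X k = abs_L1 (g k)"
      by metis
    have lim0: "(\<lambda>k. \<integral>x. norm (f x - g k x) \<partial>lebesgue) \<longlonglongrightarrow> 0"
    proof -
      have "(\<lambda>k. norm (F - X k)) \<longlonglongrightarrow> 0"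
        using tendsto_norm_zero[OF LIM_zero[OF lim]] by (simp add: norm_minus_commute)
      then show ?thesis
        using f g by (simp add: abs_L1_minus norm_abs_L1)
    qed
    have "(\<Sum>j\<in>UNIV. distr_partial j (\<lambda>x. f x $ j) \<phi>) = 0" if \<phi>: "test_function \<phi>" for \<phi>
    proof -
      obtain C where "C \<ge> 0" and C: "\<And>j x. \<bar>partial_deriv j \<phi> x\<bar> \<le> C"
        using test_function_partial_bounded[OF \<phi>] by metis
      let ?d = "\<lambda>h. \<Sum>j\<in>UNIV. distr_partial j (\<lambda>x. h x $ j) \<phi>"
      have bound: "\<bar>?d f\<bar> \<le> of_nat CARD('n) * (C * (\<integral>x. norm (f x - g k x) \<partial>lebesgue))" for k
      proof -
        let ?h = "\<lambda>x. f x - g k x"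
        have h: "integrable lebesgue ?h"
          using f g by simp
        have "?d (g k) = 0"
          using X[of k] \<phi> g[of k] by (simp add: div_free_fields_def divergence_free.abs_eq)
        moreover have "?d ?h = ?d f - ?d (g k)"
          using \<phi> f g by (simp add: distr_partial_def left_diff_distrib
            integrable_component_times_partial sum_subtractf sum_negf)
        ultimately have "?d f = ?d ?h"
          by simp
        also have "\<bar>?d ?h\<bar> \<le> (\<Sum>j\<in>(UNIV::'n set). C * (\<integral>x. norm (?h x) \<partial>lebesgue))"
        proof (rule order_trans[OF sum_abs], rule sum_mono)
          fix j :: 'n
          have "\<bar>distr_partial j (\<lambda>x. ?h x $ j) \<phi>\<bar> \<le> (\<integral>x. norm (?h x $ j * partial_deriv j \<phi> x) \<partial>lebesgue)"
            unfolding distr_partial_def abs_minus_cancel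
            using integral_norm_bound[of lebesgue "\<lambda>x. ?h x $ j * partial_deriv j \<phi> x"] by simp
          also have "\<dots> \<le> (\<integral>x. C * norm (?h x) \<partial>lebesgue)"
          proof (rule integral_mono)
            show "integrable lebesgue (\<lambda>x. norm (?h x $ j * partial_deriv j \<phi> x))"
              using integrable_component_times_partial[OF h \<phi>] by (rule integrable_norm)
            show "integrable lebesgue (\<lambda>x. C * norm (?h x))"
              using h by simp
            show "norm (?h x $ j * partial_deriv j \<phi> x) \<le> C * norm (?h x)" for x
              unfolding real_norm_def abs_mult mult.commute[of C]
              using C[of j x] component_le_norm_cart[of "?h x" j] by (intro mult_mono) auto
          qed
          finally show "\<bar>distr_partial j (\<lambda>x. ?h x $ j) \<phi>\<bar> \<le> C * (\<integral>x. norm (?h x) \<partial>lebesgue)"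
            by simp
        qed
        finally show ?thesis
          by simp
      qed
      have "(\<lambda>k. of_nat CARD('n) * (C * (\<integral>x. norm (f x - g k x) \<partial>lebesgue)))
          \<longlonglongrightarrow> of_nat CARD('n) * (C * 0)"
        by (intro tendsto_mult tendsto_const lim0)
      then have "\<bar>?d f\<bar> \<le> of_nat CARD('n) * (C * 0)"
        by (rule LIMSEQ_le_const) (use bound in blast)
      then show ?thesis
        by simp
    qed
    then show ?thesis
      using f by (simp add: div_free_fields_def divergence_free.abs_eq)
  qed
  then show ?thesis
    unfolding closed_sequential_limits by blast
qed


section \<open>The quotient of the integrable vector fields by the divergence-free ones\<close>

quotient_type (overloaded) 'n L1_mod_div_free = "(real^'n::finite, real^'n) L1" /
  "\<lambda>F G. F - G \<in> div_free_fields"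
proof (rule equivpI)
  show "reflp (\<lambda>F G :: (real^'n, real^'n) L1. F - G \<in> div_free_fields)"
    by (simp add: reflp_def subspace_0 subspace_div_free_fields)
  show "symp (\<lambda>F G :: (real^'n, real^'n) L1. F - G \<in> div_free_fields)"
    using subspace_neg[OF subspace_div_free_fields] by (force simp: symp_def)
  show "transp (\<lambda>F G :: (real^'n, real^'n) L1. F - G \<in> div_free_fields)"
    using subspace_add[OF subspace_div_free_fields] by (force simp: transp_def)
qed

lemma infdist_subspace_add:
  fixes x :: "'a::real_normed_vector"
  assumes S: "subspace S" and "x - y \<in> S"
  shows "infdist x S \<le> infdist y S"
proof -
  have "S \<noteq> {}"
    using S subspace_0 by blast
  moreover have "infdist x S \<le> dist y a" if "a \<in> S" for a
  proof -
    have "a + (x - y) \<in> S"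
      using S that assms(2) by (rule subspace_add)
    then show ?thesis
      using infdist_le[of "a + (x - y)" S x] by (simp add: dist_norm algebra_simps)
  qed
  ultimately show ?thesis
    unfolding infdist_notempty[OF \<open>S \<noteq> {}\<close>, of y] by (intro cINF_greatest)
qed

lemma infdist_almost_attained:
  fixes x :: "'a::metric_space"
  assumes "A \<noteq> {}" "e > 0"
  shows "\<exists>a\<in>A. dist x a < infdist x A + e"
proof -
  have "bdd_below (dist x ` A)"
    by (auto simp: bdd_below_def intro!: exI[of _ 0])
  then show ?thesis
    using assms cINF_less_iff[of A "dist x" "infdist x A + e"] by (simp add: infdist_notempty)
qed

instantiation L1_mod_div_free :: (finite) real_normed_vector
begin

lift_definition norm_L1_mod_div_free :: "'a L1_mod_div_free \<Rightarrow> real"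
  is "\<lambda>F. INF G\<in>div_free_fields. norm (F - G)"
proof -
  fix F G :: "(real^'a, real^'a) L1"
  assume FG: "F - G \<in> div_free_fields"
  then have "G - F \<in> div_free_fields"
    using subspace_neg[OF subspace_div_free_fields] by force
  with FG have "infdist F div_free_fields = infdist G div_free_fields"
    by (intro antisym infdist_subspace_add subspace_div_free_fields)
  moreover have "div_free_fields \<noteq> ({} :: (real^'a, real^'a) L1 set)"
    using subspace_div_free_fields subspace_0 by blast
  ultimately show "(INF H\<in>div_free_fields. norm (F - H)) = (INF H\<in>div_free_fields. norm (G - H))"
    by (simp add: infdist_def dist_norm)
qed

lift_definition zero_L1_mod_div_free :: "'a L1_mod_div_free" is 0 .

lift_definition plus_L1_mod_div_free :: "'a L1_mod_div_free \<Rightarrow> 'a L1_mod_div_free \<Rightarrow> 'a L1_mod_div_free"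
  is "(+)"
  using subspace_add[OF subspace_div_free_fields] by (force simp: algebra_simps)

lift_definition minus_L1_mod_div_free :: "'a L1_mod_div_free \<Rightarrow> 'a L1_mod_div_free \<Rightarrow> 'a L1_mod_div_free"
  is "(-)"
proof -
  fix F F' G G' :: "(real^'a, real^'a) L1"
  assume "F - F' \<in> div_free_fields" "G - G' \<in> div_free_fields"
  from subspace_diff[OF subspace_div_free_fields this]
  show "F - G - (F' - G') \<in> div_free_fields"
    by (simp add: algebra_simps)
qed

lift_definition uminus_L1_mod_div_free :: "'a L1_mod_div_free \<Rightarrow> 'a L1_mod_div_free" is uminus
  using subspace_neg[OF subspace_div_free_fields] by force

lift_definition scaleR_L1_mod_div_free :: "real \<Rightarrow> 'a L1_mod_div_free \<Rightarrow> 'a L1_mod_div_free" is scaleR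
  using subspace_scale[OF subspace_div_free_fields] by (force simp: scaleR_diff_right[symmetric])

definition dist_L1_mod_div_free :: "'a L1_mod_div_free \<Rightarrow> 'a L1_mod_div_free \<Rightarrow> real"
  where "dist_L1_mod_div_free F G = norm (F - G)"

definition uniformity_L1_mod_div_free :: "('a L1_mod_div_free \<times> 'a L1_mod_div_free) filter"
  where "uniformity_L1_mod_div_free = (INF e\<in>{0<..}. principal {(F, G). dist F G < e})"

definition open_L1_mod_div_free :: "'a L1_mod_div_free set \<Rightarrow> bool"
  where "open_L1_mod_div_free S \<longleftrightarrow> (\<forall>F\<in>S. \<forall>\<^sub>F (F', G) in uniformity. F' = F \<longrightarrow> G \<in> S)"

definition sgn_L1_mod_div_free :: "'a L1_mod_div_free \<Rightarrow> 'a L1_mod_div_free"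
  where "sgn_L1_mod_div_free F = inverse (norm F) *\<^sub>R F"

instance
proof
  let ?N = "div_free_fields :: (real^'a, real^'a) L1 set"
  have 0: "0 \<in> ?N"
    by (rule subspace_0[OF subspace_div_free_fields])
  have inf: "(INF G\<in>?N. norm (F - G)) = infdist F ?N" for F
    using 0 by (auto simp: infdist_def dist_norm)
  fix F G H :: "'a L1_mod_div_free" and a b :: real
  show "F + G + H = F + (G + H)" by transfer (simp add: 0 add.assoc)
  show "F + G = G + F" by transfer (simp add: 0 add.commute)
  show "0 + F = F" by transfer (simp add: 0)
  show "- F + F = 0" by transfer (simp add: 0)
  show "F - G = F + - G" by transfer (simp add: 0)
  show "a *\<^sub>R (F + G) = a *\<^sub>R F + a *\<^sub>R G" by transfer (simp add: 0 scaleR_add_right)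
  show "(a + b) *\<^sub>R F = a *\<^sub>R F + b *\<^sub>R F" by transfer (simp add: 0 scaleR_add_left)
  show "a *\<^sub>R b *\<^sub>R F = (a * b) *\<^sub>R F" by transfer (simp add: 0)
  show "1 *\<^sub>R F = F" by transfer (simp add: 0)
  show "dist F G = norm (F - G)" by (rule dist_L1_mod_div_free_def)
  show "sgn F = inverse (norm F) *\<^sub>R F" by (rule sgn_L1_mod_div_free_def)
  show "(uniformity :: ('a L1_mod_div_free \<times> 'a L1_mod_div_free) filter) =
      (INF e\<in>{0<..}. principal {(F, G). dist F G < e})"
    by (rule uniformity_L1_mod_div_free_def)
  show "open U = (\<forall>F\<in>U. \<forall>\<^sub>F (F', G) in uniformity. F' = F \<longrightarrow> G \<in> U)"
    for U :: "'a L1_mod_div_free set"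
    by (rule open_L1_mod_div_free_def)
  show "norm F = 0 \<longleftrightarrow> F = 0"
  proof transfer
    fix F :: "(real^'a, real^'a) L1"
    show "(INF G\<in>?N. norm (F - G)) = 0 \<longleftrightarrow> F - 0 \<in> ?N"
      unfolding inf using in_closed_iff_infdist_zero[OF closed_div_free_fields] 0 by auto
  qed
  show "norm (F + G) \<le> norm F + norm G"
  proof transfer
    fix F G :: "(real^'a, real^'a) L1"
    have "infdist (F + G) ?N \<le> infdist F ?N + infdist G ?N + e" if "e > 0" for e
    proof -
      have "\<exists>x\<in>?N. dist F x < infdist F ?N + e / 2" "\<exists>x\<in>?N. dist G x < infdist G ?N + e / 2"
        using that 0 by (auto intro!: infdist_almost_attained)
      then obtain A B where A: "A \<in> ?N" "dist F A < infdist F ?N + e / 2"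
        and B: "B \<in> ?N" "dist G B < infdist G ?N + e / 2"
        by blast
      have "infdist (F + G) ?N \<le> dist (F + G) (A + B)"
        using A B by (intro infdist_le subspace_add[OF subspace_div_free_fields])
      also have "\<dots> \<le> dist F A + dist G B"
        by (rule dist_triangle_add)
      finally show ?thesis
        using A B by simp
    qed
    then show "(INF H\<in>?N. norm (F + G - H)) \<le> (INF H\<in>?N. norm (F - H)) + (INF H\<in>?N. norm (G - H))"
      unfolding inf by (rule field_le_epsilon)
  qed
  show "norm (a *\<^sub>R F) = \<bar>a\<bar> * norm F"
  proof transfer
    fix a and F :: "(real^'a, real^'a) L1"
    have le: "infdist (c *\<^sub>R F) ?N \<le> \<bar>c\<bar> * infdist F ?N" if "c \<noteq> 0" for c and F :: "(real^'a, real^'a) L1"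
    proof -
      have "infdist (c *\<^sub>R F) ?N / \<bar>c\<bar> \<le> dist F x" if x: "x \<in> ?N" for x
      proof -
        have "infdist (c *\<^sub>R F) ?N \<le> dist (c *\<^sub>R F) (c *\<^sub>R x)"
          using x by (intro infdist_le subspace_scale[OF subspace_div_free_fields])
        also have "\<dots> = \<bar>c\<bar> * dist F x"
          by (simp add: dist_norm flip: scaleR_diff_right)
        finally show ?thesis
          using \<open>c \<noteq> 0\<close> by (simp add: field_simps)
      qed
      then have "infdist (c *\<^sub>R F) ?N / \<bar>c\<bar> \<le> infdist F ?N"
        using infdist_notempty[of ?N F] 0 cINF_greatest[of ?N _ "dist F"] by (metis empty_iff)
      then show ?thesis
        using \<open>c \<noteq> 0\<close> by (simp add: field_simps)
    qed
    show "(INF G\<in>?N. norm (a *\<^sub>R F - G)) = \<bar>a\<bar> * (INF G\<in>?N. norm (F - G))"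
    proof (cases "a = 0")
      case True
      then show ?thesis
        unfolding inf using 0 by simp
    next
      case False
      have "\<bar>a\<bar> * infdist F ?N \<le> infdist (a *\<^sub>R F) ?N"
        using le[of "inverse a" "a *\<^sub>R F"] False by (simp add: field_simps)
      with le[OF False, of F] show ?thesis
        by (simp add: inf)
    qed
  qed
qed

end

instance L1_mod_div_free :: (finite) banach
proof
  fix X :: "nat \<Rightarrow> 'a L1_mod_div_free"
  assume "Cauchy X"
  then show "convergent X"
  proof (rule Cauchy_converges_if_abs_summable_sums[rotated])
    let ?N = "div_free_fields :: (real^'a, real^'a) L1 set"
    let ?q = "abs_L1_mod_div_free :: _ \<Rightarrow> 'a L1_mod_div_free"
    have "?N \<noteq> {}"
      using subspace_div_free_fields subspace_0 by blast
    have norm_q: "norm (?q F) = infdist F ?N" for F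
      using \<open>?N \<noteq> {}\<close> by (simp add: norm_L1_mod_div_free.abs_eq infdist_def dist_norm)
    have q_le: "norm (?q F) \<le> norm F" for F
      unfolding norm_q using infdist_le[OF subspace_0[OF subspace_div_free_fields], of F] by simp
    fix F :: "nat \<Rightarrow> 'a L1_mod_div_free"
    assume summ: "summable (\<lambda>n. norm (F n))"
    have "\<exists>G. ?q G = F n \<and> norm G < norm (F n) + (1/2)^n" for n
    proof -
      obtain G where G: "F n = ?q G"
        by (metis Quotient_abs_rep[OF Quotient_L1_mod_div_free])
      obtain H where H: "H \<in> ?N" "dist G H < infdist G ?N + (1/2)^n"
        using infdist_almost_attained[OF \<open>?N \<noteq> {}\<close>, of "(1/2)^n" G] by auto
      have "?q (G - H) = ?q G"
        using H subspace_neg[OF subspace_div_free_fields] by (simp add: L1_mod_div_free.abs_eq_iff)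
      then show ?thesis
        using G H norm_q by (intro exI[of _ "G - H"]) (simp add: dist_norm)
    qed
    then obtain G where G: "\<And>n. ?q (G n) = F n" "\<And>n. norm (G n) < norm (F n) + (1/2)^n"
      by metis
    have "summable (\<lambda>n. norm (G n))"
      using G(2) by (intro summable_comparison_test[OF _ summable_add[OF summ summable_geometric[of "1/2::real"]]])
        (auto intro: less_imp_le)
    then have "summable G"
      by (rule summable_norm_cancel)
    then obtain S where S: "(\<lambda>k. \<Sum>n<k. G n) \<longlonglongrightarrow> S"
      by (auto simp: summable_def sums_def)
    have sum_q: "(\<Sum>n<k. F n) = ?q (\<Sum>n<k. G n)" for k
      by (induction k) (simp_all add: zero_L1_mod_div_free_def plus_L1_mod_div_free.abs_eq G(1)[symmetric])
    have "(\<lambda>k. (\<Sum>n<k. F n) - ?q S) \<longlonglongrightarrow> 0"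
    proof (rule Lim_null_comparison)
      show "\<forall>\<^sub>F k in sequentially. norm ((\<Sum>n<k. F n) - ?q S) \<le> norm ((\<Sum>n<k. G n) - S)"
        unfolding sum_q minus_L1_mod_div_free.abs_eq by (intro always_eventually allI q_le)
      show "(\<lambda>k. norm ((\<Sum>n<k. G n) - S)) \<longlonglongrightarrow> 0"
        using S by (simp add: LIM_zero tendsto_norm_zero)
    qed
    then show "summable F"
      unfolding summable_def sums_def by (intro exI[of _ "?q S"]) (rule LIM_zero_cancel)
  qed
qed


section \<open>Lipschitz functions vanishing at the origin and the Lipschitz-free space\<close>

typedef (overloaded) 'a lip0 = "{f :: 'a::euclidean_space \<Rightarrow> real. f 0 = 0 \<and> (\<exists>L. L-lipschitz_on UNIV f)}"
  morphisms lip0_fun Lip0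
  by (rule exI[of _ "\<lambda>_. 0"]) (auto intro: lipschitz_intros)

setup_lifting type_definition_lip0

text \<open>
  The supremum is over a nonempty set because a Euclidean space has positive dimension, and the
  quotients are bounded above for the functions in \<open>lip0\<close>.
\<close>

definition lip_const :: "('a::euclidean_space \<Rightarrow> real) \<Rightarrow> real"
  where "lip_const f = (SUP (x, y)\<in>{(x, y). x \<noteq> y}. \<bar>f x - f y\<bar> / norm (x - y))"

lemma lip_const_le:
  fixes f :: "'a::euclidean_space \<Rightarrow> real"
  assumes "\<And>x y. \<bar>f x - f y\<bar> \<le> L * norm (x - y)"
  shows "lip_const f \<le> L"
  unfolding lip_const_def
proof (rule cSUP_least)
  obtain b :: 'a where "b \<in> Basis"
    using nonempty_Basis by blast
  then have "(b, 0) \<in> {(x, y). x \<noteq> (y::'a)}"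
    by (auto simp: nonzero_Basis)
  then show "{(x, y). x \<noteq> (y::'a)} \<noteq> {}" by blast
qed (use assms in \<open>auto simp: divide_le_eq\<close>)

lemma lip_const_ge:
  fixes f :: "'a::euclidean_space \<Rightarrow> real"
  assumes "L-lipschitz_on UNIV f"
  shows "\<bar>f x - f y\<bar> \<le> lip_const f * norm (x - y)"
proof (cases "x = y")
  case False
  have "bdd_above ((\<lambda>(x, y). \<bar>f x - f y\<bar> / norm (x - y)) ` {(x, y). x \<noteq> y})"
    using lipschitz_onD[OF assms] by (auto simp: bdd_above_def divide_le_eq dist_norm intro!: exI[of _ L])
  then have "\<bar>f x - f y\<bar> / norm (x - y) \<le> lip_const f"
    unfolding lip_const_def using False by (intro cSUP_upper2[where x = "(x, y)"]) auto
  then show ?thesis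
    using False by (simp add: divide_le_eq)
qed simp

lemma lip_const_nonneg:
  fixes f :: "'a::euclidean_space \<Rightarrow> real"
  assumes "L-lipschitz_on UNIV f"
  shows "0 \<le> lip_const f"
proof -
  obtain b :: 'a where "b \<in> Basis"
    using nonempty_Basis by blast
  then have "0 \<le> lip_const f * norm b" "norm b = 1"
    using lip_const_ge[OF assms, of b 0] by (auto intro: order_trans[OF abs_ge_zero])
  then show ?thesis by simp
qed

instantiation lip0 :: (euclidean_space) real_normed_vector
begin

lift_definition norm_lip0 :: "'a lip0 \<Rightarrow> real" is lip_const .

lift_definition zero_lip0 :: "'a lip0" is "\<lambda>_. 0"
  by (auto intro: lipschitz_intros)

lift_definition plus_lip0 :: "'a lip0 \<Rightarrow> 'a lip0 \<Rightarrow> 'a lip0" is "\<lambda>f g x. f x + g x"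
  by (auto intro: lipschitz_on_add)

lift_definition minus_lip0 :: "'a lip0 \<Rightarrow> 'a lip0 \<Rightarrow> 'a lip0" is "\<lambda>f g x. f x - g x"
  by (auto intro: lipschitz_on_diff)

lift_definition uminus_lip0 :: "'a lip0 \<Rightarrow> 'a lip0" is "\<lambda>f x. - f x"
  by auto

lift_definition scaleR_lip0 :: "real \<Rightarrow> 'a lip0 \<Rightarrow> 'a lip0" is "\<lambda>c f x. c *\<^sub>R f x"
  by (auto intro: lipschitz_on_cmult_real)

definition dist_lip0 :: "'a lip0 \<Rightarrow> 'a lip0 \<Rightarrow> real"
  where "dist_lip0 f g = norm (f - g)"

definition uniformity_lip0 :: "('a lip0 \<times> 'a lip0) filter"
  where "uniformity_lip0 = (INF e\<in>{0<..}. principal {(f, g). dist f g < e})"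

definition open_lip0 :: "'a lip0 set \<Rightarrow> bool"
  where "open_lip0 S \<longleftrightarrow> (\<forall>f\<in>S. \<forall>\<^sub>F (f', g) in uniformity. f' = f \<longrightarrow> g \<in> S)"

definition sgn_lip0 :: "'a lip0 \<Rightarrow> 'a lip0"
  where "sgn_lip0 f = inverse (norm f) *\<^sub>R f"

instance
proof
  fix f g h :: "'a lip0" and a b :: real
  show "f + g + h = f + (g + h)" by transfer (simp add: add.assoc)
  show "f + g = g + f" by transfer (simp add: add.commute)
  show "0 + f = f" by transfer simp
  show "- f + f = 0" by transfer simp
  show "f - g = f + - g" by transfer simp
  show "a *\<^sub>R (f + g) = a *\<^sub>R f + a *\<^sub>R g" by transfer (simp add: algebra_simps)
  show "(a + b) *\<^sub>R f = a *\<^sub>R f + b *\<^sub>R f" by transfer (simp add: algebra_simps)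
  show "a *\<^sub>R b *\<^sub>R f = (a * b) *\<^sub>R f" by transfer (simp add: mult.assoc)
  show "1 *\<^sub>R f = f" by transfer simp
  show "dist f g = norm (f - g)" by (rule dist_lip0_def)
  show "sgn f = inverse (norm f) *\<^sub>R f" by (rule sgn_lip0_def)
  show "(uniformity :: ('a lip0 \<times> 'a lip0) filter) =
      (INF e\<in>{0<..}. principal {(f, g). dist f g < e})"
    by (rule uniformity_lip0_def)
  show "open U = (\<forall>f\<in>U. \<forall>\<^sub>F (f', g) in uniformity. f' = f \<longrightarrow> g \<in> U)" for U :: "'a lip0 set"
    by (rule open_lip0_def)
  show "norm f = 0 \<longleftrightarrow> f = 0"
  proof transfer
    fix f :: "'a \<Rightarrow> real"
    assume "f 0 = 0 \<and> (\<exists>L. L-lipschitz_on UNIV f)"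
    then obtain L where f: "f 0 = 0" "L-lipschitz_on UNIV f"
      by blast
    show "lip_const f = 0 \<longleftrightarrow> f = (\<lambda>_. 0)"
    proof
      assume "lip_const f = 0"
      then show "f = (\<lambda>_. 0)"
        using lip_const_ge[OF f(2), of _ 0] f(1) by auto
    next
      assume "f = (\<lambda>_. 0)"
      then show "lip_const f = 0"
        using lip_const_le[of f 0] lip_const_nonneg[OF f(2)] by auto
    qed
  qed
  show "norm (f + g) \<le> norm f + norm g"
  proof transfer
    fix f g :: "'a \<Rightarrow> real"
    assume "f 0 = 0 \<and> (\<exists>L. L-lipschitz_on UNIV f)" "g 0 = 0 \<and> (\<exists>L. L-lipschitz_on UNIV g)"
    then obtain L M where *: "L-lipschitz_on UNIV f" "M-lipschitz_on UNIV g"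
      by blast
    show "lip_const (\<lambda>x. f x + g x) \<le> lip_const f + lip_const g"
    proof (rule lip_const_le)
      show "\<bar>f x + g x - (f y + g y)\<bar> \<le> (lip_const f + lip_const g) * norm (x - y)" for x y
        using lip_const_ge[OF *(1), of x y] lip_const_ge[OF *(2), of x y]
        unfolding distrib_right by linarith
    qed
  qed
  show "norm (a *\<^sub>R f) = \<bar>a\<bar> * norm f"
  proof transfer
    fix a and f :: "'a \<Rightarrow> real"
    assume "f 0 = 0 \<and> (\<exists>L. L-lipschitz_on UNIV f)"
    then obtain L where f: "L-lipschitz_on UNIV f"
      by blast
    have le: "lip_const (\<lambda>x. c *\<^sub>R g x) \<le> \<bar>c\<bar> * lip_const g"
      if "M-lipschitz_on UNIV g" for c M and g :: "'a \<Rightarrow> real"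
    proof (rule lip_const_le)
      show "\<bar>c *\<^sub>R g x - c *\<^sub>R g y\<bar> \<le> \<bar>c\<bar> * lip_const g * norm (x - y)" for x y
        using mult_left_mono[OF lip_const_ge[OF that, of x y], of "\<bar>c\<bar>"]
        by (simp add: mult.assoc flip: right_diff_distrib abs_mult)
    qed
    have af: "(\<bar>a\<bar> * L)-lipschitz_on UNIV (\<lambda>x. a *\<^sub>R f x)"
      using f by (intro lipschitz_on_cmult)
    show "lip_const (\<lambda>x. a *\<^sub>R f x) = \<bar>a\<bar> * lip_const f"
    proof (cases "a = 0")
      case True
      then show ?thesis
        using le[OF f, of a] lip_const_nonneg[OF af] by simp
    next
      case False
      have "lip_const f \<le> \<bar>inverse a\<bar> * lip_const (\<lambda>x. a *\<^sub>R f x)"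
        using le[OF af, of "inverse a"] False by (simp flip: mult.assoc)
      then have "\<bar>a\<bar> * lip_const f \<le> lip_const (\<lambda>x. a *\<^sub>R f x)"
        using False by (simp add: field_simps)
      with le[OF f, of a] show ?thesis by simp
    qed
  qed
qed

end

lemma lip0_fun_diff_le: "\<bar>lip0_fun f x - lip0_fun f y\<bar> \<le> norm f * norm (x - y)"
  by transfer (auto intro: lip_const_ge)

lemma lip0_fun_le: "\<bar>lip0_fun f x\<bar> \<le> norm f * norm x"
  using lip0_fun_diff_le[of f x 0] lip0_fun[of f] by simp

instance lip0 :: (euclidean_space) banach
proof
  fix X :: "nat \<Rightarrow> 'a lip0"
  assume X: "Cauchy X"
  let ?f = "\<lambda>n. lip0_fun (X n)"
  have diff: "lip0_fun (f - g) x = lip0_fun f x - lip0_fun g x" for f g :: "'a lip0" and x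
    by transfer simp
  have "Cauchy (\<lambda>n. ?f n x)" for x
  proof (rule metric_CauchyI)
    fix e :: real
    assume "e > 0"
    then have "0 < e / (norm x + 1)"
      by (simp add: add_nonneg_pos)
    then obtain M where M: "\<And>m n. m \<ge> M \<Longrightarrow> n \<ge> M \<Longrightarrow> norm (X m - X n) < e / (norm x + 1)"
      using CauchyD[OF X] by metis
    have "dist (?f m x) (?f n x) < e" if "m \<ge> M" "n \<ge> M" for m n
    proof -
      have "dist (?f m x) (?f n x) \<le> norm (X m - X n) * norm x"
        using lip0_fun_le[of "X m - X n" x] by (simp add: dist_real_def diff)
      also have "\<dots> \<le> norm (X m - X n) * (norm x + 1)"
        by (intro mult_left_mono) auto
      also have "\<dots> < e"
        using M[OF that] by (simp add: pos_less_divide_eq add_nonneg_pos)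
      finally show ?thesis .
    qed
    then show "\<exists>M. \<forall>m\<ge>M. \<forall>n\<ge>M. dist (?f m x) (?f n x) < e"
      by blast
  qed
  then have "\<exists>l. (\<lambda>n. ?f n x) \<longlonglongrightarrow> l" for x
    by (simp add: real_Cauchy_convergent flip: convergent_def)
  then obtain f where f: "\<And>x. (\<lambda>n. ?f n x) \<longlonglongrightarrow> f x"
    by metis
  have close: "\<exists>M. \<forall>n\<ge>M. \<forall>x y. \<bar>(?f n x - f x) - (?f n y - f y)\<bar> \<le> e * norm (x - y)"
    if "e > 0" for e
  proof -
    obtain M where M: "\<And>m n. m \<ge> M \<Longrightarrow> n \<ge> M \<Longrightarrow> norm (X m - X n) < e"
      using CauchyD[OF X \<open>e > 0\<close>] by metis
    have "\<bar>(?f n x - f x) - (?f n y - f y)\<bar> \<le> e * norm (x - y)" if "n \<ge> M" for n x y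
    proof (rule LIMSEQ_le_const2)
      show "(\<lambda>m. \<bar>(?f n x - ?f m x) - (?f n y - ?f m y)\<bar>) \<longlonglongrightarrow> \<bar>(?f n x - f x) - (?f n y - f y)\<bar>"
        by (intro tendsto_intros f)
      have "\<bar>(?f n x - ?f m x) - (?f n y - ?f m y)\<bar> \<le> e * norm (x - y)" if "m \<ge> M" for m
      proof -
        have "\<bar>(?f n x - ?f m x) - (?f n y - ?f m y)\<bar> \<le> norm (X n - X m) * norm (x - y)"
          using lip0_fun_diff_le[of "X n - X m" x y] by (simp add: diff)
        also have "\<dots> \<le> e * norm (x - y)"
          using M[OF \<open>n \<ge> M\<close> that] by (intro mult_right_mono) auto
        finally show ?thesis .
      qed
      then show "\<exists>N. \<forall>m\<ge>N. \<bar>(?f n x - ?f m x) - (?f n y - ?f m y)\<bar> \<le> e * norm (x - y)"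
        by blast
    qed
    then show ?thesis by blast
  qed
  have f0: "f 0 = 0"
  proof -
    have "?f n 0 = 0" for n
      using lip0_fun[of "X n"] by simp
    then show ?thesis
      using f[of 0] by (simp add: LIMSEQ_const_iff)
  qed
  have "\<exists>L. L-lipschitz_on UNIV f"
  proof -
    obtain M where M: "\<And>x y. \<bar>(?f M x - f x) - (?f M y - f y)\<bar> \<le> 1 * norm (x - y)"
      using close[of 1] by auto
    have "(norm (X M) + 1)-lipschitz_on UNIV f"
    proof (rule lipschitz_onI)
      show "dist (f x) (f y) \<le> (norm (X M) + 1) * dist x y" for x y
        using M[of x y] lip0_fun_diff_le[of "X M" x y]
        unfolding dist_norm real_norm_def distrib_right by linarith
    qed (simp add: add_nonneg_nonneg)
    then show ?thesis by blast
  qed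
  with f0 obtain F where F: "lip0_fun F = f"
    using Lip0_inverse[of f] by blast
  have "X \<longlonglongrightarrow> F"
  proof (rule metric_LIMSEQ_I)
    fix e :: real
    assume "e > 0"
    then obtain M where M: "\<And>n x y. n \<ge> M \<Longrightarrow> \<bar>(?f n x - f x) - (?f n y - f y)\<bar> \<le> e / 2 * norm (x - y)"
      using close[of "e / 2"] by auto
    have "dist (X n) F < e" if "n \<ge> M" for n
    proof -
      have "norm (X n - F) \<le> e / 2"
        unfolding norm_lip0.rep_eq using M[OF that] by (intro lip_const_le) (simp add: diff F)
      then show ?thesis
        using \<open>e > 0\<close> by (simp add: dist_norm)
    qed
    then show "\<exists>M. \<forall>n\<ge>M. dist (X n) F < e"
      by blast
  qed
  then show "convergent X"
    by (auto simp: convergent_def)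
qed

lift_definition delta :: "'a::euclidean_space \<Rightarrow> 'a lip0 \<Rightarrow>\<^sub>L real" is "\<lambda>x f. lip0_fun f x"
proof (rule bounded_linear_intro)
  fix x :: 'a and f g :: "'a lip0" and c :: real
  show "lip0_fun (f + g) x = lip0_fun f x + lip0_fun g x" by transfer simp
  show "lip0_fun (c *\<^sub>R f) x = c *\<^sub>R lip0_fun f x" by transfer simp
  show "norm (lip0_fun f x) \<le> norm f * norm x"
    using lip0_fun_le by simp
qed

text \<open>
  \<open>lipschitz_free\<close> is a subset of the dual of \<open>lip0\<close> and carries the dual (operator) norm.
\<close>

definition lipschitz_free :: "('a::euclidean_space lip0 \<Rightarrow>\<^sub>L real) set"
  where "lipschitz_free = closure (span (range delta))"

end

theory Submission
  imports Defs
begin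

text \<open>
  A class in \<open>X/N\<close> is determined by its pairing \<open>\<phi> \<mapsto> \<integral>F \<bullet> \<nabla>\<phi>\<close> with test functions \<open>\<phi>\<close>, and this
  pairing is bounded by \<open>Lip \<phi>\<close> times the quotient norm. For points \<open>x\<close>, \<open>y\<close> there is a class of norm
  at most \<open>|x - y|\<close> with pairing \<open>\<phi> x - \<phi> y\<close>: spread the unit mass at \<open>y\<close> along segments over a small
  ball around the midpoint, then collect it again at \<open>x\<close>. Cutting a box into small
  pieces and translating it shows that the classes belonging to \<open>\<phi> x - \<phi> 0\<close> span a dense subspace.
  Every \<open>L\<close>-Lipschitz function is a pointwise limit of \<open>L\<close>-Lipschitz test functions, so it extends
  from this subspace to a functional of norm \<open>\<le> L\<close> on \<open>X/N\<close>; conversely a functional \<open>\<Psi>\<close> is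
  recovered from the Lipschitz function \<open>x \<mapsto> \<Psi> (point_class x)\<close>.
  By Hahn--Banach, evaluation at classes is then an
  isometry onto the closed span of the evaluation functionals.
\<close>


section \<open>Hahn--Banach\<close>

text \<open>The field that carries a unit mass straight from \<open>y\<close> to \<open>x\<close>
  lives on a segment, which is a null set when the dimension exceeds one, so it is not an element of
  \<open>L1\<close>. Routing through a ball cures this at the price of an extra \<open>e\<close> in
  the norm. The price disappears because the resulting class depends on its pairing only: the same
  class is obtained from every ball, and \<open>e\<close> can tend to zero. All constants have to be
  sharp, since an isometry and not merely an isomorphism is claimed. A second obstacle is that
  Lipschitz functions are not smooth while the divergence condition is tested on smooth functions
  only. No nonsmooth function is ever differentiated: the functional of a Lipschitz \<open>f\<close>
  is a limit of pairings with smooth approximants, and what makes that limit exist on the whole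
  quotient is the density of the span of the point classes. Density is therefore the technical
  centre.\<close>

text \<open>Homogeneity is demanded as an inequality because that form passes easily to infima; the
  reverse inequality follows by scaling back with \<open>inverse c\<close>.\<close>

definition sublinear :: "('a::real_vector \<Rightarrow> real) \<Rightarrow> bool"
  where "sublinear q \<longleftrightarrow> (\<forall>x y. q (x + y) \<le> q x + q y) \<and> (\<forall>c>0. \<forall>x. q (c *\<^sub>R x) \<le> c * q x)"

lemma sublinear_add: "sublinear q \<Longrightarrow> q (x + y) \<le> q x + q y"
  by (simp add: sublinear_def)

lemma sublinear_zero:
  assumes "sublinear q"
  shows "q 0 = 0"
proof -
  have "q ((1/2) *\<^sub>R 0) \<le> (1/2) * q 0"
    using assms unfolding sublinear_def by (metis half_gt_zero zero_less_one)
  then show ?thesis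
    using sublinear_add[OF assms, of 0 0] by simp
qed

lemma sublinear_scale:
  assumes "sublinear q" "c \<ge> 0"
  shows "q (c *\<^sub>R x) = c * q x"
proof (cases "c = 0")
  case False
  then have "c > 0"
    using assms by simp
  have "q (a *\<^sub>R y) \<le> a * q y" if "a > 0" for a y
    using assms that unfolding sublinear_def by blast
  from this[of c x] this[of "inverse c" "c *\<^sub>R x"] \<open>c > 0\<close>
  have "q (c *\<^sub>R x) \<le> c * q x" "q x \<le> inverse c * q (c *\<^sub>R x)"
    by simp_all
  then show ?thesis
    using \<open>c > 0\<close> by (simp add: field_simps)
qed (simp add: sublinear_zero[OF assms(1)])

lemma sublinear_ge: "sublinear q \<Longrightarrow> - q (- x) \<le> q x"
  using sublinear_add[of q x "- x"] sublinear_zero[of q] by simp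

text \<open>Equality \<open>r = q\<close> forces \<open>q (x + y) = q x + q y\<close>, so minimal sublinear functionals are linear.\<close>

lemma sublinear_lower:
  fixes q :: "'a::real_vector \<Rightarrow> real" and y :: 'a
  assumes q: "sublinear q"
  defines "r \<equiv> \<lambda>x. INF t\<in>{0..}. q (x + t *\<^sub>R y) - t * q y"
  shows "sublinear r" and "\<And>x t. t \<ge> 0 \<Longrightarrow> r x \<le> q (x + t *\<^sub>R y) - t * q y"
proof -
  have r: "r x = (INF t\<in>{0..}. q (x + t *\<^sub>R y) - t * q y)" for x
    by (simp add: r_def)
  \<comment> \<open>Subadditivity gives \<open>q (x + t *\<^sub>R y) + q (- x) \<ge> q (t *\<^sub>R
    y) = t * q y\<close>, a lower bound that does not involve \<open>t\<close>.\<close>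
  have bdd: "bdd_below ((\<lambda>t. q (x + t *\<^sub>R y) - t * q y) ` {0..})" for x
  proof (rule bdd_belowI2)
    fix t :: real
    assume "t \<in> {0..}"
    then show "- q (- x) \<le> q (x + t *\<^sub>R y) - t * q y"
      using sublinear_add[OF q, of "x + t *\<^sub>R y" "- x"] sublinear_scale[OF q, of t y] by simp
  qed
  show le: "r x \<le> q (x + t *\<^sub>R y) - t * q y" if "t \<ge> 0" for x t
    unfolding r using that by (intro cINF_lower[OF bdd]) auto
  show "sublinear r"
    unfolding sublinear_def
  proof (intro conjI allI impI)
    fix x z
    \<comment> \<open>The two infima are taken one after the other: \<open>s\<close> stays fixed
      while \<open>t\<close> varies, and the parameter for \<open>x + z\<close> is
      \<open>t + s\<close>.\<close>
    have "r (x + z) - (q (z + s *\<^sub>R y) - s * q y) \<le> r x" if "s \<ge> 0" for s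
      unfolding r[of x]
    proof (rule cINF_greatest)
      fix t :: real
      assume t: "t \<in> {0..}"
      have "r (x + z) \<le> q (x + z + (t + s) *\<^sub>R y) - (t + s) * q y"
        using that t by (intro le) auto
      also have "\<dots> \<le> q (x + t *\<^sub>R y) + q (z + s *\<^sub>R y) - (t + s) * q y"
        using sublinear_add[OF q, of "x + t *\<^sub>R y" "z + s *\<^sub>R y"] by (simp add: algebra_simps)
      finally show "r (x + z) - (q (z + s *\<^sub>R y) - s * q y) \<le> q (x + t *\<^sub>R y) - t * q y"
        by (simp add: algebra_simps)
    qed auto
    then have "r (x + z) - r x \<le> r z"
      unfolding r[of z] by (intro cINF_greatest) (auto simp: algebra_simps)
    then show "r (x + z) \<le> r x + r z"
      by simp
  next
    fix c :: real and x
    assume c: "c > 0"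
    have "r (c *\<^sub>R x) / c \<le> r x"
      unfolding r[of x]
    proof (rule cINF_greatest)
      fix t :: real
      assume t: "t \<in> {0..}"
      have "r (c *\<^sub>R x) \<le> q (c *\<^sub>R x + (c * t) *\<^sub>R y) - (c * t) * q y"
        using c t by (intro le) auto
      also have "\<dots> = c * (q (x + t *\<^sub>R y) - t * q y)"
        using c sublinear_scale[OF q, of c "x + t *\<^sub>R y"] by (simp add: algebra_simps)
      finally show "r (c *\<^sub>R x) / c \<le> q (x + t *\<^sub>R y) - t * q y"
        using c by (simp add: field_simps)
    qed auto
    then show "r (c *\<^sub>R x) \<le> c * r x"
      using c by (simp add: field_simps)
  qed
qed

text \<open>Zorn's lemma in the reversed order: the pointwise infimum of a nonempty chain is a lower
  bound, and it is finite because every member satisfies \<open>- p (- x) \<le> f x\<close>.\<close>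

lemma sublinear_minimal_exists:
  fixes p :: "'a::real_vector \<Rightarrow> real"
  assumes p: "sublinear p"
  obtains q where "sublinear q" "q \<le> p" "\<And>r. sublinear r \<Longrightarrow> r \<le> q \<Longrightarrow> r = q"
proof -
  let ?A = "{q. sublinear q \<and> q \<le> p}" and ?P = "\<lambda>f g :: 'a \<Rightarrow> real. g \<le> f"
  have "\<exists>m\<in>?A. \<forall>a\<in>?A. ?P m a \<longrightarrow> a = m"
  proof (rule predicate_Zorn)
    show "partial_order_on ?A (relation_of ?P ?A)"
      by (auto simp: partial_order_on_def preorder_on_def relation_of_def refl_on_def
        intro!: transI antisymI)
    fix C
    assume "C \<in> Chains (relation_of ?P ?A)"
    then have C: "\<And>f. f \<in> C \<Longrightarrow> sublinear f" "\<And>f. f \<in> C \<Longrightarrow> f \<le> p"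
      and chain: "\<And>f g. f \<in> C \<Longrightarrow> g \<in> C \<Longrightarrow> f \<le> g \<or> g \<le> f"
      by (auto simp: Chains_def relation_of_def)
    show "\<exists>u\<in>?A. \<forall>a\<in>C. ?P a u"
    proof (cases "C = {}")
      case False
      define u where "u x = (INF f\<in>C. f x)" for x
      have bdd: "bdd_below ((\<lambda>f. f x) ` C)" for x
      proof (rule bdd_belowI2)
        fix f
        assume "f \<in> C"
        then show "- p (- x) \<le> f x"
          using sublinear_ge[of f x] C le_funD[of f p "- x"] by force
      qed
      have le: "u x \<le> f x" if "f \<in> C" for f x
        unfolding u_def using bdd that by (rule cINF_lower)
      have "sublinear u"
        unfolding sublinear_def
      proof (intro conjI allI impI)
        fix x y
        \<comment> \<open>Only here is the chain property needed: the smaller of \<open>f\<close>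
          and \<open>g\<close> is subadditive and lies below both.\<close>
        have *: "u (x + y) \<le> f x + g y" if fg: "f \<in> C" "g \<in> C" for f g
        proof -
          obtain h where "h \<in> C" "h \<le> f" "h \<le> g"
            using chain[OF fg] fg by blast
          then show ?thesis
            using le[of h "x + y"] sublinear_add[OF C(1), of h x y] le_funD[of h f x] le_funD[of h g y]
            by linarith
        qed
        have "u (x + y) - g y \<le> u x" if "g \<in> C" for g
          unfolding u_def[of x] using False *[OF _ that] by (intro cINF_greatest) (auto simp: algebra_simps)
        then have "u (x + y) - u x \<le> u y"
          unfolding u_def[of y] using False by (intro cINF_greatest) (auto simp: algebra_simps)
        then show "u (x + y) \<le> u x + u y"
          by simp
      next
        fix c :: real and x
        assume c: "c > 0"
        have "u (c *\<^sub>R x) / c \<le> u x"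
          unfolding u_def[of x]
        proof (rule cINF_greatest[OF False])
          fix f
          assume "f \<in> C"
          then have "u (c *\<^sub>R x) \<le> c * f x"
            using le[of f "c *\<^sub>R x"] sublinear_scale[OF C(1), of f c x] c by simp
          then show "u (c *\<^sub>R x) / c \<le> f x"
            using c by (simp add: field_simps)
        qed
        then show "u (c *\<^sub>R x) \<le> c * u x"
          using c by (simp add: field_simps)
      qed
      moreover have "u \<le> p"
        using False le C(2) by (meson all_not_in_conv le_funI order_trans le_funD)
      ultimately show ?thesis
        using le by (intro bexI[of _ u]) (auto intro: le_funI)
    qed (use p in auto)
  qed
  then obtain m where "sublinear m" "m \<le> p" and m: "\<And>a. sublinear a \<Longrightarrow> a \<le> p \<Longrightarrow> a \<le> m \<Longrightarrow> a = m"
    by auto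
  then show thesis
    using that order_trans by metis
qed

lemma sublinear_minimal_linear:
  assumes q: "sublinear q" and min: "\<And>r. sublinear r \<Longrightarrow> r \<le> q \<Longrightarrow> r = q"
  shows "linear q"
proof -
  have add: "q (x + y) = q x + q y" for x y
  proof -
    define r where "r x = (INF t\<in>{0..}. q (x + t *\<^sub>R y) - t * q y)" for x
    note r = sublinear_lower[where y = y, OF q, folded r_def]
    have "r \<le> q"
      using r(2)[of 0] by (auto intro: le_funI)
    then have "r = q"
      using min r(1) by blast
    then show ?thesis
      using r(2)[of 1 x] sublinear_add[OF q, of x y] by simp
  qed
  have minus: "q (- x) = - q x" for x
    using add[of x "- x"] sublinear_zero[OF q] by simp
  show ?thesis
  proof (rule linearI[OF add])
    fix c :: real and x
    show "q (c *\<^sub>R x) = c *\<^sub>R q x"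
      using sublinear_scale[OF q, of c x] sublinear_scale[OF q, of "- c" x] minus[of "c *\<^sub>R x"]
      by (cases "c \<ge> 0") auto
  qed
qed

text \<open>The minimal functional is taken below the modification of the norm in direction
  \<open>a\<close>, not below the norm itself. With \<open>t = 1\<close> that modification is at
  most \<open>- norm a\<close> at \<open>- a\<close>, so linearity forces
  \<open>q a \<ge> norm a\<close>; no extension from a line is required.\<close>

lemma norming_functional:
  fixes a :: "'a::real_normed_vector"
  obtains \<Psi> :: "'a \<Rightarrow>\<^sub>L real" where "norm \<Psi> \<le> 1" "\<Psi> a = norm a"
proof -
  have "sublinear (norm :: 'a \<Rightarrow> real)"
    by (simp add: sublinear_def norm_triangle_ineq)
  note p = sublinear_lower[where y = a, OF this]
  obtain q where q: "sublinear q" "q \<le> (\<lambda>x. INF t\<in>{0..}. norm (x + t *\<^sub>R a) - t * norm a)"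
    "\<And>r. sublinear r \<Longrightarrow> r \<le> q \<Longrightarrow> r = q"
    using sublinear_minimal_exists[OF p(1)] by blast
  have le: "q x \<le> norm (x + t *\<^sub>R a) - t * norm a" if "t \<ge> 0" for x t
    using le_funD[OF q(2), of x] p(2)[OF that, of x] by linarith
  have lin: "linear q"
    using q by (intro sublinear_minimal_linear)
  have abs: "\<bar>q x\<bar> \<le> norm x" for x
    using le[of 0 x] le[of 0 "- x"] linear_neg[OF lin, of x] by auto
  have "bounded_linear q"
    by (rule bounded_linear_intro[where K = 1]) (use lin abs in \<open>auto simp: linear_iff\<close>)
  then have app: "blinfun_apply (Blinfun q) = q"
    by (rule bounded_linear_Blinfun_apply)
  show thesis
  proof
    show "norm (Blinfun q) \<le> 1"
      by (rule norm_blinfun_bound) (simp_all add: app abs)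
    show "Blinfun q a = norm a"
      using le[of 1 "- a"] abs[of a] linear_neg[OF lin, of a] by (simp add: app)
  qed
qed


section \<open>Smooth approximation of Lipschitz functions\<close>

text \<open>Derivatives of the classical function \<open>exp (- 1 / t)\<close> are polynomials in
  \<open>1 / t\<close> times it. Carrying the polynomial as a parameter gives a family closed under
  differentiation.\<close>

definition flat :: "real poly \<Rightarrow> real \<Rightarrow> real"
  where "flat P t = (if t > 0 then poly P (1 / t) * exp (- 1 / t) else 0)"

lemma poly_exp_minus_tendsto_0: "((\<lambda>s. poly P s * exp (- s :: real)) \<longlongrightarrow> 0) at_top"
proof -
  have "((\<lambda>s. \<Sum>i\<le>degree P. coeff P i * (s ^ i / exp s)) \<longlongrightarrow> (\<Sum>i\<le>degree P. coeff P i * 0)) at_top"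
    by (intro tendsto_intros tendsto_power_div_exp_0)
  then show ?thesis
    by (simp add: poly_altdef sum_distrib_right exp_minus divide_inverse mult.assoc)
qed

lemma flat_tendsto_0: "(flat P \<longlongrightarrow> 0) (at 0)"
proof (rule filterlim_split_at)
  show "(flat P \<longlongrightarrow> 0) (at_left 0)"
    by (rule tendsto_eventually) (auto simp: eventually_at_left_field flat_def intro: exI[of _ "-1"])
  have "((\<lambda>t. poly P (inverse t) * exp (- inverse t)) \<longlongrightarrow> 0) (at_right 0)"
    using filterlim_compose[OF poly_exp_minus_tendsto_0 filterlim_inverse_at_top_right] by simp
  then show "(flat P \<longlongrightarrow> 0) (at_right 0)"
    by (rule Lim_transform_eventually)
      (auto simp: eventually_at_right_field flat_def inverse_eq_divide intro: exI[of _ 1])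
qed

lemma flat_has_derivative:
  "(flat P has_real_derivative flat ([:0, 0, 1:] * (P - pderiv P)) t) (at t)"
proof (cases t "0::real" rule: linorder_cases)
  case less
  have "((\<lambda>_. 0) has_real_derivative 0) (at t)" by simp
  then have "(flat P has_real_derivative 0) (at t)"
    by (rule has_field_derivative_transform_within_open[of _ _ _ "{..<0}"]) (use less in \<open>auto simp: flat_def\<close>)
  then show ?thesis
    using less by (simp add: flat_def)
next
  case equal
  \<comment> \<open>The difference quotient at \<open>0\<close> is again a member of the family,
    with polynomial \<open>[:0, 1:] * P\<close>, so it tends to zero by the previous lemma.\<close>
  have "((\<lambda>t. (flat P (0 + t) - flat P 0) / t) \<longlongrightarrow> 0) (at 0)"
    using flat_tendsto_0[of "[:0, 1:] * P"]
    by (rule Lim_transform_eventually) (auto simp: flat_def)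
  then show ?thesis
    using equal by (simp add: DERIV_def flat_def)
next
  case greater
  have "((\<lambda>t. poly P (1 / t) * exp (- 1 / t)) has_real_derivative
      flat ([:0, 0, 1:] * (P - pderiv P)) t) (at t)"
    using greater
    by (auto intro!: derivative_eq_intros DERIV_chain2[OF poly_DERIV] simp: flat_def field_simps power2_eq_square)
  then show ?thesis
    by (rule has_field_derivative_transform_within_open[of _ _ _ "{0<..}"]) (use greater in \<open>auto simp: flat_def\<close>)
qed

section \<open>Gradients and closure properties of \<open>Ck_fun\<close>\<close>

lemma partial_deriv_eqI:
  "(f has_derivative f') (at x) \<Longrightarrow> partial_deriv j f x = f' (axis j 1)"
  by (simp add: partial_deriv_def frechet_derivative_at[symmetric])

definition grad :: "(real^'n::finite \<Rightarrow> real) \<Rightarrow> real^'n \<Rightarrow> real^'n"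
  where "grad f x = (\<chi> j. partial_deriv j f x)"

lemma grad_nth [simp]: "grad f x $ j = partial_deriv j f x"
  by (simp add: grad_def)

lemma has_derivative_grad:
  fixes f :: "real^'n::finite \<Rightarrow> real"
  assumes "f differentiable at x"
  shows "(f has_derivative (\<lambda>h. grad f x \<bullet> h)) (at x)"
proof -
  have D: "(f has_derivative frechet_derivative f (at x)) (at x)"
    using assms by (simp add: frechet_derivative_works)
  then have lin: "linear (frechet_derivative f (at x))"
    by (rule has_derivative_linear)
  have "frechet_derivative f (at x) h = grad f x \<bullet> h" for h
  proof -
    have "h = (\<Sum>j\<in>UNIV. h $ j *\<^sub>R axis j 1)"
      by (simp add: vec_eq_iff axis_def if_distrib cong: if_cong)
    then have "frechet_derivative f (at x) h = (\<Sum>j\<in>UNIV. frechet_derivative f (at x) (h $ j *\<^sub>R axis j 1))"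
      using linear_sum[OF lin] by metis
    then show ?thesis
      by (simp add: linear_scale[OF lin] partial_deriv_def inner_vec_def mult.commute)
  qed
  then have "frechet_derivative f (at x) = (\<lambda>h. grad f x \<bullet> h)"
    by (rule ext)
  with D show ?thesis by simp
qed

lemma Ck_fun_continuous: "Ck_fun k f \<Longrightarrow> continuous_on UNIV f"
proof (cases k)
  case (Suc l)
  assume "Ck_fun k f"
  with Suc have "\<And>x. f differentiable at x"
    by simp
  then show ?thesis
    by (intro differentiable_imp_continuous_on differentiable_at_imp_differentiable_on)
qed simp

lemma Ck_fun_Suc_imp: "Ck_fun (Suc k) f \<Longrightarrow> Ck_fun k f"
proof (induction k arbitrary: f)
  case 0
  then show ?case
    using Ck_fun_continuous[of "Suc 0" f] by simp
qed auto

lemma Ck_fun_const: "Ck_fun k (\<lambda>_. c)"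
proof (induction k arbitrary: c)
  case (Suc k)
  have "partial_deriv j (\<lambda>_. c) = (\<lambda>_. 0)" for j :: 'a
    by (rule ext, rule partial_deriv_eqI) (rule has_derivative_const)
  with Suc show ?case by simp
qed simp

lemma Ck_fun_add: "Ck_fun k f \<Longrightarrow> Ck_fun k g \<Longrightarrow> Ck_fun k (\<lambda>x. f x + g x)"
proof (induction k arbitrary: f g)
  case (Suc k)
  have "partial_deriv j (\<lambda>x. f x + g x) = (\<lambda>x. partial_deriv j f x + partial_deriv j g x)" for j
    using Suc.prems
    by (intro ext partial_deriv_eqI[THEN trans])
      (auto intro!: has_derivative_add simp: partial_deriv_def frechet_derivative_works[symmetric])
  with Suc show ?case by simp
qed (auto intro: continuous_intros)

lemma Ck_fun_mult: "Ck_fun k f \<Longrightarrow> Ck_fun k g \<Longrightarrow> Ck_fun k (\<lambda>x. f x * g x)"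
proof (induction k arbitrary: f g)
  case (Suc k)
  have "partial_deriv j (\<lambda>x. f x * g x) = (\<lambda>x. f x * partial_deriv j g x + partial_deriv j f x * g x)" for j
    using Suc.prems
    by (intro ext partial_deriv_eqI[THEN trans])
      (auto intro!: has_derivative_mult simp: partial_deriv_def frechet_derivative_works[symmetric])
  with Suc show ?case
    using Ck_fun_Suc_imp[OF Suc.prems(1)] Ck_fun_Suc_imp[OF Suc.prems(2)]
    by (auto intro!: Ck_fun_add)
qed (auto intro: continuous_intros)

lemma Ck_fun_prod: "(\<And>i. i \<in> I \<Longrightarrow> Ck_fun k (f i)) \<Longrightarrow> Ck_fun k (\<lambda>x. \<Prod>i\<in>I. f i x)"
  by (induction I rule: infinite_finite_induct) (auto intro: Ck_fun_const Ck_fun_mult)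

text \<open>A partial derivative changes only the constant \<open>c\<close> and the polynomial
  \<open>P\<close>; both are therefore generalised in the induction.\<close>

lemma Ck_fun_flat: "Ck_fun k (\<lambda>x. c * flat P (b + a * x $ i))"
proof (induction k arbitrary: c P)
  case 0
  have "continuous_on UNIV (flat P)"
    using flat_has_derivative by (intro DERIV_continuous_on) (auto intro: has_field_derivative_at_within)
  then show ?case
    by (auto intro!: continuous_intros continuous_on_compose2[of UNIV "flat P"])
next
  case (Suc k)
  let ?P = "[:0, 0, 1:] * (P - pderiv P)"
  have D: "((\<lambda>x. c * flat P (b + a * x $ i)) has_derivative
      (\<lambda>h. c * (flat ?P (b + a * x $ i) * (a * h $ i)))) (at x)" for x
  proof -
    have "(flat P has_derivative (\<lambda>h. flat ?P (b + a * x $ i) * h)) (at (b + a * x $ i))"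
      using flat_has_derivative[of P "b + a * x $ i"] by (simp add: has_field_derivative_def)
    moreover have "((\<lambda>x. b + a * x $ i) has_derivative (\<lambda>h. a * h $ i)) (at x)"
      by (auto intro!: derivative_eq_intros bounded_linear.has_derivative[OF bounded_linear_vec_nth])
    ultimately have "((\<lambda>x. flat P (b + a * x $ i)) has_derivative (\<lambda>h. flat ?P (b + a * x $ i) * (a * h $ i))) (at x)"
      using has_derivative_compose[of "\<lambda>x. b + a * x $ i" "\<lambda>h. a * h $ i" x UNIV "flat P" "\<lambda>h. flat ?P (b + a * x $ i) * h"]
      by blast
    then show ?thesis
      by (rule has_derivative_mult_right)
  qed
  have "partial_deriv j (\<lambda>x. c * flat P (b + a * x $ i)) =
      (\<lambda>x. (c * (a * axis j 1 $ i)) * flat ?P (b + a * x $ i))" for j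
    by (rule ext, rule partial_deriv_eqI[OF D, THEN trans]) simp
  then show ?case
    using D Suc by (auto simp: differentiable_def)
qed

section \<open>Compactly supported mollifiers\<close>

lemma continuous_pos_integral:
  fixes g :: "'a::euclidean_space \<Rightarrow> real"
  assumes g: "continuous_on UNIV g" "\<And>x. g x \<ge> 0" "g 0 > 0" "integrable lborel g"
  shows "(\<integral>x. g x \<partial>lborel) > 0"
proof -
  have "open {x. g x > 0}"
    using open_Collect_less[OF continuous_on_const g(1)] by simp
  have "(\<integral>x. g x \<partial>lborel) \<noteq> 0"
  proof
    assume "(\<integral>x. g x \<partial>lborel) = 0"
    then have "AE x in lborel. g x = 0"
      using g by (subst (asm) integral_nonneg_eq_0_iff_AE) auto
    then have "AE x in lborel. x \<notin> {x. g x > 0}"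
      by eventually_elim auto
    then have "emeasure lborel {x. g x > 0} = 0"
      using \<open>open {x. g x > 0}\<close> by (subst (asm) AE_iff_null_sets[symmetric]) auto
    then have "negligible {x. g x > 0}"
      using \<open>open {x. g x > 0}\<close> by (simp add: negligible_iff_emeasure0 borel_open)
    then show False
      using open_not_negligible[OF \<open>open {x. g x > 0}\<close>] g(3) by blast
  qed
  moreover have "(\<integral>x. g x \<partial>lborel) \<ge> 0"
    using g by (intro integral_nonneg_AE) auto
  ultimately show ?thesis by linarith
qed

lemma integrable_continuous_bounded_support:
  fixes g :: "'a::euclidean_space \<Rightarrow> 'b::euclidean_space"
  assumes g: "continuous_on UNIV g" "bounded {x. g x \<noteq> 0}"
  shows "integrable lborel g"
proof -
  let ?K = "closure {x. g x \<noteq> 0}"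
  have "integrable lborel (\<lambda>x. indicator ?K x *\<^sub>R g x)"
    using g by (intro borel_integrable_compact[unfolded set_integrable_def]) (auto intro: continuous_on_subset)
  also have "(\<lambda>x. indicator ?K x *\<^sub>R g x) = g"
    using closure_subset[of "{x. g x \<noteq> 0}"] by (fastforce simp: indicator_def)
  finally show ?thesis .
qed

lemma mollifier_exists:
  assumes e: "e > 0"
  obtains \<rho> :: "real^'n::finite \<Rightarrow> real"
  where "test_function \<rho>" "\<And>x. \<rho> x \<ge> 0" "\<And>x. \<rho> x \<noteq> 0 \<Longrightarrow> norm x \<le> e" "(\<integral>x. \<rho> x \<partial>lborel) = 1"
proof -
  \<comment> \<open>The product \<open>g\<close> below is supported in the cube of points with all
    coordinates at most \<open>?d\<close> in absolute value; by the \<open>l1\<close> bound on the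
    norm this cube lies in the ball of radius \<open>e\<close>.\<close>
  let ?d = "e / CARD('n)"
  have d: "?d > 0"
    using e by simp
  define g :: "real^'n \<Rightarrow> real" where "g x = (\<Prod>i\<in>UNIV. flat 1 (?d + x $ i) * flat 1 (?d + (-1) * x $ i))" for x
  have g0: "g x \<ge> 0" for x
    unfolding g_def by (intro prod_nonneg) (auto simp: flat_def)
  have supp: "norm x \<le> e" if "g x \<noteq> 0" for x
  proof -
    have "\<bar>x $ i\<bar> \<le> ?d" for i
      using that by (auto simp: g_def flat_def split: if_splits dest!: spec[of _ i])
    then have "norm x \<le> (\<Sum>i\<in>(UNIV::'n set). ?d)"
      by (intro order_trans[OF norm_le_l1_cart] sum_mono) simp
    then show ?thesis by simp
  qed
  then have bdd: "bounded {x. g x \<noteq> 0}"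
    by (auto simp: bounded_iff)
  have Ck: "Ck_fun k g" for k
    unfolding g_def using Ck_fun_flat[of k 1 _ ?d 1] Ck_fun_flat[of k 1 _ ?d "-1"]
    by (intro Ck_fun_prod Ck_fun_mult) simp_all
  have int: "integrable lborel g"
    using Ck_fun_continuous[OF Ck] bdd by (rule integrable_continuous_bounded_support)
  have "g 0 > 0"
    unfolding g_def using d by (intro prod_pos) (auto simp: flat_def)
  then have I: "(\<integral>x. g x \<partial>lborel) > 0"
    using Ck_fun_continuous[OF Ck] g0 int by (intro continuous_pos_integral)
  define c where "c = 1 / (\<integral>x. g x \<partial>lborel)"
  have c: "c > 0" "(\<integral>x. c * g x \<partial>lborel) = 1"
    using I by (auto simp: c_def)
  show thesis
  proof (rule that[of "\<lambda>x. c * g x"])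
    show "test_function (\<lambda>x. c * g x)"
      unfolding test_function_def using bdd c by (auto intro!: Ck_fun_mult Ck_fun_const Ck simp: compact_closure)
    show "norm x \<le> e" if "c * g x \<noteq> 0" for x
      using that supp by simp
  qed (use c g0 in auto)
qed

lemma test_function_Ck: "test_function \<phi> \<Longrightarrow> Ck_fun k \<phi>"
  by (simp add: test_function_def)

lemma test_function_continuous: "test_function \<phi> \<Longrightarrow> continuous_on UNIV \<phi>"
  using Ck_fun_continuous test_function_Ck by blast

lemma test_function_differentiable: "test_function \<phi> \<Longrightarrow> \<phi> differentiable at x"
  using test_function_Ck[of \<phi> "Suc 0"] by simp

lemma test_function_grad_continuous: "test_function \<phi> \<Longrightarrow> continuous_on UNIV (grad \<phi>)"
  unfolding grad_def by (intro continuous_on_vec_lambda) (auto intro: test_function_partial_continuous)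

lemma test_function_partial_deriv:
  assumes "test_function \<phi>"
  shows "test_function (partial_deriv j \<phi>)"
proof -
  let ?K = "closure {x. \<phi> x \<noteq> 0}"
  have "partial_deriv j \<phi> x = 0" if "x \<notin> ?K" for x
  proof -
    have "(\<phi> has_derivative (\<lambda>_. 0)) (at x)"
    proof (rule has_derivative_transform_within_open)
      show "((\<lambda>_. 0) has_derivative (\<lambda>_. 0)) (at x)" by simp
      show "x \<in> - ?K" using that by blast
      show "0 = \<phi> y" if "y \<in> - ?K" for y
        using that closure_subset[of "{x. \<phi> x \<noteq> 0}"] by auto
    qed (rule open_Compl[OF closed_closure])
    then show ?thesis
      by (simp add: partial_deriv_eqI)
  qed
  then have "{x. partial_deriv j \<phi> x \<noteq> 0} \<subseteq> ?K"
    by blast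
  moreover have "bounded ?K"
    using assms by (simp add: test_function_def compact_imp_bounded)
  ultimately have "bounded {x. partial_deriv j \<phi> x \<noteq> 0}"
    by (rule bounded_subset[rotated])
  moreover have "Ck_fun k (partial_deriv j \<phi>)" for k
    using test_function_Ck[OF assms, of "Suc k"] by simp
  ultimately show ?thesis
    by (simp add: test_function_def compact_closure)
qed

section \<open>Convolution with a test function\<close>

definition conv :: "('a::euclidean_space \<Rightarrow> real) \<Rightarrow> ('a \<Rightarrow> real) \<Rightarrow> 'a \<Rightarrow> real"
  where "conv f g x = (\<integral>y. f y * g (x - y) \<partial>lborel)"

text \<open>Turns the convolution into an integral over a fixed box, the form in which
  \<open>leibniz_rule\<close> differentiates under the integral sign.\<close>

lemma conv_integral_cbox:
  fixes f :: "'a::euclidean_space \<Rightarrow> real"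
  assumes f: "continuous_on UNIV f" "{y. f y \<noteq> 0} \<subseteq> cbox a b" and g: "continuous_on UNIV g"
  shows "conv f g x = integral (cbox a b) (\<lambda>y. f y * g (x - y))"
proof -
  have "{y. f y * g (x - y) \<noteq> 0} \<subseteq> cbox a b"
    using f(2) by auto
  then have "integrable lborel (\<lambda>y. f y * g (x - y))"
    using bounded_subset[OF bounded_cbox]
    by (intro integrable_continuous_bounded_support continuous_intros f continuous_on_compose2[OF g]) auto
  then have "conv f g x = integral UNIV (\<lambda>y. f y * g (x - y))"
    by (simp add: conv_def integral_lborel)
  also have "\<dots> = integral UNIV (\<lambda>y. if y \<in> cbox a b then f y * g (x - y) else 0)"
    using f(2) by (intro arg_cong[where f = "integral UNIV"] ext) auto
  also have "\<dots> = integral (cbox a b) (\<lambda>y. f y * g (x - y))"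
    by (rule integral_restrict_UNIV)
  finally show ?thesis .
qed

text \<open>The derivative falls on the smooth factor \<open>g\<close>, so continuity of
  \<open>f\<close> suffices. Since \<open>partial_deriv j g\<close> is again a test function, the
  second claim can be iterated.\<close>

lemma conv_derivative:
  fixes f :: "real^'n::finite \<Rightarrow> real"
  assumes f: "continuous_on UNIV f" "{y. f y \<noteq> 0} \<subseteq> cbox a b" and g: "test_function g"
  shows "conv f g differentiable at x" and "partial_deriv j (conv f g) = conv f (partial_deriv j g)"
proof -
  define D where "D x y = f y *\<^sub>R blinfun_inner_right (grad g (x - y))" for x y
  note cont_g = continuous_on_compose2[OF test_function_continuous[OF g]]
  note cont_grad = continuous_on_compose2[OF test_function_grad_continuous[OF g]]
  have cont_D: "continuous_on S (\<lambda>(x, y). D x y)" for S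
    unfolding D_def split_beta
    by (intro continuous_intros cont_grad continuous_on_compose2[OF f(1)]
      bounded_linear.continuous_on[OF bounded_linear_blinfun_inner_right]) auto
  have der: "(conv f g has_derivative blinfun_apply (integral (cbox a b) (D x))) (at x)" for x
    unfolding conv_integral_cbox[OF f test_function_continuous[OF g], abs_def]
  proof (rule leibniz_rule)
    fix x y :: "real^'n"
    have "((\<lambda>x. x - y) has_derivative (\<lambda>h. h)) (at x)"
      by (auto intro!: derivative_eq_intros)
    then have "((\<lambda>x. g (x - y)) has_derivative (\<lambda>h. grad g (x - y) \<bullet> h)) (at x)"
      using has_derivative_compose[of "\<lambda>x. x - y" "\<lambda>h. h" x UNIV g "\<lambda>h. grad g (x - y) \<bullet> h"]
        has_derivative_grad[OF test_function_differentiable[OF g]] by auto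
    then show "((\<lambda>x. f y * g (x - y)) has_derivative blinfun_apply (D x y)) (at x)"
      unfolding D_def by (auto intro!: derivative_eq_intros simp: blinfun.scaleR_left)
  qed (auto intro!: integrable_continuous continuous_intros cont_D cont_g continuous_on_subset[OF f(1)])
  show "conv f g differentiable at x"
    using der differentiable_def by blast
  show "partial_deriv j (conv f g) = conv f (partial_deriv j g)"
  proof
    fix x
    have int: "D x integrable_on cbox a b"
      using continuous_on_compose2[OF cont_D[of UNIV] continuous_on_Pair[OF continuous_on_const continuous_on_id]]
      by (intro integrable_continuous) simp
    have "partial_deriv j (conv f g) x = blinfun_apply (integral (cbox a b) (D x)) (axis j 1)"
      by (rule partial_deriv_eqI[OF der])
    also have "\<dots> = integral (cbox a b) (\<lambda>y. blinfun_apply (D x y) (axis j 1))"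
      using integral_linear[OF int blinfun.bounded_linear_left[of "axis j 1"]] by (simp add: o_def)
    also have "\<dots> = conv f (partial_deriv j g) x"
      by (simp add: conv_integral_cbox[OF f test_function_partial_continuous[OF g]] D_def
        blinfun.scaleR_left inner_axis)
    finally show "partial_deriv j (conv f g) x = conv f (partial_deriv j g) x" .
  qed
qed

lemma Ck_fun_conv:
  fixes f :: "real^'n::finite \<Rightarrow> real"
  assumes f: "continuous_on UNIV f" "{y. f y \<noteq> 0} \<subseteq> cbox a b" and g: "test_function g"
  shows "Ck_fun k (conv f g)"
  using g
proof (induction k arbitrary: g)
  case 0
  then show ?case
    using conv_derivative(1)[OF f 0]
    by (simp add: differentiable_imp_continuous_on differentiable_at_imp_differentiable_on)
next
  case (Suc k)
  then show ?case
    using conv_derivative[OF f Suc.prems] by (simp add: test_function_partial_deriv)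
qed

lemma test_function_conv:
  fixes f :: "real^'n::finite \<Rightarrow> real"
  assumes f: "continuous_on UNIV f" "bounded {x. f x \<noteq> 0}" and g: "test_function g"
  shows "test_function (conv f g)"
proof -
  obtain a b where ab: "{x. f x \<noteq> 0} \<subseteq> cbox a b"
    using bounded_subset_cbox_symmetric[OF f(2)] by metis
  have "bounded {x. g x \<noteq> 0}"
    using g by (simp add: test_function_def compact_closure)
  then obtain A B where A: "\<And>y. f y \<noteq> 0 \<Longrightarrow> norm y \<le> A" and B: "\<And>y. g y \<noteq> 0 \<Longrightarrow> norm y \<le> B"
    using f(2) unfolding bounded_iff by auto
  have "norm x \<le> A + B" if "conv f g x \<noteq> 0" for x
  proof (rule ccontr)
    assume x: "\<not> norm x \<le> A + B"
    have "f y * g (x - y) = 0" for y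
      using x A[of y] B[of "x - y"] norm_triangle_sub[of x y] by (smt (verit) mult_eq_0_iff)
    then have "conv f g x = (\<integral>y. 0 \<partial>(lborel :: (real^'n) measure))"
      unfolding conv_def by (intro Bochner_Integration.integral_cong) auto
    then show False
      using that by simp
  qed
  then have "bounded {x. conv f g x \<noteq> 0}"
    by (auto simp: bounded_iff)
  moreover have "Ck_fun k (conv f g)" for k
    using ab by (intro Ck_fun_conv[OF f(1) _ g])
  ultimately show ?thesis
    by (simp add: test_function_def compact_closure)
qed

lemma lborel_reflect:
  fixes f :: "'a::euclidean_space \<Rightarrow> real"
  assumes [measurable]: "f \<in> borel_measurable borel"
  shows "(\<integral>y. f y \<partial>lborel) = (\<integral>y. f (x - y) \<partial>lborel)"
  by (subst lborel_affine[of "-1" x]) (simp_all add: density_1 integral_distr)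

text \<open>After reflection, \<open>conv f g x\<close> is an average of the values
  \<open>f (x - y)\<close> with \<open>norm y \<le> e\<close>. Averaging translates cannot increase
  the Lipschitz constant, and each value differs from \<open>f x\<close> by at most
  \<open>L * e\<close>.\<close>

lemma conv_lipschitz_approx:
  fixes f :: "'a::euclidean_space \<Rightarrow> real"
  assumes f: "L-lipschitz_on UNIV f" "bounded {x. f x \<noteq> 0}"
    and g: "continuous_on UNIV g" "\<And>x. g x \<ge> 0" "\<And>x. g x \<noteq> 0 \<Longrightarrow> norm x \<le> e" "(\<integral>x. g x \<partial>lborel) = 1"
  shows "L-lipschitz_on UNIV (conv f g)" and "\<bar>conv f g x - f x\<bar> \<le> L * e"
proof -
  have cont_f: "continuous_on UNIV f"
    using f(1) by (rule lipschitz_on_continuous_on)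
  note cont_fx = continuous_on_compose2[OF cont_f]
  have int_g: "integrable lborel g"
    using g(3) by (intro integrable_continuous_bounded_support g) (auto simp: bounded_iff)
  have eq: "conv f g x = (\<integral>y. f (x - y) * g y \<partial>lborel)" for x
  proof -
    have "(\<lambda>y. f y * g (x - y)) \<in> borel_measurable borel"
      by (intro borel_measurable_continuous_onI continuous_intros cont_f continuous_on_compose2[OF g(1)]) auto
    then show ?thesis
      unfolding conv_def by (subst lborel_reflect[of _ x]) auto
  qed
  have int: "integrable lborel (\<lambda>y. f (x - y) * g y)" for x
    using g(3) by (intro integrable_continuous_bounded_support continuous_intros cont_fx g(1))
      (auto simp: bounded_iff)
  have bound: "\<bar>\<integral>y. h y * g y \<partial>lborel\<bar> \<le> C" if h: "integrable lborel (\<lambda>y. h y * g y)" "\<And>y. norm y \<le> e \<Longrightarrow> \<bar>h y\<bar> \<le> C" for h C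
  proof -
    have "\<bar>\<integral>y. h y * g y \<partial>lborel\<bar> \<le> (\<integral>y. \<bar>h y * g y\<bar> \<partial>lborel)"
      by (rule integral_abs_bound)
    also have "\<dots> \<le> (\<integral>y. C * g y \<partial>lborel)"
    proof (rule integral_mono)
      show "\<bar>h y * g y\<bar> \<le> C * g y" for y
        using h(2)[of y] g(2,3)[of y] by (cases "g y = 0") (auto simp: abs_mult intro!: mult_right_mono)
    qed (use h int_g in auto)
    finally show ?thesis
      using g(4) by simp
  qed
  show "L-lipschitz_on UNIV (conv f g)"
  proof (rule lipschitz_onI)
    fix x x'
    have "conv f g x - conv f g x' = (\<integral>y. (f (x - y) - f (x' - y)) * g y \<partial>lborel)"
      using int by (simp add: eq left_diff_distrib)
    also have "\<bar>\<dots>\<bar> \<le> L * dist x x'"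
    proof (rule bound)
      show "integrable lborel (\<lambda>y. (f (x - y) - f (x' - y)) * g y)"
        using int[of x] int[of x'] by (simp add: left_diff_distrib)
      show "\<bar>f (x - y) - f (x' - y)\<bar> \<le> L * dist x x'" for y
        using lipschitz_onD[OF f(1), of "x - y" "x' - y"] by (simp add: dist_norm)
    qed
    finally show "dist (conv f g x) (conv f g x') \<le> L * dist x x'"
      by (simp add: dist_norm)
  qed (rule lipschitz_on_nonneg[OF f(1)])
  have "conv f g x - f x = (\<integral>y. f (x - y) * g y \<partial>lborel) - f x * (\<integral>y. g y \<partial>lborel)"
    by (simp add: eq g(4))
  also have "\<dots> = (\<integral>y. (f (x - y) - f x) * g y \<partial>lborel)"
    using int int_g by (simp add: left_diff_distrib)
  also have "\<bar>\<dots>\<bar> \<le> L * e"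
  proof (rule bound)
    show "integrable lborel (\<lambda>y. (f (x - y) - f x) * g y)"
      using int int_g by (simp add: left_diff_distrib)
    show "\<bar>f (x - y) - f x\<bar> \<le> L * e" if "norm y \<le> e" for y
      using lipschitz_onD[OF f(1), of "x - y" x] mult_left_mono[OF that lipschitz_on_nonneg[OF f(1)]]
      by (simp add: dist_norm)
  qed
  finally show "\<bar>conv f g x - f x\<bar> \<le> L * e" .
qed

lemma lipschitz_on_clip:
  fixes f h :: "'a::metric_space \<Rightarrow> real"
  assumes f: "L-lipschitz_on UNIV f" and h: "L-lipschitz_on UNIV h"
  shows "L-lipschitz_on UNIV (\<lambda>x. max (- h x) (min (f x) (h x)))"
proof (rule lipschitz_onI)
  fix x y
  show "dist (max (- h x) (min (f x) (h x))) (max (- h y) (min (f y) (h y))) \<le> L * dist x y"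
    using lipschitz_onD[OF f, of x y] lipschitz_onD[OF h, of x y]
    by (simp add: dist_real_def max_def min_def abs_le_iff)
qed (rule lipschitz_on_nonneg[OF f])

lemma lipschitz_test_function_approx:
  fixes f :: "real^'n::finite \<Rightarrow> real"
  assumes f: "L-lipschitz_on UNIV f" "f 0 = 0"
  obtains \<phi> where "\<And>k. test_function (\<phi> k)" "\<And>k. L-lipschitz_on UNIV (\<phi> k)"
    "\<And>x. (\<lambda>k. \<phi> k x) \<longlonglongrightarrow> f x"
proof -
  note L = lipschitz_on_nonneg[OF f(1)]
  define h where "h k x = L * max 0 (2 * real k - norm x)" for k and x :: "real^'n"
  \<comment> \<open>Clipping \<open>f\<close> between \<open>- h k\<close> and \<open>h k\<close> gives compact support without increasing the Lipschitz constant.\<close>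
  define u where "u k x = max (- h k x) (min (f x) (h k x))" for k x
  have "L-lipschitz_on UNIV (h k)" for k
  proof (rule lipschitz_onI)
    fix x y :: "real^'n"
    have "\<bar>max 0 (2 * real k - norm x) - max 0 (2 * real k - norm y)\<bar> \<le> dist x y"
      using norm_triangle_ineq3[of x y] by (auto simp: max_def dist_norm)
    then show "dist (h k x) (h k y) \<le> L * dist x y"
      using L by (simp add: h_def dist_real_def abs_mult mult_left_mono flip: right_diff_distrib)
  qed (rule L)
  then have lip_u: "L-lipschitz_on UNIV (u k)" for k
    unfolding u_def using f(1) by (intro lipschitz_on_clip)
  have "norm x \<le> 2 * real k" if "u k x \<noteq> 0" for k x
    using that by (auto simp: u_def h_def max_def min_def split: if_splits)
  then have supp_u: "bounded {x. u k x \<noteq> 0}" for k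
    by (auto simp: bounded_iff)
  \<comment> \<open>For \<open>norm x \<le> real k\<close> one has
    \<open>2 * real k - norm x \<ge> norm x\<close>, so the bounds \<open>- h k x\<close> and
    \<open>h k x\<close> do not cut \<open>f\<close>; this is the reason for the factor 2.\<close>
  have u_eq: "u k x = f x" if "norm x \<le> real k" for k x
  proof -
    have "\<bar>f x\<bar> \<le> L * norm x"
      using lipschitz_onD[OF f(1), of x 0] f(2) by (simp add: dist_norm)
    also have "\<dots> \<le> h k x"
      unfolding h_def using that L by (intro mult_left_mono) auto
    finally show ?thesis
      by (auto simp: u_def)
  qed
  have "\<exists>\<rho> :: real^'n \<Rightarrow> real. test_function \<rho> \<and> (\<forall>x. \<rho> x \<ge> 0) \<and>
      (\<forall>x. \<rho> x \<noteq> 0 \<longrightarrow> norm x \<le> 1 / real (Suc k)) \<and> (\<integral>x. \<rho> x \<partial>lborel) = 1" for k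
    using mollifier_exists[of "1 / real (Suc k)"] by (metis of_nat_0_less_iff zero_less_Suc zero_less_divide_1_iff)
  then obtain \<rho> :: "nat \<Rightarrow> real^'n \<Rightarrow> real" where \<rho>: "\<And>k. test_function (\<rho> k)" "\<And>k x. \<rho> k x \<ge> 0"
      "\<And>k x. \<rho> k x \<noteq> 0 \<Longrightarrow> norm x \<le> 1 / real (Suc k)" "\<And>k. (\<integral>x. \<rho> k x \<partial>lborel) = 1"
    by metis
  note approx = conv_lipschitz_approx[OF lip_u supp_u test_function_continuous[OF \<rho>(1)] \<rho>(2,3,4)]
  have close: "\<bar>conv (u k) (\<rho> k) x - u k x\<bar> \<le> L * (1 / real (Suc k))" for k x
    by (rule approx)
  show thesis
  proof
    show "test_function (conv (u k) (\<rho> k))" for k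
      using lip_u supp_u \<rho>(1) by (intro test_function_conv) (auto intro: lipschitz_on_continuous_on)
    show "L-lipschitz_on UNIV (conv (u k) (\<rho> k))" for k
      by (rule approx)
    show "(\<lambda>k. conv (u k) (\<rho> k) x) \<longlonglongrightarrow> f x" for x
    proof (rule LIM_zero_cancel, rule Lim_null_comparison)
      have "(\<lambda>k. L * (1 / real (Suc k))) \<longlonglongrightarrow> L * 0"
        by (intro tendsto_intros LIMSEQ_Suc[OF lim_1_over_n])
      then show "(\<lambda>k. L * (1 / real (Suc k))) \<longlonglongrightarrow> 0" by simp
      obtain m where m: "norm x \<le> real m"
        using real_arch_simple by blast
      show "\<forall>\<^sub>F k in sequentially. norm (conv (u k) (\<rho> k) x - f x) \<le> L * (1 / real (Suc k))"
        using eventually_ge_at_top[of m]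
      proof eventually_elim
        case (elim k)
        then show ?case
          using close[of k x] u_eq[of x k] m by simp
      qed
    qed
  qed
qed


section \<open>Vector fields transporting mass along segments\<close>

lemma test_function_grad_bounded:
  fixes \<phi> :: "real^'n::finite \<Rightarrow> real"
  assumes "test_function \<phi>"
  obtains C where "C \<ge> 0" "\<And>x. norm (grad \<phi> x) \<le> C"
proof -
  obtain C where C: "C \<ge> 0" "\<And>j x. \<bar>partial_deriv j \<phi> x\<bar> \<le> C"
    using test_function_partial_bounded[OF assms] by metis
  have "norm (grad \<phi> x) \<le> (\<Sum>j\<in>(UNIV::'n set). C)" for x
    using C by (intro order_trans[OF norm_le_l1_cart] sum_mono) simp
  then show thesis
    using C(1) by (intro that[of "\<Sum>j\<in>(UNIV::'n set). C"]) auto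
qed

text \<open>The change of variables \<open>z = b + s *\<^sub>R w\<close>, phrased so that
  integrability and the value of the integral come together.\<close>

lemma has_bochner_integral_scale:
  fixes g :: "'a::euclidean_space \<Rightarrow> 'b::{banach, second_countable_topology}"
  assumes g: "integrable lborel g" and s: "s > 0"
  shows "has_bochner_integral lborel (\<lambda>z. (1 / s ^ DIM('a)) *\<^sub>R g ((1 / s) *\<^sub>R (z - b))) (\<integral>w. g w \<partial>lborel)"
proof -
  have [measurable]: "g \<in> borel_measurable borel"
    using g by auto
  have "has_bochner_integral (density (distr lborel borel (\<lambda>x. b + s *\<^sub>R x)) (\<lambda>_. ennreal (\<bar>s\<bar> ^ DIM('a))))
      (\<lambda>z. (1 / s ^ DIM('a)) *\<^sub>R g ((1 / s) *\<^sub>R (z - b))) (\<integral>w. g w \<partial>lborel)"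
    using g s by (intro has_bochner_integral_density has_bochner_integral_distr)
      (simp_all add: has_bochner_integral_iff)
  then show ?thesis
    using lborel_affine[of s b] s by simp
qed

text \<open>
  With \<open>u w = c *\<^sub>R w + d\<close>, this is the density of the vector measure obtained by moving every \<open>w \<in> A\<close>
  along the segment from \<open>w\<close> to \<open>w + u w\<close>: for fixed \<open>t\<close> substitute \<open>z = w + t *\<^sub>R u w\<close>, whose Jacobian
  is \<open>(1 + t * c) ^ n\<close>. Only \<open>c = -1\<close> (contraction to \<open>d\<close>) and \<open>c = 0\<close> (translation by \<open>d\<close>) are used.
\<close>

definition segment_density :: "(real^'n::finite) set \<Rightarrow> real \<Rightarrow> real^'n \<Rightarrow> real^'n \<Rightarrow> real^'n"
  where "segment_density A c d z = (\<integral>t. (indicator {0<..<1} t * indicator A ((1 / (1 + t * c)) *\<^sub>R (z - t *\<^sub>R d)) / (1 + t * c) ^ CARD('n)) *\<^sub>R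
    (c *\<^sub>R ((1 / (1 + t * c)) *\<^sub>R (z - t *\<^sub>R d)) + d) \<partial>lborel)"

text \<open>For fixed \<open>t\<close> the integrand is the density of the image of
  \<open>indicator A w *\<^sub>R u w\<close> under \<open>w \<mapsto> w + t *\<^sub>R u w\<close>.
  Fubini then gives integrability, and the triangle inequality gives the norm bound. The pairing
  formula is the fundamental theorem of calculus along each segment. For \<open>c = -1\<close> the
  Jacobian vanishes at \<open>t = 1\<close>, which the open interval excludes.\<close>

lemma segment_density:
  fixes A :: "(real^'n::finite) set" and d :: "real^'n"
  assumes A: "A \<in> sets borel" "bounded A" and c: "c \<ge> -1"
  defines "u \<equiv> \<lambda>w. c *\<^sub>R w + d"
  defines "E \<equiv> segment_density A c d"
  shows "integrable lborel E"
    and "(\<integral>z. norm (E z) \<partial>lborel) \<le> (\<integral>w. indicator A w * norm (u w) \<partial>lborel)"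
    and "test_function \<phi> \<Longrightarrow> (\<integral>z. E z \<bullet> grad \<phi> z \<partial>lborel) = (\<integral>w. indicator A w * (\<phi> (w + u w) - \<phi> w) \<partial>lborel)"
proof -
  note [measurable] = A(1)
  let ?I = "\<lambda>t. indicator {0<..<1::real} t :: real"
  define h where "h t z = (?I t * indicator A ((1 / (1 + t * c)) *\<^sub>R (z - t *\<^sub>R d)) / (1 + t * c) ^ CARD('n)) *\<^sub>R
    u ((1 / (1 + t * c)) *\<^sub>R (z - t *\<^sub>R d))" for t z
  have E: "E z = (\<integral>t. h t z \<partial>lborel)" for z
    by (simp add: E_def segment_density_def h_def u_def)
  have [measurable]: "u \<in> borel_measurable borel"
    unfolding u_def by measurable
  have meas: "case_prod h \<in> borel_measurable (lborel \<Otimes>\<^sub>M lborel)"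
    unfolding h_def split_beta by measurable
  have s: "1 + t * c > 0" if "0 < t" "t < 1" for t
    using c that mult_left_mono[of "-1" c t] by linarith
  have scale: "has_bochner_integral lborel
      (\<lambda>z. (1 / (1 + t * c) ^ CARD('n)) *\<^sub>R g ((1 / (1 + t * c)) *\<^sub>R (z - t *\<^sub>R d))) (\<integral>w. g w \<partial>lborel)"
    if "0 < t" "t < 1" "integrable lborel g" for t and g :: "real^'n \<Rightarrow> 'b::{banach, second_countable_topology}"
    using has_bochner_integral_scale[OF that(3) s[OF that(1,2)]] by simp
  have int_bdd: "integrable lborel (\<lambda>w. indicator A w *\<^sub>R g w)"
    if [measurable]: "g \<in> borel_measurable borel" and "\<And>w. w \<in> A \<Longrightarrow> norm (g w) \<le> B"
    for g :: "real^'n \<Rightarrow> 'b::{banach, second_countable_topology}" and B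
  proof (rule Bochner_Integration.integrable_bound)
    have "emeasure lborel A < \<infinity>"
      using emeasure_bounded_finite[OF A(2)] by simp
    then show "integrable lborel (\<lambda>w. indicator A w * B)"
      by (intro integrable_mult_left) (simp add: integrable_indicator_iff)
    show "AE w in lborel. norm (indicator A w *\<^sub>R g w) \<le> norm (indicator A w * B)"
      using that(2) by (auto simp: indicator_def intro: order_trans[OF _ abs_ge_self])
  qed measurable
  obtain R where R: "\<And>w. w \<in> A \<Longrightarrow> norm w \<le> R"
    using A(2) by (auto simp: bounded_iff)
  define B where "B = \<bar>c\<bar> * R + norm d"
  have uB: "norm (u w) \<le> B" if "w \<in> A" for w
  proof -
    have "norm (u w) \<le> \<bar>c\<bar> * norm w + norm d"
      unfolding u_def using norm_triangle_ineq[of "c *\<^sub>R w" d] by simp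
    also have "\<dots> \<le> B"
      unfolding B_def using R[OF that] by (intro add_mono mult_left_mono) auto
    finally show ?thesis .
  qed
  have int_u: "integrable lborel (\<lambda>w. indicator A w *\<^sub>R u w)"
    using uB by (intro int_bdd) auto
  \<comment> \<open>One substitution serves three integrands: the norm, the field itself and its
    inner product with \<open>grad \<phi>\<close>. They share positive homogeneity in the field,
    which lets the positive Jacobian factor pass through \<open>f\<close>.\<close>
  have slice: "has_bochner_integral lborel (\<lambda>z. f (h t z) z) (?I t *\<^sub>R (\<integral>w. f (indicator A w *\<^sub>R u w) (w + t *\<^sub>R u w) \<partial>lborel))"
    if f0: "\<And>z. f 0 z = 0" and f: "\<And>a v z. a \<ge> 0 \<Longrightarrow> f (a *\<^sub>R v) z = a *\<^sub>R f v z"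
      and int: "integrable lborel (\<lambda>w. f (indicator A w *\<^sub>R u w) (w + t *\<^sub>R u w))"
    for t and f :: "real^'n \<Rightarrow> real^'n \<Rightarrow> 'b::{banach, second_countable_topology}"
  proof (cases "0 < t \<and> t < 1")
    case True
    define w where "w z = (1 / (1 + t * c)) *\<^sub>R (z - t *\<^sub>R d)" for z
    have w: "w z + t *\<^sub>R u (w z) = z" for z
    proof -
      have "w z + t *\<^sub>R u (w z) = (1 + t * c) *\<^sub>R w z + t *\<^sub>R d"
        by (simp add: u_def algebra_simps)
      then show ?thesis
        using s[of t] True by (simp add: w_def)
    qed
    have "f (h t z) z = (1 / (1 + t * c) ^ CARD('n)) *\<^sub>R f (indicator A (w z) *\<^sub>R u (w z)) (w z + t *\<^sub>R u (w z))" for z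
    proof -
      have "h t z = (1 / (1 + t * c) ^ CARD('n)) *\<^sub>R (indicator A (w z) *\<^sub>R u (w z))"
        using True by (simp add: h_def w_def)
      then show ?thesis
        using s[of t] True by (simp add: f w)
    qed
    then show ?thesis
      using scale[OF _ _ int] True by (simp add: w_def)
  qed (simp add: h_def f0 has_bochner_integral_zero)
  define K where "K = (\<integral>w. indicator A w * norm (u w) \<partial>lborel)"
  have slice_norm: "has_bochner_integral lborel (\<lambda>z. norm (h t z)) (?I t * K)" for t
    using slice[of "\<lambda>v z. norm v" t] integrable_norm[OF int_u] by (simp add: K_def)
  have int_h: "integrable (lborel \<Otimes>\<^sub>M lborel) (case_prod h)"
  proof (rule lborel_pair.Fubini_integrable[OF meas])
    have "integrable lborel (\<lambda>t. ?I t * K)"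
      by (intro integrable_mult_left) simp
    then show "integrable lborel (\<lambda>t. \<integral>z. norm (case (t, z) of (t, z) \<Rightarrow> h t z) \<partial>lborel)"
      using slice_norm by (simp add: has_bochner_integral_iff)
    have "integrable lborel (h t)" for t
      using slice[of "\<lambda>v z. v" t] int_u by (simp add: has_bochner_integral_iff)
    then show "AE t in lborel. integrable lborel (\<lambda>z. case (t, z) of (t, z) \<Rightarrow> h t z)"
      by simp
  qed
  show int_E: "integrable lborel E"
    unfolding E using lborel_pair.integrable_snd[OF int_h] .
  have int_nh: "integrable (lborel \<Otimes>\<^sub>M lborel) (\<lambda>(t, z). norm (h t z))"
    using integrable_norm[OF int_h] by (simp add: split_def)
  have "(\<integral>z. norm (E z) \<partial>lborel) \<le> (\<integral>z. \<integral>t. norm (h t z) \<partial>lborel \<partial>lborel)"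
    unfolding E
    by (intro integral_mono integrable_norm int_E[unfolded E] lborel_pair.integrable_snd[OF int_nh] integral_norm_bound)
  also have "\<dots> = (\<integral>t. \<integral>z. norm (h t z) \<partial>lborel \<partial>lborel)"
    using lborel_pair.Fubini_integral[OF int_nh] by simp
  also have "\<dots> = (\<integral>t. ?I t * K \<partial>lborel)"
    using slice_norm by (simp add: has_bochner_integral_iff)
  also have "\<dots> = K"
    by simp
  finally show "(\<integral>z. norm (E z) \<partial>lborel) \<le> K" .
  assume \<phi>: "test_function \<phi>"
  obtain C where C: "C \<ge> 0" "\<And>x. norm (grad \<phi> x) \<le> C"
    using test_function_grad_bounded[OF \<phi>] by metis
  have [measurable]: "grad \<phi> \<in> borel_measurable borel" "\<phi> \<in> borel_measurable borel"
    using test_function_grad_continuous[OF \<phi>] test_function_continuous[OF \<phi>]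
    by (auto intro: borel_measurable_continuous_onI)
  have int_hg: "integrable (lborel \<Otimes>\<^sub>M lborel) (\<lambda>(t, z). h t z \<bullet> grad \<phi> z)"
  proof (rule Bochner_Integration.integrable_bound)
    show "integrable (lborel \<Otimes>\<^sub>M lborel) (\<lambda>p. C * norm (case_prod h p))"
      by (intro integrable_mult_right integrable_norm int_h)
    show "(\<lambda>(t, z). h t z \<bullet> grad \<phi> z) \<in> borel_measurable (lborel \<Otimes>\<^sub>M lborel)"
      using meas unfolding split_beta by measurable
    have "\<bar>h t z \<bullet> grad \<phi> z\<bar> \<le> C * norm (h t z)" for t z
      using Cauchy_Schwarz_ineq2[of "h t z" "grad \<phi> z"] mult_left_mono[OF C(2)[of z], of "norm (h t z)"]
      by (simp add: mult.commute)
    then show "AE p in lborel \<Otimes>\<^sub>M lborel. norm (case p of (t, z) \<Rightarrow> h t z \<bullet> grad \<phi> z) \<le> norm (C * norm (case_prod h p))"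
      using C(1) by (auto simp: abs_mult)
  qed
  define G where "G t w = ?I t * (indicator A w * (u w \<bullet> grad \<phi> (w + t *\<^sub>R u w)))" for t w
  have G_bound: "\<bar>indicator A w * (u w \<bullet> grad \<phi> (w + t *\<^sub>R u w))\<bar> \<le> C * (indicator A w * norm (u w))" for t w
    using Cauchy_Schwarz_ineq2[of "u w" "grad \<phi> (w + t *\<^sub>R u w)"]
      mult_left_mono[OF C(2)[of "w + t *\<^sub>R u w"], of "norm (u w)"]
    by (auto simp: mult.commute indicator_def)
  have int_nu: "integrable lborel (\<lambda>w. C * (indicator A w * norm (u w)))"
    using integrable_norm[OF int_u] by (intro integrable_mult_right) simp
  have int_slice: "integrable lborel (\<lambda>w. indicator A w * (u w \<bullet> grad \<phi> (w + t *\<^sub>R u w)))" for t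
    by (rule Bochner_Integration.integrable_bound[OF int_nu])
      (measurable, use G_bound C(1) in \<open>auto simp: abs_mult\<close>)
  have int_G: "integrable (lborel \<Otimes>\<^sub>M lborel) (case_prod G)"
  proof (rule Bochner_Integration.integrable_bound)
    show "case_prod G \<in> borel_measurable (lborel \<Otimes>\<^sub>M lborel)"
      unfolding G_def split_beta by measurable
    show "integrable (lborel \<Otimes>\<^sub>M lborel) (\<lambda>(t, w). ?I t * (C * (indicator A w * norm (u w))))"
    proof (rule lborel_pair.Fubini_integrable)
      show "(\<lambda>(t, w). ?I t * (C * (indicator A w * norm (u w)))) \<in> borel_measurable (lborel \<Otimes>\<^sub>M lborel)"
        unfolding split_beta by measurable
      have "integrable lborel (\<lambda>t. ?I t * (C * K))"
        by (intro integrable_mult_left) simp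
      then show "integrable lborel (\<lambda>t. \<integral>w. norm (case (t, w) of (t, w) \<Rightarrow> ?I t * (C * (indicator A w * norm (u w)))) \<partial>lborel)"
        using C(1) by (simp add: abs_mult K_def)
    qed (use int_nu in simp)
    show "AE p in lborel \<Otimes>\<^sub>M lborel. norm (case_prod G p) \<le> norm (case p of (t, w) \<Rightarrow> ?I t * (C * (indicator A w * norm (u w))))"
      using G_bound C(1) by (auto simp: G_def abs_mult intro!: AE_I2 mult_left_mono)
  qed
  have "(\<integral>z. E z \<bullet> grad \<phi> z \<partial>lborel) = (\<integral>z. \<integral>t. h t z \<bullet> grad \<phi> z \<partial>lborel \<partial>lborel)"
  proof (rule integral_cong_AE)
    show "(\<lambda>z. E z \<bullet> grad \<phi> z) \<in> borel_measurable lborel"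
      using int_E by measurable
    show "(\<lambda>z. \<integral>t. h t z \<bullet> grad \<phi> z \<partial>lborel) \<in> borel_measurable lborel"
      using lborel_pair.integrable_snd[OF int_hg] by auto
    \<comment> \<open>Moving the inner product under the \<open>t\<close>-integral uses
      integrability of \<open>h\<close> in \<open>t\<close>, which Fubini supplies for almost every
      \<open>z\<close>.\<close>
    show "AE z in lborel. E z \<bullet> grad \<phi> z = (\<integral>t. h t z \<bullet> grad \<phi> z \<partial>lborel)"
      using lborel_pair.AE_integrable_snd[OF int_h] by eventually_elim (simp add: E)
  qed
  also have "\<dots> = (\<integral>t. \<integral>z. h t z \<bullet> grad \<phi> z \<partial>lborel \<partial>lborel)"
    using lborel_pair.Fubini_integral[OF int_hg] by simp
  also have "\<dots> = (\<integral>t. \<integral>w. G t w \<partial>lborel \<partial>lborel)"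
    using slice[of "\<lambda>v z. v \<bullet> grad \<phi> z"] int_slice by (simp add: G_def has_bochner_integral_iff)
  also have "\<dots> = (\<integral>w. \<integral>t. G t w \<partial>lborel \<partial>lborel)"
    using lborel_pair.Fubini_integral[OF int_G] by simp
  also have "\<dots> = (\<integral>w. indicator A w * (\<phi> (w + u w) - \<phi> w) \<partial>lborel)"
  proof (rule Bochner_Integration.integral_cong[OF refl])
    fix w
    define g where "g t = grad \<phi> (w + t *\<^sub>R u w) \<bullet> u w" for t
    have der: "((\<lambda>t. \<phi> (w + t *\<^sub>R u w)) has_vector_derivative g t) (at t within S)" for t S
    proof -
      have "((\<lambda>t. w + t *\<^sub>R u w) has_derivative (\<lambda>h. h *\<^sub>R u w)) (at t within S)"
        by (auto intro!: derivative_eq_intros)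
      from has_derivative_compose[OF this has_derivative_grad[OF test_function_differentiable[OF \<phi>]]]
      show ?thesis
        by (simp add: has_vector_derivative_def g_def)
    qed
    have "has_bochner_integral lborel (\<lambda>t. indicator {0..1} t *\<^sub>R g t) (\<phi> (w + 1 *\<^sub>R u w) - \<phi> (w + 0 *\<^sub>R u w))"
      unfolding g_def by (intro has_bochner_integral_FTC_Icc der[unfolded g_def] continuous_intros
        continuous_on_compose2[OF test_function_grad_continuous[OF \<phi>]]) auto
    \<comment> \<open>The fundamental theorem is stated on the closed interval, the density on the
      open one; they differ by two points.\<close>
    moreover have "(\<integral>t. indicator {0..1} t *\<^sub>R g t \<partial>lborel) = (\<integral>t. ?I t * g t \<partial>lborel)"
    proof (rule integral_cong_AE)
      have "AE t in lborel. t \<noteq> 0 \<and> t \<noteq> (1::real)"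
        using AE_lborel_singleton[of 0] AE_lborel_singleton[of 1] by eventually_elim auto
      then show "AE t in lborel. indicator {0..1} t *\<^sub>R g t = ?I t * g t"
        by eventually_elim (auto simp: indicator_def)
    qed (auto simp: g_def)
    ultimately have "(\<integral>t. ?I t * g t \<partial>lborel) = \<phi> (w + u w) - \<phi> w"
      by (simp add: has_bochner_integral_iff)
    then show "(\<integral>t. G t w \<partial>lborel) = indicator A w * (\<phi> (w + u w) - \<phi> w)"
      by (cases "w \<in> A") (simp_all add: G_def g_def inner_commute)
  qed
  finally show "(\<integral>z. E z \<bullet> grad \<phi> z \<partial>lborel) = (\<integral>w. indicator A w * (\<phi> (w + u w) - \<phi> w) \<partial>lborel)" .
qed


section \<open>The quotient space and its point classes\<close>

definition field_class :: "(real^'n::finite \<Rightarrow> real^'n) \<Rightarrow> 'n L1_mod_div_free"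
  where "field_class f = abs_L1_mod_div_free (abs_L1 f)"

text \<open>Chosen representatives make this a total function. For a test function the value is the
  same for every representative, by \<open>pairing_field_class\<close>; for other \<phi> no meaning
  is attached to it.\<close>

definition pairing :: "'n::finite L1_mod_div_free \<Rightarrow> (real^'n \<Rightarrow> real) \<Rightarrow> real"
  where "pairing q \<phi> = (\<integral>x. rep_L1 (rep_L1_mod_div_free q) x \<bullet> grad \<phi> x \<partial>lebesgue)"

lemma field_class_cases:
  obtains f where "integrable lebesgue f" "q = field_class f"
  by (metis L1_cases Quotient_abs_rep[OF Quotient_L1_mod_div_free] field_class_def)

lemma integrable_inner_grad:
  fixes f :: "real^'n::finite \<Rightarrow> real^'n"
  assumes "integrable lebesgue f" "test_function \<phi>"
  shows "integrable lebesgue (\<lambda>x. f x \<bullet> grad \<phi> x)"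
  unfolding inner_vec_def using integrable_component_times_partial[OF assms] by simp

lemma div_free_fields_iff:
  fixes f :: "real^'n::finite \<Rightarrow> real^'n"
  assumes f: "integrable lebesgue f"
  shows "abs_L1 f \<in> div_free_fields \<longleftrightarrow> (\<forall>\<phi>. test_function \<phi> \<longrightarrow> (\<integral>x. f x \<bullet> grad \<phi> x \<partial>lebesgue) = 0)"
proof -
  have "(\<Sum>j\<in>UNIV. distr_partial j (\<lambda>x. f x $ j) \<phi>) = - (\<integral>x. f x \<bullet> grad \<phi> x \<partial>lebesgue)"
    if "test_function \<phi>" for \<phi>
    using integrable_component_times_partial[OF f that]
    by (simp add: distr_partial_def inner_vec_def sum_negf)
  then show ?thesis
    using f by (simp add: div_free_fields_def divergence_free.abs_eq)
qed

lemma field_class_eq_iff: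
  fixes f g :: "real^'n::finite \<Rightarrow> real^'n"
  assumes "integrable lebesgue f" "integrable lebesgue g"
  shows "field_class f = field_class g \<longleftrightarrow>
    (\<forall>\<phi>. test_function \<phi> \<longrightarrow> (\<integral>x. f x \<bullet> grad \<phi> x \<partial>lebesgue) = (\<integral>x. g x \<bullet> grad \<phi> x \<partial>lebesgue))"
proof -
  have "field_class f = field_class g \<longleftrightarrow> abs_L1 (\<lambda>x. f x - g x) \<in> div_free_fields"
    using assms by (simp add: field_class_def L1_mod_div_free.abs_eq_iff abs_L1_minus)
  also have "\<dots> \<longleftrightarrow> (\<forall>\<phi>. test_function \<phi> \<longrightarrow> (\<integral>x. f x \<bullet> grad \<phi> x \<partial>lebesgue) = (\<integral>x. g x \<bullet> grad \<phi> x \<partial>lebesgue))"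
    using assms by (subst div_free_fields_iff) (auto simp: inner_diff_left integrable_inner_grad)
  finally show ?thesis .
qed

lemma pairing_field_class:
  fixes f :: "real^'n::finite \<Rightarrow> real^'n"
  assumes f: "integrable lebesgue f" and \<phi>: "test_function \<phi>"
  shows "pairing (field_class f) \<phi> = (\<integral>x. f x \<bullet> grad \<phi> x \<partial>lebesgue)"
proof -
  let ?g = "rep_L1 (rep_L1_mod_div_free (field_class f))"
  have "L1_rel ?g ?g"
    by (rule Quotient_rep_reflp[OF Quotient_L1])
  moreover have "field_class ?g = field_class f"
    by (simp add: field_class_def Quotient_abs_rep[OF Quotient_L1] Quotient_abs_rep[OF Quotient_L1_mod_div_free])
  ultimately show ?thesis
    using field_class_eq_iff[of ?g f] f \<phi> by (simp add: pairing_def)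
qed

lemma pairing_eqI:
  fixes p q :: "'n::finite L1_mod_div_free"
  assumes "\<And>\<phi>. test_function \<phi> \<Longrightarrow> pairing p \<phi> = pairing q \<phi>"
  shows "p = q"
proof -
  obtain f where f: "integrable lebesgue f" "p = field_class f" by (rule field_class_cases)
  obtain g where g: "integrable lebesgue g" "q = field_class g" by (rule field_class_cases)
  show ?thesis
    using assms f g by (simp add: field_class_eq_iff pairing_field_class)
qed

lemma field_class_add:
  "integrable lebesgue f \<Longrightarrow> integrable lebesgue g \<Longrightarrow> field_class (\<lambda>x. f x + g x) = field_class f + field_class g"
  by (simp add: field_class_def plus_L1_mod_div_free.abs_eq plus_L1.abs_eq)

lemma field_class_diff:
  "integrable lebesgue f \<Longrightarrow> integrable lebesgue g \<Longrightarrow> field_class (\<lambda>x. f x - g x) = field_class f - field_class g"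
  by (simp add: field_class_def minus_L1_mod_div_free.abs_eq minus_L1.abs_eq)

lemma field_class_scaleR:
  "integrable lebesgue f \<Longrightarrow> field_class (\<lambda>x. c *\<^sub>R f x) = c *\<^sub>R field_class f"
  by (simp add: field_class_def scaleR_L1_mod_div_free.abs_eq scaleR_L1.abs_eq)

lemma field_class_zero: "field_class (\<lambda>_. 0) = 0"
  by (simp add: field_class_def zero_L1_mod_div_free_def zero_L1_def)

lemma pairing_add:
  assumes "test_function \<phi>"
  shows "pairing (p + q) \<phi> = pairing p \<phi> + pairing q \<phi>"
proof -
  obtain f where f: "integrable lebesgue f" "p = field_class f" by (rule field_class_cases)
  obtain g where g: "integrable lebesgue g" "q = field_class g" by (rule field_class_cases)
  show ?thesis
    using assms f g by (simp flip: field_class_add add: pairing_field_class inner_add_left integrable_inner_grad)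
qed

lemma pairing_scaleR:
  assumes "test_function \<phi>"
  shows "pairing (c *\<^sub>R q) \<phi> = c * pairing q \<phi>"
proof -
  obtain f where f: "integrable lebesgue f" "q = field_class f" by (rule field_class_cases)
  show ?thesis
    using assms f by (simp flip: field_class_scaleR add: pairing_field_class)
qed

lemma pairing_diff:
  assumes "test_function \<phi>"
  shows "pairing (p - q) \<phi> = pairing p \<phi> - pairing q \<phi>"
  using pairing_add[OF assms, of p "- 1 *\<^sub>R q"] pairing_scaleR[OF assms, of "- 1" q] by simp

lemma norm_abs_L1_mod_div_free:
  fixes F :: "(real^'n::finite, real^'n) L1"
  shows "norm (abs_L1_mod_div_free F) = infdist F div_free_fields"
proof -
  have "div_free_fields \<noteq> ({} :: (real^'n, real^'n) L1 set)"
    using subspace_div_free_fields subspace_0 by blast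
  then show ?thesis
    by (simp add: norm_L1_mod_div_free.abs_eq infdist_def dist_norm)
qed

lemma norm_field_class_le:
  fixes f :: "real^'n::finite \<Rightarrow> real^'n"
  assumes "integrable lebesgue f"
  shows "norm (field_class f) \<le> (\<integral>x. norm (f x) \<partial>lebesgue)"
  using infdist_le[OF subspace_0[OF subspace_div_free_fields], of "abs_L1 f"] assms
  by (simp add: field_class_def norm_abs_L1_mod_div_free norm_abs_L1)

lemma field_class_almost_norm:
  fixes q :: "'n::finite L1_mod_div_free"
  assumes "e > 0"
  obtains f where "integrable lebesgue f" "q = field_class f" "(\<integral>x. norm (f x) \<partial>lebesgue) < norm q + e"
proof -
  let ?N = "div_free_fields :: (real^'n, real^'n) L1 set"
  have "?N \<noteq> {}"
    using subspace_div_free_fields subspace_0 by blast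
  obtain F where F: "q = abs_L1_mod_div_free F"
    by (metis Quotient_abs_rep[OF Quotient_L1_mod_div_free])
  obtain G where G: "G \<in> ?N" "dist F G < infdist F ?N + e"
    using infdist_almost_attained[OF \<open>?N \<noteq> {}\<close> assms, of F] by auto
  obtain f where f: "integrable lebesgue f" "F - G = abs_L1 f"
    by (rule L1_cases)
  have "abs_L1_mod_div_free (F - G) = q"
    using G F subspace_neg[OF subspace_div_free_fields] by (simp add: L1_mod_div_free.abs_eq_iff)
  then show thesis
    using f G by (intro that[of f]) (simp_all add: field_class_def F norm_abs_L1_mod_div_free dist_norm
      norm_abs_L1[symmetric])
qed

text \<open>Along the direction of the gradient \<open>v\<close> itself the derivative is
  \<open>v \<bullet> v\<close>, whereas the difference quotients are at most
  \<open>L * norm v\<close>.\<close>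

lemma norm_grad_le:
  fixes \<phi> :: "real^'n::finite \<Rightarrow> real"
  assumes L: "L-lipschitz_on UNIV \<phi>" and "\<phi> differentiable at x"
  shows "norm (grad \<phi> x) \<le> L"
proof -
  let ?v = "grad \<phi> x"
  have "((\<lambda>t. x + t *\<^sub>R ?v) has_derivative (\<lambda>h. h *\<^sub>R ?v)) (at 0)"
    by (auto intro!: derivative_eq_intros)
  moreover have "(\<phi> has_derivative (\<lambda>h. ?v \<bullet> h)) (at (x + 0 *\<^sub>R ?v))"
    using has_derivative_grad[OF assms(2)] by simp
  ultimately have "((\<lambda>t. \<phi> (x + t *\<^sub>R ?v)) has_derivative (\<lambda>h. ?v \<bullet> (h *\<^sub>R ?v))) (at 0)"
    by (rule has_derivative_compose)
  moreover have "(\<lambda>h. ?v \<bullet> (h *\<^sub>R ?v)) = (*) (?v \<bullet> ?v)"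
    by (simp add: fun_eq_iff)
  ultimately have "((\<lambda>t. \<phi> (x + t *\<^sub>R ?v)) has_real_derivative (?v \<bullet> ?v)) (at 0)"
    by (simp add: has_field_derivative_def)
  then have lim: "((\<lambda>t. (\<phi> (x + t *\<^sub>R ?v) - \<phi> x) / t) \<longlongrightarrow> ?v \<bullet> ?v) (at 0)"
    by (simp add: DERIV_def)
  have "?v \<bullet> ?v \<le> L * norm ?v"
  proof (rule tendsto_upperbound[OF lim always_eventually])
    show "\<forall>t. (\<phi> (x + t *\<^sub>R ?v) - \<phi> x) / t \<le> L * norm ?v"
    proof
      fix t :: real
      have "\<bar>\<phi> (x + t *\<^sub>R ?v) - \<phi> x\<bar> \<le> L * (\<bar>t\<bar> * norm ?v)"
        using lipschitz_onD[OF L, of "x + t *\<^sub>R ?v" x] by (simp add: dist_norm)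
      then have "\<bar>(\<phi> (x + t *\<^sub>R ?v) - \<phi> x) / t\<bar> \<le> L * norm ?v"
        using lipschitz_on_nonneg[OF L] by (cases "t = 0") (simp_all add: abs_divide divide_le_eq mult_ac)
      then show "(\<phi> (x + t *\<^sub>R ?v) - \<phi> x) / t \<le> L * norm ?v"
        by linarith
    qed
  qed simp
  then have "norm ?v * norm ?v \<le> L * norm ?v"
    by (simp add: power2_norm_eq_inner[symmetric] power2_eq_square)
  then show ?thesis
    using lipschitz_on_nonneg[OF L] by (cases "norm ?v = 0") (auto simp: mult_le_cancel_right)
qed

lemma abs_pairing_le:
  fixes q :: "'n::finite L1_mod_div_free"
  assumes \<phi>: "test_function \<phi>" "L-lipschitz_on UNIV \<phi>"
  shows "\<bar>pairing q \<phi>\<bar> \<le> L * norm q"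
proof -
  note L = lipschitz_on_nonneg[OF \<phi>(2)]
  have "\<bar>pairing q \<phi>\<bar> \<le> L * norm q + e" if "e > 0" for e
  proof -
    \<comment> \<open>\<open>L + 1\<close> instead of \<open>L\<close> covers \<open>L = 0\<close>
      and still gives \<open>L * (e / (L + 1)) \<le> e\<close>.\<close>
    have "e / (L + 1) > 0"
      using that L by simp
    then obtain f where f: "integrable lebesgue f" "q = field_class f"
      "(\<integral>x. norm (f x) \<partial>lebesgue) < norm q + e / (L + 1)"
      by (rule field_class_almost_norm)
    have "\<bar>pairing q \<phi>\<bar> \<le> (\<integral>x. \<bar>f x \<bullet> grad \<phi> x\<bar> \<partial>lebesgue)"
      unfolding f(2) pairing_field_class[OF f(1) \<phi>(1)] by (rule integral_abs_bound)
    also have "\<dots> \<le> (\<integral>x. L * norm (f x) \<partial>lebesgue)"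
    proof (rule integral_mono)
      show "\<bar>f x \<bullet> grad \<phi> x\<bar> \<le> L * norm (f x)" for x
        using Cauchy_Schwarz_ineq2[of "f x" "grad \<phi> x"]
          mult_left_mono[OF norm_grad_le[OF \<phi>(2) test_function_differentiable[OF \<phi>(1)], of x], of "norm (f x)"]
        by (simp add: mult.commute)
    qed (use f(1) integrable_inner_grad[OF f(1) \<phi>(1)] in auto)
    also have "\<dots> \<le> L * (norm q + e / (L + 1))"
      using f(3) L by (auto intro!: mult_left_mono)
    also have "\<dots> \<le> L * norm q + e"
      using that L by (simp add: field_simps)
    finally show ?thesis .
  qed
  then show ?thesis
    by (rule field_le_epsilon)
qed

lemma lebesgue_integrable_lborel:
  "integrable lborel f \<Longrightarrow> integrable lebesgue f" for f :: "'a::euclidean_space \<Rightarrow> 'b::{banach, second_countable_topology}"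
  by (simp add: integrable_completion)

lemma lebesgue_integral_lborel:
  "f \<in> borel_measurable borel \<Longrightarrow> (\<integral>x. f x \<partial>lebesgue) = (\<integral>x. f x \<partial>lborel)"
  for f :: "'a::euclidean_space \<Rightarrow> 'b::{banach, second_countable_topology}"
  by (simp add: integral_completion)

lemma pairing_field_class_lborel:
  fixes f :: "real^'n::finite \<Rightarrow> real^'n"
  assumes f: "integrable lborel f" and \<phi>: "test_function \<phi>"
  shows "pairing (field_class f) \<phi> = (\<integral>x. f x \<bullet> grad \<phi> x \<partial>lborel)"
proof -
  have [measurable]: "f \<in> borel_measurable borel" "grad \<phi> \<in> borel_measurable borel"
    using f test_function_grad_continuous[OF \<phi>] by (auto intro: borel_measurable_continuous_onI)
  show ?thesis
    using f \<phi> by (simp add: pairing_field_class lebesgue_integrable_lborel lebesgue_integral_lborel)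
qed

lemma norm_field_class_le_lborel:
  fixes f :: "real^'n::finite \<Rightarrow> real^'n"
  assumes f: "integrable lborel f"
  shows "norm (field_class f) \<le> (\<integral>x. norm (f x) \<partial>lborel)"
proof -
  have [measurable]: "f \<in> borel_measurable borel"
    using f by auto
  show ?thesis
    using norm_field_class_le[OF lebesgue_integrable_lborel[OF f]] by (simp add: lebesgue_integral_lborel)
qed

section \<open>Classes that contract a set to a point, and dipoles\<close>

lemma integrable_indicator_bounded:
  fixes g :: "'a::euclidean_space \<Rightarrow> real"
  assumes [measurable]: "A \<in> sets borel" and A: "bounded A" and g: "continuous_on UNIV g"
  shows "integrable lborel (\<lambda>w. indicator A w * g w)"
proof -
  have [measurable]: "g \<in> borel_measurable borel"
    using g by (rule borel_measurable_continuous_onI)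
  have K: "compact (closure A)"
    using A by (simp add: compact_closure)
  have "integrable lborel (\<lambda>w. indicator (closure A) w *\<^sub>R g w)"
    using g by (intro borel_integrable_compact[unfolded set_integrable_def] K) (auto intro: continuous_on_subset)
  then show ?thesis
    by (rule Bochner_Integration.integrable_bound)
      (measurable, use closure_subset[of A] in \<open>auto simp: indicator_def\<close>)
qed

lemma integral_indicator_const:
  fixes A :: "'a::euclidean_space set"
  assumes "A \<in> sets borel"
  shows "(\<integral>w. indicator A w * c \<partial>lborel) = measure lborel A * c"
  using assms by simp

text \<open>With \<open>c = -1\<close> the displacement of \<open>w\<close> is \<open>d - w\<close>,
  so every segment ends at \<open>d\<close> and the mass of \<open>A\<close> is collected
  there.\<close>

lemma cone_class:
  fixes A :: "(real^'n::finite) set"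
  assumes A: "A \<in> sets borel" "bounded A"
  obtains q :: "'n L1_mod_div_free"
  where "\<And>\<phi>. test_function \<phi> \<Longrightarrow> pairing q \<phi> = measure lborel A * \<phi> d - (\<integral>w. indicator A w * \<phi> w \<partial>lborel)"
    and "norm q \<le> (\<integral>w. indicator A w * norm (d - w) \<partial>lborel)"
proof -
  note E = segment_density[where c = "-1" and d = d, OF A]
  let ?q = "field_class (segment_density A (-1) d)"
  show thesis
  proof (rule that[of ?q])
    show "pairing ?q \<phi> = measure lborel A * \<phi> d - (\<integral>w. indicator A w * \<phi> w \<partial>lborel)" if \<phi>: "test_function \<phi>" for \<phi>
    proof -
      have int: "integrable lborel (\<lambda>w. indicator A w * \<phi> w)" "integrable lborel (\<lambda>w. indicator A w * \<phi> d)"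
        using A test_function_continuous[OF \<phi>] by (intro integrable_indicator_bounded; simp)+
      have "pairing ?q \<phi> = (\<integral>w. indicator A w * \<phi> d - indicator A w * \<phi> w \<partial>lborel)"
        by (subst pairing_field_class_lborel[OF E(1) \<phi>], simp, subst E(3)[OF _ \<phi>]) (simp_all add: right_diff_distrib)
      also have "\<dots> = measure lborel A * \<phi> d - (\<integral>w. indicator A w * \<phi> w \<partial>lborel)"
        using int A by (simp only: Bochner_Integration.integral_diff integral_indicator_const)
      finally show ?thesis .
    qed
    show "norm ?q \<le> (\<integral>w. indicator A w * norm (d - w) \<partial>lborel)"
      using order_trans[OF norm_field_class_le_lborel[OF E(1)] E(2)] by simp
  qed
qed


text \<open>Every point of the ball of radius \<open>e/2\<close> around the midpoint is within
  \<open>norm (x - y) / 2 + e / 2\<close> of both ends. The difference of the cones to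
  \<open>x\<close> and to \<open>y\<close> cancels the uniform mass on the ball, and normalising by
  the volume gives the bound.\<close>

lemma dipole_class_approx:
  fixes x y :: "real^'n::finite"
  assumes e: "e > 0"
  obtains q :: "'n L1_mod_div_free"
  where "\<And>\<phi>. test_function \<phi> \<Longrightarrow> pairing q \<phi> = \<phi> x - \<phi> y" "norm q \<le> norm (x - y) + e"
proof -
  define m where "m = (1/2) *\<^sub>R (x + y)"
  let ?A = "ball m (e/2)"
  have A: "?A \<in> sets borel" "bounded ?A"
    by auto
  have M: "measure lborel ?A > 0"
    using content_ball_pos[of "e/2" m] e by simp
  have fin: "integrable lborel (\<lambda>w. indicator ?A w * c)" for c :: real
    using integrable_indicator_bounded[OF A continuous_on_const] .
  obtain p where p: "\<And>\<phi>. test_function \<phi> \<Longrightarrow> pairing p \<phi> = measure lborel ?A * \<phi> x - (\<integral>w. indicator ?A w * \<phi> w \<partial>lborel)"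
    "norm p \<le> (\<integral>w. indicator ?A w * norm (x - w) \<partial>lborel)"
    using cone_class[OF A, of x] by blast
  obtain q where q: "\<And>\<phi>. test_function \<phi> \<Longrightarrow> pairing q \<phi> = measure lborel ?A * \<phi> y - (\<integral>w. indicator ?A w * \<phi> w \<partial>lborel)"
    "norm q \<le> (\<integral>w. indicator ?A w * norm (y - w) \<partial>lborel)"
    using cone_class[OF A, of y] by blast
  have le: "(\<integral>w. indicator ?A w * norm (z - w) \<partial>lborel) \<le> measure lborel ?A * (norm (x - y) / 2 + e / 2)"
    if z: "norm (z - m) = norm (x - y) / 2" for z
  proof -
    have "(\<integral>w. indicator ?A w * norm (z - w) \<partial>lborel) \<le> (\<integral>w. indicator ?A w * (norm (x - y) / 2 + e / 2) \<partial>lborel)"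
    proof (rule integral_mono[OF integrable_indicator_bounded[OF A] fin])
      show "continuous_on UNIV (\<lambda>w. norm (z - w))"
        by (intro continuous_intros)
      show "indicator ?A w * norm (z - w) \<le> indicator ?A w * (norm (x - y) / 2 + e / 2)" for w
        using z norm_triangle_ineq[of "z - m" "m - w"] by (auto simp: indicator_def dist_norm)
    qed
    then show ?thesis
      by (simp only: integral_indicator_const[OF A(1)])
  qed
  have m: "x - m = (1/2) *\<^sub>R (x - y)" "y - m = - (1/2) *\<^sub>R (x - y)"
    by (simp_all add: m_def vec_eq_iff field_simps)
  have mx: "norm (x - m) = norm (x - y) / 2" and my: "norm (y - m) = norm (x - y) / 2"
    unfolding m by simp_all
  have "norm (p - q) \<le> measure lborel ?A * (norm (x - y) / 2 + e / 2) + measure lborel ?A * (norm (x - y) / 2 + e / 2)"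
    by (intro order_trans[OF norm_triangle_ineq4] add_mono order_trans[OF p(2) le[OF mx]] order_trans[OF q(2) le[OF my]])
  also have "\<dots> = measure lborel ?A * (norm (x - y) + e)"
    by (simp add: field_simps)
  finally have "norm ((1 / measure lborel ?A) *\<^sub>R (p - q)) \<le> norm (x - y) + e"
    unfolding norm_scaleR using M by (simp add: field_simps)
  then show thesis
    using M p(1) q(1) by (intro that[of "(1 / measure lborel ?A) *\<^sub>R (p - q)"])
      (simp_all add: pairing_scaleR pairing_diff flip: right_diff_distrib)
qed

text \<open>The approximate dipoles for different \<open>e\<close> have equal pairings and hence are
  one and the same class, so its norm obeys all the bounds at once.\<close>

lemma dipole_class:
  fixes x y :: "real^'n::finite"
  obtains q :: "'n L1_mod_div_free"
  where "\<And>\<phi>. test_function \<phi> \<Longrightarrow> pairing q \<phi> = \<phi> x - \<phi> y" "norm q \<le> norm (x - y)"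
proof -
  obtain q :: "'n L1_mod_div_free" where q: "\<And>\<phi>. test_function \<phi> \<Longrightarrow> pairing q \<phi> = \<phi> x - \<phi> y"
    using dipole_class_approx[of 1 x y] by auto
  have "norm q \<le> norm (x - y) + e" if e: "e > 0" for e
  proof -
    obtain q' :: "'n L1_mod_div_free" where q': "\<And>\<phi>. test_function \<phi> \<Longrightarrow> pairing q' \<phi> = \<phi> x - \<phi> y" "norm q' \<le> norm (x - y) + e"
      using dipole_class_approx[OF e, of x y] by auto
    have "q = q'"
      using q q'(1) by (intro pairing_eqI) simp
    with q'(2) show ?thesis by simp
  qed
  then have "norm q \<le> norm (x - y)"
    by (rule field_le_epsilon)
  with q that show thesis by blast
qed

text \<open>The counterpart of \<open>delta x\<close> in the quotient. The choice is unique by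
  \<open>pairing_eqI\<close>.\<close>

definition point_class :: "real^'n::finite \<Rightarrow> 'n L1_mod_div_free"
  where "point_class x = (SOME q. \<forall>\<phi>. test_function \<phi> \<longrightarrow> pairing q \<phi> = \<phi> x - \<phi> 0)"

lemma pairing_point_class:
  assumes "test_function \<phi>"
  shows "pairing (point_class x) \<phi> = \<phi> x - \<phi> 0"
proof -
  have "\<exists>q. \<forall>\<phi>. test_function \<phi> \<longrightarrow> pairing q \<phi> = \<phi> x - \<phi> 0"
    using dipole_class[of x 0] by blast
  from someI_ex[OF this] assms show ?thesis
    by (simp add: point_class_def)
qed

lemma norm_point_class_diff: "norm (point_class x - point_class y) \<le> norm (x - y)"
proof -
  obtain q where q: "\<And>\<phi>. test_function \<phi> \<Longrightarrow> pairing q \<phi> = \<phi> x - \<phi> y" "norm q \<le> norm (x - y)"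
    using dipole_class[of x y] by auto
  have "point_class x - point_class y = q"
    using q(1) by (intro pairing_eqI) (simp add: pairing_diff pairing_point_class)
  with q(2) show ?thesis by simp
qed

lemma point_class_0: "point_class 0 = 0"
  using pairing_scaleR[of _ 0 0] by (intro pairing_eqI) (simp add: pairing_point_class)

section \<open>Density of the span of the point classes\<close>

abbreviation point_span :: "'n::finite L1_mod_div_free set"
  where "point_span \<equiv> closure (span (range point_class))"

lemma subspace_closure:
  fixes S :: "'a::real_normed_vector set"
  assumes S: "subspace S"
  shows "subspace (closure S)"
proof (rule subspaceI)
  show "0 \<in> closure S"
    using subspace_0[OF S] closure_subset by blast
  show "x + y \<in> closure S" if xy: "x \<in> closure S" "y \<in> closure S" for x y
  proof -
    obtain f g where "\<forall>n. f n \<in> S" "f \<longlonglongrightarrow> x" "\<forall>n. g n \<in> S" "g \<longlonglongrightarrow> y"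
      using xy unfolding closure_sequential by blast
    then show ?thesis
      unfolding closure_sequential using subspace_add[OF S] tendsto_add
      by (intro exI[of _ "\<lambda>n. f n + g n"]) blast
  qed
  show "c *\<^sub>R x \<in> closure S" if "x \<in> closure S" for c x
    using subspace_scale[OF S] closure_scaleR[of c S] that closure_mono[of "(*\<^sub>R) c ` S" S] by blast
qed

lemma subspace_point_span: "subspace (point_span :: 'n::finite L1_mod_div_free set)"
  by (intro subspace_closure subspace_span)

text \<open>
  \<open>v + r\<close> is the class with pairing \<open>\<integral>\<^sub>A \<phi> - |A| \<phi> 0\<close>: the parts of \<open>A\<close> near the centres \<open>x \<in> S\<close> are
  contracted to \<open>x\<close>, which moves mass over a distance of at most \<open>\<delta>\<close>.
\<close>

lemma uniform_class_split:
  fixes S A :: "(real^'n::finite) set"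
  assumes "finite S" "\<delta> > 0" "A \<in> sets borel" "bounded A" "A \<subseteq> (\<Union>x\<in>S. ball x \<delta>)"
  shows "\<exists>v\<in>span (range point_class). \<exists>r. norm r \<le> \<delta> * measure lborel A \<and> (\<forall>\<phi>. test_function \<phi> \<longrightarrow>
    pairing (v + r) \<phi> = (\<integral>w. indicator A w * \<phi> w \<partial>lborel) - measure lborel A * \<phi> 0)"
  using assms
proof (induction S arbitrary: A rule: finite_induct)
  case empty
  then show ?case
    using pairing_scaleR[of _ 0 0] by (intro bexI[of _ 0] exI[of _ 0]) (auto simp: span_zero)
next
  case (insert x S)
  let ?B = "A \<inter> ball x \<delta>" and ?C = "A - ball x \<delta>"
  have B: "?B \<in> sets borel" "bounded ?B" and C: "?C \<in> sets borel" "bounded ?C"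
    using insert.prems by (auto intro: bounded_subset)
  have "\<exists>v\<in>span (range point_class). \<exists>r. norm r \<le> \<delta> * measure lborel ?C \<and> (\<forall>\<phi>. test_function \<phi> \<longrightarrow>
      pairing (v + r) \<phi> = (\<integral>w. indicator ?C w * \<phi> w \<partial>lborel) - measure lborel ?C * \<phi> 0)"
    using insert.prems C by (intro insert.IH) auto
  then obtain v r where v: "v \<in> span (range point_class)" "norm r \<le> \<delta> * measure lborel ?C"
    "\<And>\<phi>. test_function \<phi> \<Longrightarrow> pairing (v + r) \<phi> = (\<integral>w. indicator ?C w * \<phi> w \<partial>lborel) - measure lborel ?C * \<phi> 0"
    by blast
  obtain q where q: "\<And>\<phi>. test_function \<phi> \<Longrightarrow> pairing q \<phi> = measure lborel ?B * \<phi> x - (\<integral>w. indicator ?B w * \<phi> w \<partial>lborel)"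
    "norm q \<le> (\<integral>w. indicator ?B w * norm (x - w) \<partial>lborel)"
    using cone_class[OF B, of x] by blast
  have "(\<integral>w. indicator ?B w * norm (x - w) \<partial>lborel) \<le> (\<integral>w. indicator ?B w * \<delta> \<partial>lborel)"
    by (intro integral_mono integrable_indicator_bounded B continuous_intros)
      (auto simp: indicator_def dist_norm)
  then have q_le: "norm q \<le> \<delta> * measure lborel ?B"
    using q(2) by (simp only: integral_indicator_const[OF B(1)] mult.commute[of \<delta>])
  have fin: "emeasure lborel ?B \<noteq> \<infinity>" "emeasure lborel ?C \<noteq> \<infinity>"
    using emeasure_bounded_finite[OF B(2)] emeasure_bounded_finite[OF C(2)] by auto
  have M: "measure lborel A = measure lborel ?B + measure lborel ?C"
    using measure_Union[of lborel ?B ?C] B C fin by (simp add: Int_Diff_Un Int_Diff_disjoint)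
  show ?case
  \<comment> \<open>On test functions \<open>measure lborel ?B *\<^sub>R point_class x - q\<close>
    pairs to the integral over \<open>?B\<close> minus \<open>measure lborel ?B * \<phi> 0\<close>.
    The multiple of the point class joins \<open>v\<close>, and \<open>- q\<close> joins the
    remainder. Since \<open>?B\<close> and \<open>?C\<close> are disjoint, the two costs add up to
    \<delta> times the measure of \<open>A\<close>.\<close>
  proof (intro bexI[of _ "v + measure lborel ?B *\<^sub>R point_class x"] exI[of _ "r - q"] conjI allI impI)
    show "v + measure lborel ?B *\<^sub>R point_class x \<in> span (range point_class)"
      by (rule span_add[OF v(1)], rule span_scale, rule span_base) simp
    show "norm (r - q) \<le> \<delta> * measure lborel A"
      using norm_triangle_ineq4[of r q] q_le v(2) by (simp add: M distrib_left)
    fix \<phi> :: "real^'n \<Rightarrow> real"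
    assume \<phi>: "test_function \<phi>"
    have "(\<integral>w. indicator A w * \<phi> w \<partial>lborel) = (\<integral>w. indicator ?B w * \<phi> w + indicator ?C w * \<phi> w \<partial>lborel)"
      by (intro Bochner_Integration.integral_cong) (auto simp: indicator_def)
    also have "\<dots> = (\<integral>w. indicator ?B w * \<phi> w \<partial>lborel) + (\<integral>w. indicator ?C w * \<phi> w \<partial>lborel)"
      by (intro Bochner_Integration.integral_add integrable_indicator_bounded B C test_function_continuous \<phi>)
    finally show "pairing (v + measure lborel ?B *\<^sub>R point_class x + (r - q)) \<phi> =
        (\<integral>w. indicator A w * \<phi> w \<partial>lborel) - measure lborel A * \<phi> 0"
      using v(3)[OF \<phi>] q(1)[OF \<phi>] \<phi>
      by (simp add: pairing_add pairing_diff pairing_scaleR pairing_point_class M algebra_simps)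
  qed
qed

text \<open>Total boundedness covers \<open>A\<close> by finitely many balls of any radius \<delta>.
  The split then writes the same \<open>q\<close> as an element of the span plus a remainder of norm
  at most \<open>\<delta> * measure lborel A\<close>.\<close>

lemma uniform_class_in_point_span:
  fixes A :: "(real^'n::finite) set"
  assumes A: "A \<in> sets borel" "bounded A"
    and q: "\<And>\<phi>. test_function \<phi> \<Longrightarrow> pairing q \<phi> = (\<integral>w. indicator A w * \<phi> w \<partial>lborel) - measure lborel A * \<phi> 0"
  shows "q \<in> point_span"
  unfolding closure_approachable
proof (intro allI impI)
  fix e :: real
  assume e: "e > 0"
  define \<delta> where "\<delta> = e / (measure lborel A + 1)"
  have M: "measure lborel A + 1 > 0"
    by (simp add: add_nonneg_pos)
  have \<delta>: "\<delta> > 0"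
    using e M unfolding \<delta>_def by (rule divide_pos_pos)
  have "compact (closure A)"
    using A by (simp add: compact_closure)
  then obtain S where S: "finite S" "closure A \<subseteq> (\<Union>x\<in>S. ball x \<delta>)"
    using \<delta> by (metis compact_eq_totally_bounded)
  then have "A \<subseteq> (\<Union>x\<in>S. ball x \<delta>)"
    using closure_subset by blast
  then obtain v r where v: "v \<in> span (range point_class)" "norm r \<le> \<delta> * measure lborel A"
    "\<And>\<phi>. test_function \<phi> \<Longrightarrow> pairing (v + r) \<phi> = (\<integral>w. indicator A w * \<phi> w \<partial>lborel) - measure lborel A * \<phi> 0"
    using uniform_class_split[OF S(1) \<delta> A] by blast
  have "q = v + r"
    using q v(3) by (intro pairing_eqI) simp
  then have "dist v q \<le> \<delta> * measure lborel A"
    using v(2) by (simp add: dist_norm)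
  also have "\<dots> < \<delta> * (measure lborel A + 1)"
    using \<delta> by simp
  also have "\<dots> = e"
    using M by (simp add: \<delta>_def)
  finally show "\<exists>v\<in>span (range point_class). dist v q < e"
    using v(1) by blast
qed


lemma uniform_class_exists:
  fixes A :: "(real^'n::finite) set"
  assumes A: "A \<in> sets borel" "bounded A"
  obtains q where "q \<in> point_span"
    "\<And>\<phi>. test_function \<phi> \<Longrightarrow> pairing q \<phi> = (\<integral>w. indicator A w * \<phi> w \<partial>lborel) - measure lborel A * \<phi> 0"
proof -
  obtain q where q: "\<And>\<phi>. test_function \<phi> \<Longrightarrow> pairing q \<phi> = measure lborel A * \<phi> 0 - (\<integral>w. indicator A w * \<phi> w \<partial>lborel)"
    using cone_class[OF A, of 0] by blast
  \<comment> \<open>The cone to \<open>0\<close> collects mass at the origin; the sign change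
    distributes it over \<open>A\<close> instead.\<close>
  have *: "pairing (- 1 *\<^sub>R q) \<phi> = (\<integral>w. indicator A w * \<phi> w \<partial>lborel) - measure lborel A * \<phi> 0" if "test_function \<phi>" for \<phi>
    unfolding pairing_scaleR[OF that] q[OF that] by simp
  show thesis
    using that[OF uniform_class_in_point_span[OF A *] *] by blast
qed

lemma integral_lborel_translate:
  fixes g :: "'a::euclidean_space \<Rightarrow> real"
  assumes "integrable lborel g"
  shows "(\<integral>z. g (z - b) \<partial>lborel) = (\<integral>w. g w \<partial>lborel)"
  using has_bochner_integral_scale[OF assms, of 1 b] by (simp add: has_bochner_integral_iff)

text \<open>Moving \<open>A\<close> by \<open>d\<close> creates uniform mass on the translate and
  removes it from \<open>A\<close>. Both sets have the same measure, so the terms at the origin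
  cancel in the difference of the two uniform classes.\<close>

lemma translation_class_in_point_span:
  fixes A :: "(real^'n::finite) set"
  assumes A: "A \<in> sets borel" "bounded A"
  shows "field_class (segment_density A 0 d) \<in> point_span"
proof -
  define B where "B = (\<lambda>z. z - d) -` A"
  have "(\<lambda>z. z - d) \<in> borel_measurable borel"
    by simp
  from measurable_sets[OF this A(1)] have B1: "B \<in> sets borel"
    by (simp add: B_def)
  have "B = (\<lambda>w. w + d) ` A"
    by (force simp: B_def image_iff)
  then have B2: "bounded B"
    using bounded_translation[OF A(2), of d] by (simp add: add.commute)
  have ind: "indicator A (z - d) = (indicator B z :: real)" for z
    by (simp add: B_def indicator_def)
  obtain p where p: "p \<in> point_span"
    "\<And>\<phi>. test_function \<phi> \<Longrightarrow> pairing p \<phi> = (\<integral>w. indicator B w * \<phi> w \<partial>lborel) - measure lborel B * \<phi> 0"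
    using uniform_class_exists[OF B1 B2] by blast
  obtain q where q: "q \<in> point_span"
    "\<And>\<phi>. test_function \<phi> \<Longrightarrow> pairing q \<phi> = (\<integral>w. indicator A w * \<phi> w \<partial>lborel) - measure lborel A * \<phi> 0"
    using uniform_class_exists[OF A] by blast
  have M: "measure lborel B = measure lborel A"
    using integral_lborel_translate[OF integrable_indicator_bounded[OF A continuous_on_const[of UNIV 1]], of d] A(1) B1
    by (simp add: ind)
  have "field_class (segment_density A 0 d) = p - q"
  proof (rule pairing_eqI)
    fix \<phi> :: "real^'n \<Rightarrow> real"
    assume \<phi>: "test_function \<phi>"
    note cont = test_function_continuous[OF \<phi>]
    have int: "integrable lborel (\<lambda>w. indicator A w * \<phi> (w + d))"
      by (intro integrable_indicator_bounded A continuous_on_compose2[OF cont] continuous_intros) auto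
    have "pairing (field_class (segment_density A 0 d)) \<phi> = (\<integral>w. indicator A w * (\<phi> (w + d) - \<phi> w) \<partial>lborel)"
      using segment_density(1,3)[where c = 0 and d = d, OF A] \<phi> by (simp add: pairing_field_class_lborel)
    also have "\<dots> = (\<integral>w. indicator A w * \<phi> (w + d) \<partial>lborel) - (\<integral>w. indicator A w * \<phi> w \<partial>lborel)"
      unfolding right_diff_distrib
      by (intro Bochner_Integration.integral_diff int integrable_indicator_bounded A cont)
    also have "(\<integral>w. indicator A w * \<phi> (w + d) \<partial>lborel) = (\<integral>w. indicator B w * \<phi> w \<partial>lborel)"
      using integral_lborel_translate[OF int, of d] by (simp add: ind)
    finally show "pairing (field_class (segment_density A 0 d)) \<phi> = pairing (p - q) \<phi>"
      using p(2)[OF \<phi>] q(2)[OF \<phi>] by (simp add: pairing_diff[OF \<phi>] M)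
  qed
  then show ?thesis
    using subspace_diff[OF subspace_point_span p(1) q(1)] by simp
qed

text \<open>Dominated convergence gives convergence in \<open>L1\<close>, the quotient norm is no
  larger, and \<open>point_span\<close> is closed. All limits of fields in the density argument pass
  through this lemma.\<close>

lemma field_class_dominated_limit:
  fixes f :: "real^'n::finite \<Rightarrow> real^'n"
  assumes s: "\<And>k. integrable lebesgue (s k)" "\<And>k. field_class (s k) \<in> point_span"
    and f: "f \<in> borel_measurable lebesgue" and w: "integrable lebesgue w"
    and lim: "AE x in lebesgue. (\<lambda>k. s k x) \<longlonglongrightarrow> f x"
    and bound: "\<And>k. AE x in lebesgue. norm (s k x) \<le> w x"
  shows "field_class f \<in> point_span"
proof -
  have s_meas: "s k \<in> borel_measurable lebesgue" for k
    using s(1) by auto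
  have int_f: "integrable lebesgue f"
    by (rule integrable_dominated_convergence[OF f s_meas w lim bound])
  have "(\<lambda>k. \<integral>x. norm (s k x - f x) \<partial>lebesgue) \<longlonglongrightarrow> (\<integral>x. 0 \<partial>(lebesgue :: (real^'n) measure))"
  proof (rule integral_dominated_convergence)
    show "integrable lebesgue (\<lambda>x. w x + norm (f x))"
      using w int_f by simp
    show "AE x in lebesgue. (\<lambda>k. norm (s k x - f x)) \<longlonglongrightarrow> 0"
      using lim by eventually_elim (rule tendsto_norm_zero[OF LIM_zero])
    show "AE x in lebesgue. norm (norm (s k x - f x)) \<le> w x + norm (f x)" for k
      using bound[of k]
    proof eventually_elim
      case (elim x)
      then show ?case
        using norm_triangle_ineq4[of "s k x" "f x"] by simp
    qed
  qed (use s_meas f in measurable)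
  then have lim0: "(\<lambda>k. \<integral>x. norm (s k x - f x) \<partial>lebesgue) \<longlonglongrightarrow> 0"
    by simp
  have "(\<lambda>k. field_class (s k) - field_class f) \<longlonglongrightarrow> 0"
  proof (rule Lim_null_comparison[OF _ lim0])
    show "\<forall>\<^sub>F k in sequentially. norm (field_class (s k) - field_class f) \<le> (\<integral>x. norm (s k x - f x) \<partial>lebesgue)"
      using norm_field_class_le[OF Bochner_Integration.integrable_diff[OF s(1) int_f]] s(1) int_f
      by (simp add: field_class_diff)
  qed
  then have "(\<lambda>k. field_class (s k)) \<longlonglongrightarrow> field_class f"
    by (rule LIM_zero_cancel)
  then show ?thesis
    using s(2) closed_sequentially[OF closed_closure, of "\<lambda>k. field_class (s k)"] by blast
qed

lemma integrable_indicator_vector: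
  fixes v :: "'b::euclidean_space"
  assumes A: "A \<in> sets lebesgue" "bounded A"
  shows "integrable lebesgue (\<lambda>z::'a::euclidean_space. indicator A z *\<^sub>R v)"
proof -
  have "A \<in> lmeasurable"
    using A by (rule bounded_set_imp_lmeasurable[rotated])
  then show ?thesis
    by (auto simp: fmeasurable_def intro!: integrable_scaleR_left integrable_real_indicator)
qed

text \<open>Translating the box by \<open>h k *\<^sub>R v\<close> and dividing by \<open>h k\<close>
  gives fields that tend to the constant \<open>v\<close> on the box and to \<open>0\<close> outside
  its closure. The frontier, where this may fail, is a null set because the box is convex.\<close>

lemma box_class_in_point_span:
  fixes a b v :: "real^'n::finite"
  shows "field_class (\<lambda>z. indicator (box a b) z *\<^sub>R v) \<in> point_span"
proof -
  let ?Q = "box a b"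
  define h where "h k = 1 / real (Suc k)" for k
  have h: "h k > 0" "h k \<le> 1" for k
    by (simp_all add: h_def)
  have h_lim: "h \<longlonglongrightarrow> 0"
    unfolding h_def by (rule LIMSEQ_Suc[OF lim_1_over_n])
  define m where "m k z = (\<integral>t. indicator {0<..<1::real} t * indicator ?Q (z - t *\<^sub>R h k *\<^sub>R v) \<partial>lborel :: real)" for k and z :: "real^'n"
  have Q: "?Q \<in> sets borel" "bounded ?Q"
    by auto
  obtain R where R: "\<And>z. z \<in> ?Q \<Longrightarrow> norm z \<le> R"
    using Q(2) by (auto simp: bounded_iff)
  \<comment> \<open>\<open>s k\<close> averages the translates of \<open>indicator ?Q\<close> along the segment from \<open>0\<close> to \<open>h k *\<^sub>R v\<close>.\<close>
  define s where "s k z = (1 / h k) *\<^sub>R segment_density ?Q 0 (h k *\<^sub>R v) z" for k z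
  have s: "s k z = m k z *\<^sub>R v" for k z
  proof -
    have int: "integrable lborel (\<lambda>t. indicator {0<..<1::real} t * indicator ?Q (z - t *\<^sub>R h k *\<^sub>R v) :: real)"
    proof (rule Bochner_Integration.integrable_bound)
      show "integrable lborel (indicator {0<..<1::real} :: real \<Rightarrow> real)"
        by simp
    qed (measurable, auto simp: indicator_def)
    have "segment_density ?Q 0 (h k *\<^sub>R v) z =
        (\<integral>t. (indicator {0<..<1} t * indicator ?Q (z - t *\<^sub>R h k *\<^sub>R v)) *\<^sub>R (h k *\<^sub>R v) \<partial>lborel)"
      unfolding segment_density_def by (rule Bochner_Integration.integral_cong) simp_all
    also have "\<dots> = m k z *\<^sub>R (h k *\<^sub>R v)"
      unfolding m_def by (rule integral_scaleR_left[OF int])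
    finally show ?thesis
      using h(1)[of k] by (simp add: s_def)
  qed
  have near: "norm (t *\<^sub>R h k *\<^sub>R v) \<le> h k * norm v" if "0 < t" "t < 1" for t k
    using that h(1)[of k] mult_right_mono[of t 1 "h k * norm v"] by simp
  have m_const: "m k z = c" if "\<And>t. 0 < t \<Longrightarrow> t < 1 \<Longrightarrow> indicator ?Q (z - t *\<^sub>R h k *\<^sub>R v) = c" for k z c
  proof -
    have "m k z = (\<integral>t. indicator {0<..<1::real} t * c \<partial>lborel)"
      unfolding m_def using that by (intro Bochner_Integration.integral_cong) (auto simp: indicator_def)
    then show ?thesis by simp
  qed
  have m_bound: "\<bar>m k z\<bar> \<le> 1" for k z
  proof -
    have "\<bar>m k z\<bar> \<le> (\<integral>t. \<bar>indicator {0<..<1} t * indicator ?Q (z - t *\<^sub>R h k *\<^sub>R v)\<bar> \<partial>lborel)"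
      unfolding m_def by (rule integral_abs_bound)
    also have "\<dots> \<le> (\<integral>t. indicator {0<..<1::real} t \<partial>lborel)"
      by (rule integral_mono') (simp, auto simp: indicator_def)
    finally show ?thesis by simp
  qed
  \<comment> \<open>Since \<open>h k \<le> 1\<close>, all translates involved stay in this ball, so
    one integrable bound serves every \<open>k\<close>.\<close>
  let ?C = "cball 0 (R + norm v) :: (real^'n) set"
  have s_bound: "norm (s k z) \<le> indicator ?C z * norm v" for k z
  proof (cases "z \<in> ?C")
    case True
    then show ?thesis
      using mult_right_mono[OF m_bound, of "norm v" k z] by (simp add: s)
  next
    case False
    have "m k z = 0"
    proof (rule m_const)
      fix t :: real
      assume t: "0 < t" "t < 1"
      have "h k * norm v \<le> norm v"
        using h[of k] mult_right_mono[of "h k" 1 "norm v"] by simp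
      then have "\<not> norm (z - t *\<^sub>R h k *\<^sub>R v) \<le> R"
        using False near[OF t, of k] norm_triangle_sub[of z "t *\<^sub>R h k *\<^sub>R v"] by simp
      then have "z - t *\<^sub>R h k *\<^sub>R v \<notin> ?Q"
        using R by blast
      then show "indicator ?Q (z - t *\<^sub>R h k *\<^sub>R v) = 0"
        by simp
    qed
    with False show ?thesis by (simp add: s)
  qed
  have lim: "(\<lambda>k. s k z) \<longlonglongrightarrow> indicator ?Q z *\<^sub>R v" if z: "z \<notin> frontier ?Q" for z
  proof (rule tendsto_eventually)
    \<comment> \<open>Away from the frontier the indicator is locally constant, so the averages are
      eventually equal to the limit.\<close>
    obtain U where U: "open U" "z \<in> U" "\<And>y. y \<in> U \<Longrightarrow> indicator ?Q y = (indicator ?Q z :: real)"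
    proof (cases "z \<in> ?Q")
      case True
      then show ?thesis
        using that[OF open_box True] by simp
    next
      case False
      then have "z \<in> - closure ?Q"
        using z interior_subset[of ?Q] by (auto simp: frontier_def)
      moreover have "y \<notin> ?Q" if "y \<in> - closure ?Q" for y
        using that closure_subset by blast
      ultimately show ?thesis
        using False by (intro that[of "- closure ?Q"]) auto
    qed
    then obtain r where r: "r > 0" "ball z r \<subseteq> U"
      by (metis open_contains_ball)
    have "(\<lambda>k. h k * norm v) \<longlonglongrightarrow> 0 * norm v"
      by (intro tendsto_intros h_lim)
    then have "\<forall>\<^sub>F k in sequentially. h k * norm v < r"
      using r(1) by (auto dest: order_tendstoD(2))
    then show "\<forall>\<^sub>F k in sequentially. s k z = indicator ?Q z *\<^sub>R v"
    proof eventually_elim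
      case (elim k)
      have "m k z = indicator ?Q z"
      proof (rule m_const, rule U(3))
        fix t :: real
        assume "0 < t" "t < 1"
        then have "dist z (z - t *\<^sub>R h k *\<^sub>R v) < r"
          using near[of t k] elim by (simp add: dist_norm)
        then show "z - t *\<^sub>R h k *\<^sub>R v \<in> U"
          using r(2) by auto
      qed
      then show ?case by (simp add: s)
    qed
  qed
  have int_E: "integrable lebesgue (segment_density ?Q 0 d)" for d
    by (intro lebesgue_integrable_lborel segment_density(1) Q) simp
  show ?thesis
  proof (rule field_class_dominated_limit)
    show "integrable lebesgue (s k)" for k
      unfolding s_def using int_E by (intro integrable_scaleR_right)
    show "field_class (s k) \<in> point_span" for k
      unfolding s_def using int_E
      by (subst field_class_scaleR) (auto intro!: subspace_scale[OF subspace_point_span] translation_class_in_point_span Q)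
    show "(\<lambda>z. indicator ?Q z *\<^sub>R v) \<in> borel_measurable lebesgue"
      using integrable_indicator_vector[of ?Q v] by auto
    show "integrable lebesgue (\<lambda>z. indicator ?C z * norm v)"
      using integrable_indicator_vector[of ?C "norm v"] by simp
    have "AE z in lebesgue. z \<notin> frontier ?Q"
      using negligible_convex_frontier[OF convex_box(2), of a b] by (simp add: negligible_iff_null_sets AE_not_in)
    then show "AE z in lebesgue. (\<lambda>k. s k z) \<longlonglongrightarrow> indicator ?Q z *\<^sub>R v"
      by eventually_elim (rule lim)
    show "AE z in lebesgue. norm (s k z) \<le> indicator ?C z * norm v" for k
      using s_bound by simp
  qed
qed

text \<open>Induction over a generator stable under intersection: open boxes generate the Borel
  sets, and the intersection of two is a box. The fixed \<open>box a b\<close> keeps complements and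
  countable unions integrable.\<close>

lemma borel_class_in_point_span:
  fixes v :: "real^'n::finite"
  assumes "A \<in> sets borel"
  shows "field_class (\<lambda>z. indicator (A \<inter> box a b) z *\<^sub>R v) \<in> point_span"
proof -
  let ?C = "box a b"
  have int: "integrable lebesgue (\<lambda>z. indicator (B \<inter> ?C) z *\<^sub>R v)" if "B \<in> sets lebesgue" for B
    using that by (intro integrable_indicator_vector) (auto intro: bounded_subset[OF bounded_box])
  have "Int_stable (range (\<lambda>(a, b). box a b :: (real^'n) set))"
    by (auto simp: Int_stable_def box_Int_box)
  moreover have "range (\<lambda>(a, b). box a b :: (real^'n) set) \<subseteq> Pow UNIV"
    by auto
  moreover have "A \<in> sigma_sets UNIV (range (\<lambda>(a, b). box a b :: (real^'n) set))"
    using assms unfolding borel_eq_box by simp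
  ultimately show ?thesis
  proof (induction rule: sigma_sets_induct_disjoint)
    case (basic A)
    then show ?case
      by (auto simp: box_Int_box box_class_in_point_span)
  next
    case empty
    show ?case
      using subspace_0[OF subspace_point_span] by (simp add: field_class_zero)
  next
    case (compl A)
    then have "A \<in> sets borel"
      by (simp add: borel_eq_box)
    then have A: "A \<in> sets lebesgue" by simp
    have "(\<lambda>z. indicator ((UNIV - A) \<inter> ?C) z *\<^sub>R v) = (\<lambda>z. indicator ?C z *\<^sub>R v - indicator (A \<inter> ?C) z *\<^sub>R v)"
      by (auto simp: indicator_def fun_eq_iff)
    then show ?case
      using compl.IH int[OF A] int[of UNIV]
      by (simp add: field_class_diff subspace_diff[OF subspace_point_span box_class_in_point_span])
  next
    case (union A)
    have A: "A i \<in> sets lebesgue" for i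
    proof -
      have "A i \<in> sets borel"
        using union.hyps(2) by (auto simp: borel_eq_box)
      then show ?thesis by simp
    qed
    let ?s = "\<lambda>k z. \<Sum>i<k. indicator (A i \<inter> ?C) z *\<^sub>R v"
    have s_eq: "?s k z = indicator ((\<Union>i<k. A i) \<inter> ?C) z *\<^sub>R v" for k z
    proof -
      have "(\<Sum>i<k. indicator (A i) z) = (indicator (\<Union>i<k. A i) z :: real)"
        using union.hyps(1) by (subst indicator_UN_disjoint) (auto simp: disjoint_family_on_def)
      then show ?thesis
        by (simp add: indicator_inter_arith flip: scaleR_left.sum sum_distrib_right)
    qed
    show ?case
    proof (rule field_class_dominated_limit)
      show "integrable lebesgue (?s k)" for k
        by (intro Bochner_Integration.integrable_sum int A)
      show "field_class (?s k) \<in> point_span" for k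
      proof (induction k)
        case 0
        show ?case
          using subspace_0[OF subspace_point_span] by (simp add: field_class_zero)
      next
        case (Suc k)
        have "field_class (?s (Suc k)) = field_class (?s k) + field_class (\<lambda>z. indicator (A k \<inter> ?C) z *\<^sub>R v)"
          unfolding sum.lessThan_Suc by (intro field_class_add Bochner_Integration.integrable_sum int A)
        then show ?case
          using Suc union.IH[of k] subspace_add[OF subspace_point_span] by simp
      qed
      show "(\<lambda>z. indicator (\<Union> (range A) \<inter> ?C) z *\<^sub>R v) \<in> borel_measurable lebesgue"
        using int[of "\<Union> (range A)"] A by auto
      show "integrable lebesgue (\<lambda>z. indicator ?C z *\<^sub>R norm v)"
        by (intro integrable_indicator_vector) auto
      show "AE z in lebesgue. (\<lambda>k. ?s k z) \<longlonglongrightarrow> indicator (\<Union> (range A) \<inter> ?C) z *\<^sub>R v"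
      proof (rule AE_I2, rule tendsto_eventually)
        fix z
        obtain i where i: "z \<in> \<Union> (range A) \<longrightarrow> z \<in> A i"
          by blast
        show "\<forall>\<^sub>F k in sequentially. ?s k z = indicator (\<Union> (range A) \<inter> ?C) z *\<^sub>R v"
          using eventually_gt_at_top[of i] unfolding s_eq by eventually_elim (use i in \<open>auto simp: indicator_def\<close>)
      qed
      show "AE z in lebesgue. norm (?s k z) \<le> indicator ?C z *\<^sub>R norm v" for k
        unfolding s_eq by (auto simp: indicator_def)
    qed
  qed
qed

lemma point_span_UNIV: "point_span = (UNIV :: 'n::finite L1_mod_div_free set)"
proof (intro set_eqI iffI UNIV_I)
  fix q :: "'n L1_mod_div_free"
  obtain f where f: "integrable lebesgue f" "q = field_class f"
    by (rule field_class_cases)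
  from f(1) have "field_class f \<in> point_span"
  proof (induction rule: integrable_induct)
    case (base A v)
    then have A: "A \<in> sets lebesgue" by simp
    \<comment> \<open>The induction supplies a Lebesgue set. Its main part is Borel and differs from
      it by a null set, and the growing cubes \<open>?C k\<close> reduce it to bounded
      pieces.\<close>
    let ?B = "main_part lborel A" and ?C = "\<lambda>k. box (\<chi> i. - real k) (\<chi> i. real k) :: (real^'n) set"
    have B: "?B \<in> sets borel"
      using main_part_sets[OF A] by simp
    show ?case
    proof (rule field_class_dominated_limit)
      let ?s = "\<lambda>k z. indicator (?B \<inter> ?C k) z *\<^sub>R v"
      show "integrable lebesgue (?s k)" for k
        using B by (intro integrable_indicator_vector) (auto intro: bounded_subset[OF bounded_box])
      show "field_class (?s k) \<in> point_span" for k
        by (rule borel_class_in_point_span[OF B])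
      show int: "integrable lebesgue (\<lambda>z. norm (indicator A z *\<^sub>R v))"
        using base by (intro integrable_norm integrable_scaleR_left integrable_real_indicator)
      show "(\<lambda>z. indicator A z *\<^sub>R v) \<in> borel_measurable lebesgue"
        using A by measurable
      have AB: "A = ?B \<union> null_part lborel A"
        using main_part_null_part_Un[OF A] by simp
      obtain N where N: "N \<in> null_sets lborel" "null_part lborel A \<subseteq> N"
        using null_part[OF A] by blast
      have "AE z in lebesgue. z \<notin> N"
        using N(1) by (intro AE_not_in null_sets_completionI)
      then have ae: "AE z in lebesgue. z \<in> A \<longleftrightarrow> z \<in> ?B"
        by eventually_elim (use AB N(2) in blast)
      show "AE z in lebesgue. (\<lambda>k. ?s k z) \<longlonglongrightarrow> indicator A z *\<^sub>R v"
        using ae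
      proof eventually_elim
        case (elim z)
        obtain j :: nat where j: "norm z < real j"
          using reals_Archimedean2 by blast
        show ?case
        proof (rule tendsto_eventually)
          show "\<forall>\<^sub>F k in sequentially. ?s k z = indicator A z *\<^sub>R v"
            using eventually_ge_at_top[of j]
          proof eventually_elim
            case k: (elim k)
            have "- real k < z $ i \<and> z $ i < real k" for i
              using j k component_le_norm_cart[of z i] by (simp add: abs_le_iff)
            then have "z \<in> ?C k"
              by (simp add: mem_box_cart)
            then show ?case
              using elim by (simp add: indicator_def)
          qed
        qed
      qed
      show "AE z in lebesgue. norm (?s k z) \<le> norm (indicator A z *\<^sub>R v)" for k
        using ae by eventually_elim (auto simp: indicator_def)
    qed
  next
    case (add f g)
    then show ?case
      using subspace_add[OF subspace_point_span] by (simp add: field_class_add)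
  next
    case (lim f s)
    show ?case
    proof (rule field_class_dominated_limit)
      \<comment> \<open>The factor 2 is the bound that \<open>integrable_induct\<close> provides for
        the approximating functions.\<close>
      show "integrable lebesgue (\<lambda>x. 2 * norm (f x))"
        using lim by simp
      show "AE x in lebesgue. (\<lambda>k. s k x) \<longlonglongrightarrow> f x"
        using lim by auto
      show "AE x in lebesgue. norm (s k x) \<le> 2 * norm (f x)" for k
        using lim by auto
    qed (use lim in auto)
  qed
  then show "q \<in> point_span"
    by (simp add: f)
qed


section \<open>The duality\<close>

lemma lip0_fun_lipschitz: "(norm f)-lipschitz_on UNIV (lip0_fun f)"
  using lip0_fun_diff_le by (intro lipschitz_onI) (simp_all add: dist_norm)

lemma lip0_fun_0: "lip0_fun f 0 = 0"
  using lip0_fun[of f] by simp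

lemma lip0_fun_add: "lip0_fun (f + g) x = lip0_fun f x + lip0_fun g x"
  by transfer simp

lemma lip0_fun_scaleR: "lip0_fun (c *\<^sub>R f) x = c * lip0_fun f x"
  by transfer simp

lemma blinfun_eq_on_closure_span:
  fixes F G :: "'a::real_normed_vector \<Rightarrow>\<^sub>L 'b::real_normed_vector"
  assumes "\<And>x. x \<in> S \<Longrightarrow> F x = G x" and "closure (span S) = UNIV"
  shows "F = G"
proof (rule blinfun_eqI)
  fix x
  have "closed {x. F x = G x}"
    by (intro closed_Collect_eq linear_continuous_on blinfun.bounded_linear_right)
  moreover have "F x = G x" if "x \<in> span S" for x
    by (rule linear_eq_on_span[OF _ _ assms(1) that]) (auto intro: bounded_linear.linear blinfun.bounded_linear_right)
  ultimately have "closure (span S) \<subseteq> {x. F x = G x}"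
    by (intro closure_minimal) auto
  then show "F x = G x"
    using assms(2) by blast
qed

text \<open>On the span of the point classes the pairings are finite combinations of
  \<open>\<phi> k x - \<phi> k 0\<close>, which converge. The functionals are bounded by
  \<open>L\<close> uniformly in \<open>k\<close>, so convergence extends to the closure of that
  span.\<close>

lemma pairing_limit_exists:
  fixes \<phi> :: "nat \<Rightarrow> real^'n::finite \<Rightarrow> real"
  assumes \<phi>: "\<And>k. test_function (\<phi> k)" "\<And>k. L-lipschitz_on UNIV (\<phi> k)"
    and lim: "\<And>x. (\<lambda>k. \<phi> k x) \<longlonglongrightarrow> f x"
  shows "convergent (\<lambda>k. pairing q (\<phi> k))"
proof -
  note L = lipschitz_on_nonneg[OF \<phi>(2)]
  have sp: "convergent (\<lambda>k. pairing v (\<phi> k))" if "v \<in> span (range point_class)" for v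
    using that
  proof (induction rule: span_induct_alt)
    case base
    then show ?case
      using pairing_scaleR[OF \<phi>(1), of 0 0] by (simp add: convergent_const)
  next
    case (step c p v)
    then obtain x where x: "p = point_class x" by blast
    have "convergent (\<lambda>k. \<phi> k x - \<phi> k 0)"
      using tendsto_diff[OF lim lim] by (rule convergentI)
    then have "convergent (\<lambda>k. c * (\<phi> k x - \<phi> k 0) + pairing v (\<phi> k))"
      using step by (intro convergent_add convergent_mult convergent_const)
    then show ?case
      using \<phi>(1) by (simp add: x pairing_add pairing_scaleR pairing_point_class)
  qed
  have "Cauchy (\<lambda>k. pairing q (\<phi> k))"
  proof (rule metric_CauchyI)
    fix e :: real
    assume e: "e > 0"
    \<comment> \<open>Replacing \<open>q\<close> by \<open>v\<close> costs at most
      \<open>L * d \<le> e / 3\<close> at each of the two indices; \<open>L + 1\<close> avoids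
      division by zero.\<close>
    define d where "d = e / (3 * (L + 1))"
    have d: "d > 0" "L * d \<le> e / 3"
      using e L by (auto simp: d_def field_simps)
    have "q \<in> point_span"
      by (simp add: point_span_UNIV)
    then obtain v where v: "v \<in> span (range point_class)" "norm (v - q) < d"
      using d(1) unfolding closure_approachable dist_norm by blast
    obtain M where M: "\<And>m n. m \<ge> M \<Longrightarrow> n \<ge> M \<Longrightarrow> dist (pairing v (\<phi> m)) (pairing v (\<phi> n)) < e / 3"
      using metric_CauchyD[OF convergent_Cauchy[OF sp[OF v(1)]], of "e / 3"] e by auto
    have close: "\<bar>pairing v (\<phi> m) - pairing q (\<phi> m)\<bar> \<le> e / 3" for m
    proof -
      have "\<bar>pairing v (\<phi> m) - pairing q (\<phi> m)\<bar> \<le> L * norm (v - q)"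
        using abs_pairing_le[OF \<phi>, of "v - q" m] by (simp add: pairing_diff[OF \<phi>(1)])
      also have "\<dots> \<le> L * d"
        using v(2) L by (intro mult_left_mono) auto
      finally show ?thesis
        using d(2) by linarith
    qed
    have "dist (pairing q (\<phi> m)) (pairing q (\<phi> n)) < e" if "m \<ge> M" "n \<ge> M" for m n
      using close[of m] close[of n] M[OF that] unfolding dist_real_def by linarith
    then show "\<exists>M. \<forall>m\<ge>M. \<forall>n\<ge>M. dist (pairing q (\<phi> m)) (pairing q (\<phi> n)) < e"
      by blast
  qed
  then show ?thesis
    by (rule Cauchy_convergent)
qed

text \<open>The smooth approximants share the constant \<open>norm f\<close>, so the norm bound
  survives the limit.\<close>

lemma lip0_functional_exists:
  fixes f :: "(real^'n::finite) lip0"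
  shows "\<exists>\<Psi> :: 'n L1_mod_div_free \<Rightarrow>\<^sub>L real. norm \<Psi> \<le> norm f \<and> (\<forall>x. blinfun_apply \<Psi> (point_class x) = lip0_fun f x)"
proof -
  obtain \<phi> where \<phi>: "\<And>k. test_function (\<phi> k)" "\<And>k. (norm f)-lipschitz_on UNIV (\<phi> k)"
    and lim: "\<And>x. (\<lambda>k. \<phi> k x) \<longlonglongrightarrow> lip0_fun f x"
    using lipschitz_test_function_approx[OF lip0_fun_lipschitz lip0_fun_0] by blast
  define \<Psi> where "\<Psi> q = lim (\<lambda>k. pairing q (\<phi> k))" for q
  have \<Psi>: "(\<lambda>k. pairing q (\<phi> k)) \<longlonglongrightarrow> \<Psi> q" for q
    using pairing_limit_exists[OF \<phi> lim] unfolding \<Psi>_def by (simp add: convergent_LIMSEQ_iff)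
  have bound: "\<bar>\<Psi> q\<bar> \<le> norm f * norm q" for q
    using abs_pairing_le[OF \<phi>] by (intro LIMSEQ_le_const2[OF tendsto_rabs[OF \<Psi>]]) blast
  have "bounded_linear \<Psi>"
  proof (rule bounded_linear_intro)
    show "\<Psi> (p + q) = \<Psi> p + \<Psi> q" for p q
      using LIMSEQ_unique[OF \<Psi>[of "p + q"]] tendsto_add[OF \<Psi>[of p] \<Psi>[of q]] \<phi>(1) by (simp add: pairing_add)
    show "\<Psi> (c *\<^sub>R q) = c *\<^sub>R \<Psi> q" for c q
      using LIMSEQ_unique[OF \<Psi>[of "c *\<^sub>R q"]] tendsto_mult[OF tendsto_const[of c] \<Psi>[of q]] \<phi>(1)
      by (simp add: pairing_scaleR)
    show "norm (\<Psi> q) \<le> norm q * norm f" for q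
      using bound[of q] by (simp add: mult.commute)
  qed
  then have app: "blinfun_apply (Blinfun \<Psi>) = \<Psi>"
    by (rule bounded_linear_Blinfun_apply)
  have "\<Psi> (point_class x) = lip0_fun f x" for x
    using LIMSEQ_unique[OF \<Psi>[of "point_class x"]] tendsto_diff[OF lim[of x] lim[of 0]] \<phi>(1)
    by (simp add: pairing_point_class lip0_fun_0)
  moreover have "norm (Blinfun \<Psi>) \<le> norm f"
    using bound by (intro norm_blinfun_bound) (auto simp: app)
  ultimately show ?thesis
    by (intro exI[of _ "Blinfun \<Psi>"]) (simp add: app)
qed

text \<open>Classically this is integration against the almost everywhere gradient of
  \<open>f\<close>. Its values at the point classes determine it by density, so the choice is
  harmless.\<close>

definition lip0_functional :: "(real^'n::finite) lip0 \<Rightarrow> 'n L1_mod_div_free \<Rightarrow>\<^sub>L real"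
  where "lip0_functional f = (SOME \<Psi> :: 'n L1_mod_div_free \<Rightarrow>\<^sub>L real. norm \<Psi> \<le> norm f \<and> (\<forall>x. blinfun_apply \<Psi> (point_class x) = lip0_fun f x))"

lemma norm_lip0_functional_le: "norm (lip0_functional f) \<le> norm f"
  and lip0_functional_point: "lip0_functional f (point_class x) = lip0_fun f x"
  using someI_ex[OF lip0_functional_exists[of f]] by (simp_all add: lip0_functional_def)

text \<open>Linearity and surjectivity of \<open>lip0_functional\<close> both reduce to this
  uniqueness.\<close>

lemma lip0_functional_eqI:
  fixes \<Psi> :: "'n::finite L1_mod_div_free \<Rightarrow>\<^sub>L real"
  assumes "\<And>x. \<Psi> (point_class x) = lip0_fun f x"
  shows "lip0_functional f = \<Psi>"
  using point_span_UNIV by (intro blinfun_eq_on_closure_span[of "range point_class"]) (auto simp: assms lip0_functional_point)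

text \<open>For the lower bound the functional is tested on dipoles
  \<open>point_class x - point_class y\<close>, whose norm is at most \<open>norm (x - y)\<close>;
  here the sharp dipole bound enters.\<close>

lemma norm_lip0_functional: "norm (lip0_functional f) = norm f"
proof (rule antisym)
  show "norm f \<le> norm (lip0_functional f)"
    unfolding norm_lip0.rep_eq
  proof (rule lip_const_le)
    fix x y
    have "\<bar>lip0_fun f x - lip0_fun f y\<bar> = norm (lip0_functional f (point_class x - point_class y))"
      by (simp add: blinfun.diff_right lip0_functional_point)
    also have "\<dots> \<le> norm (lip0_functional f) * norm (point_class x - point_class y)"
      by (rule norm_blinfun)
    also have "\<dots> \<le> norm (lip0_functional f) * norm (x - y)"
      by (intro mult_left_mono norm_point_class_diff) simp
    finally show "\<bar>lip0_fun f x - lip0_fun f y\<bar> \<le> norm (lip0_functional f) * norm (x - y)" .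
  qed
qed (rule norm_lip0_functional_le)

lemma linear_lip0_functional: "linear lip0_functional"
  by (intro linearI lip0_functional_eqI)
    (simp_all add: blinfun.add_left blinfun.scaleR_left lip0_functional_point lip0_fun_add lip0_fun_scaleR)

lemma surj_lip0_functional: "surj lip0_functional"
proof (rule surjI)
  fix \<Psi> :: "'n::finite L1_mod_div_free \<Rightarrow>\<^sub>L real"
  let ?f = "\<lambda>x. \<Psi> (point_class x)"
  have "(norm \<Psi>)-lipschitz_on UNIV ?f"
  proof (rule lipschitz_onI)
    fix x y
    have "dist (?f x) (?f y) \<le> norm \<Psi> * norm (point_class x - point_class y)"
      using norm_blinfun[of \<Psi> "point_class x - point_class y"] by (simp add: dist_norm blinfun.diff_right)
    also have "\<dots> \<le> norm \<Psi> * dist x y"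
      unfolding dist_norm by (intro mult_left_mono norm_point_class_diff) simp
    finally show "dist (?f x) (?f y) \<le> norm \<Psi> * dist x y" .
  qed simp
  then have "lip0_fun (Lip0 ?f) = ?f"
    by (intro Lip0_inverse) (auto simp: point_class_0)
  then show "lip0_functional (Lip0 ?f) = \<Psi>"
    by (intro lip0_functional_eqI) simp
qed

text \<open>The canonical map into the bidual, with the dual of the quotient replaced by
  \<open>lip0\<close> through \<open>lip0_functional\<close>.\<close>

lift_definition evaluation :: "'n::finite L1_mod_div_free \<Rightarrow> (real^'n) lip0 \<Rightarrow>\<^sub>L real"
  is "\<lambda>q f. lip0_functional f q"
proof (rule bounded_linear_intro)
  fix q :: "'n L1_mod_div_free" and f g :: "(real^'n) lip0" and c :: real
  show "lip0_functional (f + g) q = lip0_functional f q + lip0_functional g q"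
    by (simp add: linear_add[OF linear_lip0_functional] blinfun.add_left)
  show "lip0_functional (c *\<^sub>R f) q = c *\<^sub>R lip0_functional f q"
    by (simp add: linear_scale[OF linear_lip0_functional] blinfun.scaleR_left)
  show "norm (lip0_functional f q) \<le> norm f * norm q"
    using norm_blinfun[of "lip0_functional f" q] by (simp add: norm_lip0_functional)
qed

lemma linear_evaluation: "linear evaluation"
  by (intro linearI blinfun_eqI) (simp_all add: evaluation.rep_eq blinfun.add_right blinfun.scaleR_right
    blinfun.add_left blinfun.scaleR_left)

lemma norm_evaluation: "norm (evaluation q) = norm q"
proof (rule antisym)
  show "norm (evaluation q) \<le> norm q"
    using norm_blinfun[of "lip0_functional _" q]
    by (intro norm_blinfun_bound) (simp_all add: evaluation.rep_eq norm_lip0_functional mult.commute)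
  obtain \<Psi> :: "'a L1_mod_div_free \<Rightarrow>\<^sub>L real" where \<Psi>: "norm \<Psi> \<le> 1" "\<Psi> q = norm q"
    by (rule norming_functional)
  \<comment> \<open>Surjectivity realises the norming functional by a Lipschitz function, whose norm
    is then at most 1.\<close>
  obtain f where f: "\<Psi> = lip0_functional f"
    using surj_lip0_functional by (rule surjE)
  have "norm q = evaluation q f"
    using \<Psi>(2) by (simp add: f evaluation.rep_eq)
  also have "\<dots> \<le> norm (evaluation q) * norm f"
    using norm_blinfun[of "evaluation q" f] by simp
  also have "\<dots> \<le> norm (evaluation q) * 1"
    using \<Psi>(1) by (intro mult_left_mono) (simp_all add: f norm_lip0_functional)
  finally show "norm q \<le> norm (evaluation q)" by simp
qed

lemma evaluation_point_class: "evaluation (point_class x) = delta x"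
  by (rule blinfun_eqI) (simp add: evaluation.rep_eq delta.rep_eq lip0_functional_point)

text \<open>One inclusion is continuity together with density of the point classes, whose images are
  the \<open>delta x\<close>. The other uses completeness of the quotient: an isometric image of a
  complete space is closed.\<close>

lemma range_evaluation: "range evaluation = (lipschitz_free :: ((real^'n::finite) lip0 \<Rightarrow>\<^sub>L real) set)"
proof
  have bl: "bounded_linear (evaluation :: 'n L1_mod_div_free \<Rightarrow> _)"
    by (rule bounded_linear_intro[where K = 1])
      (simp_all add: norm_evaluation linear_add[OF linear_evaluation] linear_scale[OF linear_evaluation])
  have span: "evaluation ` span (range point_class) = span (range (delta :: real^'n \<Rightarrow> _))"
    by (simp add: linear_span_image[OF linear_evaluation, symmetric] image_image evaluation_point_class)
  have "range evaluation = evaluation ` closure (span (range (point_class :: real^'n \<Rightarrow> _)))"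
    by (simp add: point_span_UNIV)
  also have "\<dots> \<subseteq> closure (evaluation ` span (range point_class))"
    by (intro continuous_image_closure_subset[OF _ subset_UNIV] linear_continuous_on[OF bl])
  finally show "range evaluation \<subseteq> (lipschitz_free :: ((real^'n) lip0 \<Rightarrow>\<^sub>L real) set)"
    by (simp add: span lipschitz_free_def)
  have "complete (range (evaluation :: 'n L1_mod_div_free \<Rightarrow> _))"
    by (rule complete_isometric_image[OF zero_less_one subspace_UNIV bl]) (auto simp: norm_evaluation complete_UNIV)
  then have "closed (range (evaluation :: 'n L1_mod_div_free \<Rightarrow> _))"
    by (rule complete_imp_closed)
  moreover have "span (range (delta :: real^'n \<Rightarrow> _)) \<subseteq> range evaluation"
    using span by blast
  ultimately show "(lipschitz_free :: ((real^'n) lip0 \<Rightarrow>\<^sub>L real) set) \<subseteq> range evaluation"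
    unfolding lipschitz_free_def by (rule closure_minimal[rotated])
qed

text \<open>The witnesses are \<open>evaluation\<close> and \<open>lip0_functional\<close>. A linear
  map that preserves norms is injective, so the range equations make them isometric
  isomorphisms.\<close>

theorem proposition3:
  shows "subspace (div_free_fields :: (real^'n::finite, real^'n) L1 set) \<and>
    closed (div_free_fields :: (real^'n, real^'n) L1 set) \<and>
    (\<exists>T :: 'n L1_mod_div_free \<Rightarrow> ((real^'n) lip0 \<Rightarrow>\<^sub>L real).
      linear T \<and> (\<forall>q. norm (T q) = norm q) \<and> range T = lipschitz_free) \<and>
    (\<exists>S :: (real^'n) lip0 \<Rightarrow> ('n L1_mod_div_free \<Rightarrow>\<^sub>L real).
      linear S \<and> (\<forall>f. norm (S f) = norm f) \<and> range S = UNIV)"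
  using subspace_div_free_fields closed_div_free_fields linear_evaluation norm_evaluation range_evaluation
    linear_lip0_functional norm_lip0_functional surj_lip0_functional
  by blast

end
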